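(* Let $R(t)\in SO(3)$ be the attitude of a rigid body with $\dot R=R\Omega^\times$. Consider the filter $$\begin{cases}\dot{\hat R}=\hat R\hat\Omega^\times=\hat R(\Omega^m-\omega)^\times,\\ m\dot\omega=-m\hat\Omega\times\omega+\Phi'\big(\mathcal U^0(\hat R,U^m)\big)S_L(\hat R)-D\omega,\\ \hat\Omega=\Omega^m-\omega,\end{cases}$$ with $m>0$ a scalar, $D\in\mathbb R^{3\times3}$ positive definite, $L=EW(U^m)^T$, $S_L(\hat R)=\mathrm{vex}(L^T\hat R-\hat R^TL)$, and with distinct positive eigenvalues for $K=EWE^T$. Let $Q=R\hat R^T$. Then this filter is asymptotically stable at the estimation error state $(Q,\omega)=(I,0)$ in the absence of measurement noise. Further, the domain of attraction of $(Q,\omega)=(I,0)$ is a dense open subset of $SO(3)\times\mathbb R^3$.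
   Context: $a^\times$ is the skew-symmetric matrix with $a^\times c=a\times c$ and $\mathrm{vex}:\mathfrak{so}(3)\to\mathbb R^3$ is the inverse of $a\mapsto a^\times$. $\langle A_1,A_2\rangle=\mathrm{trace}(A_1^TA_2)$. $E\in\mathbb R^{3\times n}$ is the rank-3 matrix whose columns are the known inertial vectors being measured (at least two; the cross product of the two vectors is added as a third column when only two are measured), $U^m\in\mathbb R^{3\times n}$ is the matrix of the corresponding vectors measured in the body frame, and $\Omega^m$ is the measured angular velocity. Absence of measurement noise means $U^m=R^TE$ and $\Omega^m=\Omega$. $W\in\mathbb R^{n\times n}$ is a positive definite weight matrix of the following form: if $E=U_E\Sigma_EV_E^T$ is a singular value decomposition with singular values $\sigma_1,\sigma_2,\sigma_3>0$, then $W=V_EW_0V_E^T$ with $W_0$ diagonal with positive diagonal entries, the first three being $d_i/\sigma_i^2$ with $d_i>0$; then $K=EWE^T$ has eigenvalues $d_1,d_2,d_3$. $\mathcal U^0(\hat R,U^m)=\frac12\langle E-\hat RU^m,(E-\hat RU^m)W\rangle$. $\Phi:[0,\infty)\to[0,\infty)$ is a $C^2$ function with $\Phi(0)=0$ and $\Phi'(x)>0$ for all $x\in[0,\infty)$; furthermore $\Phi'(\cdot)\le\alpha(\cdot)$ where $\alpha(\cdot)$ is a Class-$\mathcal K$ function.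
   Formalization: The conditions Φ'>0 on [0,∞) and Φ'≤α with α of class K conflict at 0, since α(0)=0; the formal theorem assumes instead either Φ'>0 on [0,∞) with no bound by α, or Φ'>0 on (0,∞) together with Φ'≤α. *)

theory Defs
  imports "HOL-Analysis.Analysis"
begin

text \<open>Matrices with \<open>r\<close> rows and \<open>c\<close> columns have type \<open>real^'c^'r\<close>.\<close>

definition SO3 :: "(real^3^3) set" where
  "SO3 = {A. rotation_matrix A}"

definition skew :: "real^3 \<Rightarrow> real^3^3" where
  "skew a = matrix (cross3 a)"

lemma skew_mult: "skew a *v c = cross3 a c"
  by (simp add: skew_def matrix_def matrix_vector_mult_def axis_def cross3_simps forall_3)

text \<open>Only meaningful on skew-symmetric matrices, the range of \<open>skew\<close>.\<close>

definition vex :: "real^3^3 \<Rightarrow> real^3" where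
  "vex = inv skew"

lemma vex_skew: "vex (skew a) = a"
proof -
  have "inj skew"
  proof (rule injI)
    fix a b :: "real^3"
    assume "skew a = skew b"
    then have "cross3 a c = cross3 b c" for c
      by (metis skew_mult)
    from this[of "axis 1 1"] this[of "axis 2 1"] show "a = b"
      by (simp add: cross3_simps axis_def forall_3)
  qed
  then show ?thesis
    by (simp add: vex_def)
qed

definition frob_inner :: "real^'n^'m \<Rightarrow> real^'n^'m \<Rightarrow> real" where
  "frob_inner A B = trace (transpose A ** B)"

text \<open>Symmetry is deliberately not part of the definition.  It is only used in hypotheses, so it
  covers both conventions for the gain \<open>D\<close>; the weight \<open>W\<close> is symmetric by its prescribed form.\<close>

definition positive_definite :: "real^'n^'n \<Rightarrow> bool" where
  "positive_definite A \<longleftrightarrow> (\<forall>x. x \<noteq> 0 \<longrightarrow> 0 < x \<bullet> (A *v x))"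

definition diagonal :: "real^'n^'n \<Rightarrow> bool" where
  "diagonal A \<longleftrightarrow> (\<forall>i j. i \<noteq> j \<longrightarrow> A $ i $ j = 0)"

definition eigenvalues :: "real^'n^'n \<Rightarrow> real set" where
  "eigenvalues A = {k. \<exists>v. v \<noteq> 0 \<and> A *v v = k *\<^sub>R v}"

definition distinct_positive_eigenvalues :: "real^'n^'n \<Rightarrow> bool" where
  "distinct_positive_eigenvalues A \<longleftrightarrow>
     card (eigenvalues A) = CARD('n) \<and> (\<forall>k\<in>eigenvalues A. 0 < k)"

text \<open>Singular value decomposition \<open>E = U \<Sigma> V\<^sup>T\<close> of a \<open>3 \<times> n\<close> matrix of rank 3.  The column
  index type \<open>'n\<close> carries no order; the injection \<open>\<iota>\<close> names its first three
  elements, so that \<open>\<Sigma>\<close> has the entry \<open>\<sigma> i\<close> at \<open>(i, \<iota> i)\<close> and zeros elsewhere.\<close>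

definition is_svd ::
  "real^'n^3 \<Rightarrow> (3 \<Rightarrow> 'n) \<Rightarrow> real^3^3 \<Rightarrow> (3 \<Rightarrow> real) \<Rightarrow> real^'n^'n \<Rightarrow> bool" where
  "is_svd E \<iota> U \<sigma> V \<longleftrightarrow>
     inj \<iota> \<and> orthogonal_matrix U \<and> orthogonal_matrix V \<and> (\<forall>i. 0 < \<sigma> i) \<and>
     E = U ** (\<chi> i j. if j = \<iota> i then \<sigma> i else 0) ** transpose V"

definition admissible_weight :: "real^'n^3 \<Rightarrow> real^'n^'n \<Rightarrow> bool" where
  "admissible_weight E W \<longleftrightarrow>
     positive_definite W \<and>
     (\<exists>\<iota> U \<sigma> V d W0. is_svd E \<iota> U \<sigma> V \<and> (\<forall>i. 0 < d i) \<and>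
        diagonal W0 \<and> (\<forall>j. 0 < W0 $ j $ j) \<and> (\<forall>i. W0 $ \<iota> i $ \<iota> i = d i / (\<sigma> i)\<^sup>2) \<and>
        W = V ** W0 ** transpose V)"

definition U0 :: "real^'n^3 \<Rightarrow> real^'n^'n \<Rightarrow> real^3^3 \<Rightarrow> real^'n^3 \<Rightarrow> real" where
  "U0 E W Rhat Um = 1/2 * frob_inner (E - Rhat ** Um) ((E - Rhat ** Um) ** W)"

definition SL :: "real^3^3 \<Rightarrow> real^3^3 \<Rightarrow> real^3" where
  "SL L Rhat = vex (transpose L ** Rhat - transpose Rhat ** L)"

definition class_K :: "(real \<Rightarrow> real) \<Rightarrow> bool" where
  "class_K \<alpha> \<longleftrightarrow> continuous_on {0..} \<alpha> \<and> strict_mono_on {0..} \<alpha> \<and> \<alpha> 0 = 0"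

text \<open>\<open>\<Phi>\<close> is a \<open>C\<^sup>2\<close> function from \<open>[0, \<infinity>)\<close> to itself with derivative \<open>\<Phi>'\<close>
  (one-sided at 0) and \<open>\<Phi> 0 = 0\<close>.

  The two further requirements usually made, \<open>\<Phi>' > 0\<close> on all of \<open>[0, \<infinity>)\<close> and \<open>\<Phi>' \<le> \<alpha>\<close> for
  a class K function \<open>\<alpha>\<close>, contradict each other at 0, since \<open>\<alpha> 0 = 0\<close>.  To avoid a vacuous notion
  the final disjunction accepts either repair: \<open>\<Phi>' > 0\<close> everywhere without the class K bound
  (e.g. \<open>\<Phi> x = x\<close>), or the class K bound with \<open>\<Phi>' > 0\<close> away from 0 (e.g. \<open>\<Phi> x = x\<^sup>2\<close>).
  Both requirements together imply each disjunct.\<close>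

definition admissible_potential :: "(real \<Rightarrow> real) \<Rightarrow> (real \<Rightarrow> real) \<Rightarrow> bool" where
  "admissible_potential \<Phi> \<Phi>' \<longleftrightarrow>
     (\<forall>x\<ge>0. 0 \<le> \<Phi> x) \<and> \<Phi> 0 = 0 \<and>
     (\<forall>x\<ge>0. (\<Phi> has_real_derivative \<Phi>' x) (at x within {0..})) \<and>
     (\<exists>\<Phi>''. (\<forall>x\<ge>0. (\<Phi>' has_real_derivative \<Phi>'' x) (at x within {0..})) \<and>
            continuous_on {0..} \<Phi>'') \<and>
     ((\<forall>x\<ge>0. 0 < \<Phi>' x) \<or>
      (\<forall>x>0. 0 < \<Phi>' x) \<and> (\<exists>\<alpha>. class_K \<alpha> \<and> (\<forall>x\<ge>0. \<Phi>' x \<le> \<alpha> x)))"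

definition filter_solution ::
  "real \<Rightarrow> real^3^3 \<Rightarrow> (real \<Rightarrow> real) \<Rightarrow> real^'n^3 \<Rightarrow> real^'n^'n \<Rightarrow>
   (real \<Rightarrow> real^'n^3) \<Rightarrow> (real \<Rightarrow> real^3) \<Rightarrow> real \<Rightarrow>
   (real \<Rightarrow> real^3^3) \<Rightarrow> (real \<Rightarrow> real^3) \<Rightarrow> bool" where
  "filter_solution m D \<Phi>' E W Um \<Omega>m t0 Rhat \<omega> \<longleftrightarrow>
     (\<forall>t\<ge>t0.
        let \<Omega>hat = \<Omega>m t - \<omega> t;
            L = E ** W ** transpose (Um t)
        in Rhat t \<in> SO3 \<and>
           (Rhat has_vector_derivative Rhat t ** skew \<Omega>hat) (at t within {t0..}) \<and>
           (\<exists>\<omega>'. (\<omega> has_vector_derivative \<omega>') (at t within {t0..}) \<and>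
              m *\<^sub>R \<omega>' = - m *\<^sub>R cross3 \<Omega>hat (\<omega> t)
                        + \<Phi>' (U0 E W (Rhat t) (Um t)) *\<^sub>R SL L (Rhat t)
                        - D *v \<omega> t))"

text \<open>In the error coordinates the filter is a non-autonomous system, driven by the true motion.
  Its trajectories from initial time \<open>t0\<close> are represented by functions on the reals, of which only
  the values on \<open>[t0, \<infinity>)\<close> matter.\<close>

definition error_trajectories ::
  "real \<Rightarrow> real^3^3 \<Rightarrow> (real \<Rightarrow> real) \<Rightarrow> real^'n^3 \<Rightarrow> real^'n^'n \<Rightarrow>
   (real \<Rightarrow> real^'n^3) \<Rightarrow> (real \<Rightarrow> real^3) \<Rightarrow> (real \<Rightarrow> real^3^3) \<Rightarrow> real \<Rightarrow>
   (real \<Rightarrow> (real^3^3) \<times> (real^3)) set" where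
  "error_trajectories m D \<Phi>' E W Um \<Omega>m R t0 =
     {\<lambda>t. (R t ** transpose (Rhat t), \<omega> t) | Rhat \<omega>.
        filter_solution m D \<Phi>' E W Um \<Omega>m t0 Rhat \<omega>}"

text \<open>Stability notions for a possibly non-autonomous system with state space \<open>X\<close> whose set of
  trajectories on \<open>[t0, \<infinity>)\<close> is \<open>T\<close>.  Existence of a trajectory is always demanded, so that
  the conditions on all trajectories from a given initial state are not vacuous.\<close>

definition lyapunov_stable ::
  "'a::metric_space set \<Rightarrow> (real \<Rightarrow> 'a) set \<Rightarrow> real \<Rightarrow> 'a \<Rightarrow> bool" where
  "lyapunov_stable X T t0 e \<longleftrightarrow>
     (\<forall>\<epsilon>>0. \<exists>\<delta>>0. \<forall>x0\<in>X. dist x0 e < \<delta> \<longrightarrow>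
        (\<exists>x\<in>T. x t0 = x0) \<and>
        (\<forall>x\<in>T. x t0 = x0 \<longrightarrow> (\<forall>t\<ge>t0. dist (x t) e < \<epsilon>)))"

definition domain_of_attraction ::
  "'a::metric_space set \<Rightarrow> (real \<Rightarrow> 'a) set \<Rightarrow> real \<Rightarrow> 'a \<Rightarrow> 'a set" where
  "domain_of_attraction X T t0 e =
     {x0\<in>X. (\<exists>x\<in>T. x t0 = x0) \<and> (\<forall>x\<in>T. x t0 = x0 \<longrightarrow> (x \<longlongrightarrow> e) at_top)}"

definition asymptotically_stable ::
  "'a::metric_space set \<Rightarrow> (real \<Rightarrow> 'a) set \<Rightarrow> real \<Rightarrow> 'a \<Rightarrow> bool" where
  "asymptotically_stable X T t0 e \<longleftrightarrow>
     lyapunov_stable X T t0 e \<and>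
     (\<exists>c>0. \<forall>x0\<in>X. dist x0 e < c \<longrightarrow> x0 \<in> domain_of_attraction X T t0 e)"

definition dense_open_in :: "'a::topological_space set \<Rightarrow> 'a set \<Rightarrow> bool" where
  "dense_open_in X A \<longleftrightarrow> openin (top_of_set X) A \<and> X \<subseteq> closure A"

end

theory Submission
  imports Defs
begin

text \<open>
  Diagonalise \<open>E W E\<^sup>T = U \<Lambda> U\<^sup>T\<close> with \<open>U\<close> a rotation and put \<open>P = U\<^sup>T Q U\<close>, \<open>z = U\<^sup>T R \<omega>\<close>. At every
  time this is an isometric change of the error state, and it removes the angular velocity of the
  body: \<open>P' = z\<^sup>\<times> P\<close>, \<open>m z' = \<Phi>'(V) \<tau>(P) - A z\<close>, where \<open>V(P) = \<Sum> d\<^sub>i (1 - P\<^sub>i\<^sub>i)\<close>, \<open>\<tau>\<close> is linear in \<open>P\<close>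
  with \<open>V' = - z \<bullet> \<tau>(P)\<close>, and \<open>A = U\<^sup>T R D R\<^sup>T U\<close> is continuous in time, bounded and coercive.

  The energy \<open>m |z|\<^sup>2 / 2 + \<Phi>(V)\<close> has derivative \<open>- z \<bullet> A z\<close>. By Barbalat's lemma \<open>z \<longrightarrow> 0\<close> and
  \<open>\<Phi>'(V) \<tau>(P) \<longrightarrow> 0\<close>. The zeros of \<open>\<tau>\<close> are the diagonal rotations, on which \<open>V\<close> takes distinct values,
  so every solution converges to one of them. Low energy leaves only the identity; this gives
  asymptotic stability and, by continuous dependence, an open domain of attraction.

  Near another equilibrium \<open>dmat e\<close> the difference \<open>(Z, w)\<close> of two solutions decreases the functional
  \<open>m |w|\<^sup>2 / 2 + \<phi> q(Z) / 2 - \<epsilon> m w \<bullet> \<tau>(Z)\<close> with \<open>q\<close> the indefinite form \<open>\<Sum> e\<^sub>i d\<^sub>i |row\<^sub>i Z|\<^sup>2\<close>, at the rate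
  \<open>|w|\<^sup>2 + |Z|\<^sup>2\<close>. So two solutions whose difference makes it negative cannot both stay near the
  equilibrium. Rotating the state at time \<open>T\<close> slightly and solving backwards shows that the initial
  states whose solutions leave the neighbourhood after time \<open>T\<close> are dense; they are also open, and the
  Baire property yields a dense domain of attraction. No stable manifold theorem is needed, and time
  dependence of \<open>A\<close> is harmless.
\<close>

section \<open>Differential inequalities and the Picard-Lindeloef theorem\<close>

text \<open>Barbalat's lemma replaces the former, the comparison of two solutions the latter.
  Damping acts on the velocity only; the cross term \<open>w \<bullet> \<tau>(Z)\<close> transfers
  some of it to the attitude, since its derivative contains \<open>\<phi> |\<tau>(Z)|^2\<close> and
  the torque is nondegenerate on tangent directions. That is the second use of distinct positive
  \<open>d\<close>, after isolating the equilibria and separating their energies. As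
  \<open>\<Phi>'\<close> may vanish at 0, local stability of the identity comes from the energy and
  not from a linearisation; at the other equilibria the potential is at least
  \<open>4 * d_min\<close>, so there \<open>\<phi>\<close> is positive. A solution that misses the
  identity converges to one of three half-turns and is trapped near it from some integer time on;
  three half-turns and countably many times are what the Baire property can handle.\<close>

lemma mvt_within:
  fixes f :: "real \<Rightarrow> real"
  assumes "s < t" "{s..t} \<subseteq> T"
    and "\<And>x. x \<in> T \<Longrightarrow> (f has_vector_derivative f' x) (at x within T)"
  obtains \<xi> where "s < \<xi>" "\<xi> < t" "f t - f s = (t - s) * f' \<xi>"
proof -
  have "\<exists>x\<in>{s<..<t}. f t - f s = (\<lambda>h. h * f' x) (t - s)"
  proof (rule mvt_simple[OF \<open>s < t\<close>])
    fix x assume "s \<le> x" "x \<le> t"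
    then have "(f has_vector_derivative f' x) (at x within {s..t})"
      using assms by (meson atLeastAtMost_iff has_vector_derivative_within_subset subsetD)
    then show "(f has_derivative (\<lambda>h. h * f' x)) (at x within {s..t})"
      by (simp add: has_vector_derivative_def)
  qed
  then show ?thesis using that by auto
qed

lemma nonincreasing_within:
  fixes f :: "real \<Rightarrow> real"
  assumes "s \<le> t" "{s..t} \<subseteq> T"
    and "\<And>x. x \<in> T \<Longrightarrow> (f has_vector_derivative f' x) (at x within T)"
    and "\<And>x. x \<in> {s..t} \<Longrightarrow> f' x \<le> 0"
  shows "f t \<le> f s"
proof (cases "s = t")
  case False
  then have "s < t" using assms by simp
  then obtain \<xi> where "s < \<xi>" "\<xi> < t" "f t - f s = (t - s) * f' \<xi>"
    using mvt_within[OF _ assms(2,3)] by metis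
  moreover have "(t - s) * f' \<xi> \<le> 0"
    using assms(4)[of \<xi>] \<open>s < t\<close> calculation by (simp add: mult_le_0_iff)
  ultimately show ?thesis by linarith
qed simp

text \<open>\<open>f\<close> times \<open>exp (- K x)\<close> is nonincreasing. Neither
  \<open>f\<close> nor \<open>K\<close> carries a sign: \<open>gronwall\<close> applies this to
  \<open>- f\<close> with rate \<open>- K\<close>, and \<open>forward_exists\<close> uses a negative
  rate to obtain decay.\<close>

lemma gronwall_forward:
  fixes f :: "real \<Rightarrow> real"
  assumes "s \<le> t" "{s..t} \<subseteq> T"
    and der: "\<And>x. x \<in> T \<Longrightarrow> (f has_vector_derivative f' x) (at x within T)"
    and le: "\<And>x. x \<in> {s..t} \<Longrightarrow> f' x \<le> K * f x"
  shows "f t \<le> f s * exp (K * (t - s))"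
proof -
  have "f t * exp (- (K * t)) \<le> f s * exp (- (K * s))"
  proof (rule nonincreasing_within[OF assms(1,2)])
    fix x assume "x \<in> T"
    show "((\<lambda>x. f x * exp (- (K * x))) has_vector_derivative (f' x - K * f x) * exp (- (K * x)))
           (at x within T)"
      using der[OF \<open>x \<in> T\<close>] unfolding has_real_derivative_iff_has_vector_derivative[symmetric]
      by (auto intro!: derivative_eq_intros simp: algebra_simps)
  next
    fix x assume "x \<in> {s..t}"
    then show "(f' x - K * f x) * exp (- (K * x)) \<le> 0"
      using le[of x] by (simp add: mult_nonpos_nonneg)
  qed
  then have "f t * exp (- (K * t)) * exp (K * t) \<le> f s * exp (- (K * s)) * exp (K * t)"
    by (simp add: mult_right_mono)
  then show ?thesis
    by (simp add: mult.assoc exp_minus_inverse exp_add[symmetric] algebra_simps)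
qed

text \<open>A bound on the modulus of \<open>f'\<close> controls \<open>f\<close> in both time
  directions, so \<open>s\<close> and \<open>t\<close> may come in either order; the crude exponent
  \<open>b - a\<close> covers both cases.\<close>

lemma gronwall:
  fixes f :: "real \<Rightarrow> real"
  assumes "s \<in> {a..b}" "t \<in> {a..b}"
    and der: "\<And>x. x \<in> {a..b} \<Longrightarrow> (f has_vector_derivative f' x) (at x within {a..b})"
    and le: "\<And>x. x \<in> {a..b} \<Longrightarrow> \<bar>f' x\<bar> \<le> K * f x"
    and "0 \<le> K" and nonneg: "\<And>x. x \<in> {a..b} \<Longrightarrow> 0 \<le> f x"
  shows "f t \<le> f s * exp (K * (b - a))"
proof (cases "s \<le> t")
  case True
  have "f t \<le> f s * exp (K * (t - s))"
    by (rule gronwall_forward[OF True _ der]) (use assms le in \<open>auto simp: abs_le_iff\<close>)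
  also have "\<dots> \<le> f s * exp (K * (b - a))"
    using assms by (auto intro!: mult_left_mono)
  finally show ?thesis .
next
  case False
  then have "t \<le> s" by simp
  have "- f s \<le> - f t * exp (- K * (s - t))"
    by (rule gronwall_forward[OF \<open>t \<le> s\<close>, where T = "{a..b}" and f' = "\<lambda>x. - f' x"])
      (use assms le in \<open>force simp: abs_le_iff intro!: derivative_intros\<close>)+
  then have "f t * exp (- K * (s - t)) \<le> f s" by simp
  then have "f t * exp (- K * (s - t)) * exp (K * (s - t)) \<le> f s * exp (K * (s - t))"
    by (simp add: mult_right_mono)
  then have "f t \<le> f s * exp (K * (s - t))"
    by (simp add: mult.assoc exp_add[symmetric])
  also have "\<dots> \<le> f s * exp (K * (b - a))"
    using assms by (auto intro!: mult_left_mono)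
  finally show ?thesis .
qed

text \<open>Successive approximation in an exponentially weighted norm: against
  \<open>exp (k (t - a))\<close> the integral operator contracts by 1/2 on every interval, however
  long. One iteration therefore serves the whole half-line.\<close>

lemma picard_lindeloef:
  fixes F :: "real \<Rightarrow> 'a::euclidean_space \<Rightarrow> 'a"
  assumes cont: "continuous_on ({a..} \<times> UNIV) (\<lambda>(t, x). F t x)"
    and lip: "\<And>t x y. t \<ge> a \<Longrightarrow> norm (F t x - F t y) \<le> L * norm (x - y)"
  obtains x where "x a = x0" "\<And>t. t \<ge> a \<Longrightarrow> (x has_vector_derivative F t (x t)) (at t within {a..})"
proof -
  have contF: "continuous_on {a..b} (\<lambda>s. F s (y s))" if "continuous_on {a..b} y" for y b
  proof -
    have "continuous_on {a..b} ((\<lambda>(t, x). F t x) \<circ> (\<lambda>s. (s, y s)))"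
      by (intro continuous_on_compose continuous_intros that continuous_on_subset[OF cont]) auto
    then show ?thesis by (simp add: o_def)
  qed
  \<comment> \<open>Integrating \<open>exp (k (s - a))\<close> gains a factor \<open>1 / k\<close>,
    and \<open>k >= 2 |L|\<close> turns the Lipschitz constant into at most 1/2; the added 1 keeps
    \<open>k\<close> positive.\<close>
  define k where "k = 2 * (\<bar>L\<bar> + 1)"
  have "k > 0" by (simp add: k_def)
  define X where "X n = rec_nat (\<lambda>_. x0) (\<lambda>_ y t. x0 + integral {a..t} (\<lambda>s. F s (y s))) n" for n
  have X0: "X 0 = (\<lambda>_. x0)" and XS: "X (Suc n) = (\<lambda>t. x0 + integral {a..t} (\<lambda>s. F s (X n s)))" for n
    by (simp_all add: X_def)
  have contX: "continuous_on {a..b} (X n)" for n b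
  proof (induction n)
    case (Suc n)
    show ?case unfolding XS
      by (intro continuous_intros indefinite_integral_continuous_1 integrable_continuous_real contF Suc)
  qed (simp add: X0)
  \<comment> \<open>The iterates do not depend on \<open>b\<close>, only the estimates do. Recording
    that \<open>x\<close> is their pointwise limit lets the solutions on different intervals be
    glued below.\<close>
  have "\<exists>x. \<forall>t\<in>{a..b}. (\<lambda>n. X n t) \<longlonglongrightarrow> x t \<and>
      (x has_vector_derivative F t (x t)) (at t within {a..b})" for b
  proof -
    obtain M where M: "\<And>s. s \<in> {a..b} \<Longrightarrow> norm (F s x0) \<le> M" "M \<ge> 0"
    proof -
      have "compact ((\<lambda>s. F s x0) ` {a..b})"
        by (intro compact_continuous_image contF) auto
      then obtain M where "\<And>s. s \<in> {a..b} \<Longrightarrow> norm (F s x0) \<le> M"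
        by (meson bounded_iff compact_imp_bounded imageI)
      then show ?thesis using that[of "max M 0"] by fastforce
    qed
    define C where "C = M / k"
    have "C \<ge> 0" using M \<open>k > 0\<close> by (simp add: C_def)
    have expint: "((\<lambda>s. c * exp (k * (s - a))) has_integral c / k * (exp (k * (t - a)) - 1)) {a..t}"
      if "a \<le> t" for c t
    proof -
      have "((\<lambda>s. c * exp (k * (s - a))) has_integral
          c / k * exp (k * (t - a)) - c / k * exp (k * (a - a))) {a..t}"
        by (rule fundamental_theorem_of_calculus[OF that])
          (use \<open>k > 0\<close> in \<open>auto intro!: derivative_eq_intros
            simp: has_real_derivative_iff_has_vector_derivative[symmetric]\<close>)
      then show ?thesis by (simp add: algebra_simps)
    qed
    have bound: "norm (X (Suc n) t - X n t) \<le> C * exp (k * (t - a)) * (1/2)^n"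
      if "t \<in> {a..b}" for n t
      using that
    proof (induction n arbitrary: t)
      case 0
      have "norm (integral {a..t} (\<lambda>s. F s x0)) \<le> integral {a..t} (\<lambda>s. M * exp (k * (s - a)))"
      proof (rule integral_norm_bound_integral)
        fix s assume "s \<in> {a..t}"
        then have "norm (F s x0) \<le> M * 1" "1 \<le> exp (k * (s - a))"
          using M 0 \<open>k > 0\<close> by auto
        then show "norm (F s x0) \<le> M * exp (k * (s - a))"
          using M(2) by (meson mult_left_mono order_trans)
      qed (auto intro!: integrable_continuous_real contF continuous_intros)
      also have "\<dots> = C * (exp (k * (t - a)) - 1)"
        using integral_unique[OF expint] 0 by (simp add: C_def)
      also have "\<dots> \<le> C * exp (k * (t - a))" using \<open>C \<ge> 0\<close> by (simp add: mult_left_mono)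
      finally show ?case by (simp add: X0 XS)
    next
      case (Suc n)
      let ?c = "C * (1/2)^n * \<bar>L\<bar>"
      have int: "(\<lambda>s. F s (X n s)) integrable_on {a..t}" for n
        by (intro integrable_continuous_real contF contX)
      have "X (Suc (Suc n)) t - X (Suc n) t
          = integral {a..t} (\<lambda>s. F s (X (Suc n) s)) - integral {a..t} (\<lambda>s. F s (X n s))"
        by (simp only: XS add_diff_cancel_left)
      then have "norm (X (Suc (Suc n)) t - X (Suc n) t)
          = norm (integral {a..t} (\<lambda>s. F s (X (Suc n) s) - F s (X n s)))"
        by (simp add: integral_diff[OF int int])
      also have "\<dots> \<le> integral {a..t} (\<lambda>s. ?c * exp (k * (s - a)))"
      proof (rule integral_norm_bound_integral)
        fix s assume s: "s \<in> {a..t}"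
        then have "norm (F s (X (Suc n) s) - F s (X n s)) \<le> L * norm (X (Suc n) s - X n s)"
          using lip by simp
        also have "\<dots> \<le> \<bar>L\<bar> * norm (X (Suc n) s - X n s)"
          by (simp add: mult_right_mono)
        also have "\<dots> \<le> \<bar>L\<bar> * (C * exp (k * (s - a)) * (1/2)^n)"
          using Suc s by (intro mult_left_mono) auto
        finally show "norm (F s (X (Suc n) s) - F s (X n s)) \<le> ?c * exp (k * (s - a))"
          by (simp add: mult_ac)
      qed (auto intro!: integrable_continuous_real continuous_intros integrable_diff contF contX)
      also have "\<dots> = ?c / k * (exp (k * (t - a)) - 1)"
        using integral_unique[OF expint] Suc.prems by simp
      also have "\<dots> \<le> (C * (1/2)^n * (1/2)) * (exp (k * (t - a)))"
      proof (rule mult_mono)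
        have "\<bar>L\<bar> / k \<le> 1/2" using \<open>k > 0\<close> by (simp add: k_def field_simps)
        then have "(C * (1/2)^n) * (\<bar>L\<bar> / k) \<le> (C * (1/2)^n) * (1/2)"
          using \<open>C \<ge> 0\<close> by (intro mult_left_mono) auto
        then show "?c / k \<le> C * (1/2)^n * (1/2)" by simp
      qed (use \<open>C \<ge> 0\<close> \<open>k > 0\<close> Suc.prems in auto)
      finally show ?case by (simp add: mult_ac)
    qed
    define x where "x t = x0 + (\<Sum>n. X (Suc n) t - X n t)" for t
    have "uniform_limit {a..b} (\<lambda>n t. \<Sum>i<n. X (Suc i) t - X i t)
        (\<lambda>t. \<Sum>n. X (Suc n) t - X n t) sequentially"
    proof (rule Weierstrass_m_test)
      show "norm (X (Suc n) t - X n t) \<le> C * exp (k * (b - a)) * (1/2)^n" if "t \<in> {a..b}" for n t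
      proof -
        have "C * exp (k * (t - a)) * (1/2)^n \<le> C * exp (k * (b - a)) * (1/2)^n"
          using that \<open>k > 0\<close> \<open>C \<ge> 0\<close> by (intro mult_right_mono mult_left_mono) auto
        then show ?thesis using bound[OF that, of n] by linarith
      qed
    qed (auto intro!: summable_mult summable_geometric)
    then have ul: "uniform_limit {a..b} X x sequentially"
    proof -
      assume u: "uniform_limit {a..b} (\<lambda>n t. \<Sum>i<n. X (Suc i) t - X i t)
        (\<lambda>t. \<Sum>n. X (Suc n) t - X n t) sequentially"
      have "uniform_limit {a..b} (\<lambda>n t. x0 + (\<Sum>i<n. X (Suc i) t - X i t)) x sequentially"
        unfolding x_def[abs_def] by (intro uniform_limit_intros u)
      moreover have "x0 + (\<Sum>i<n. X (Suc i) t - X i t) = X n t" for n t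
        by (subst sum_lessThan_telescope) (simp add: X0)
      ultimately show ?thesis by simp
    qed
    have contx: "continuous_on {a..b} x"
      by (rule uniform_limit_theorem[OF _ ul]) (auto simp: contX)
    have ulF: "uniform_limit {a..b} (\<lambda>n s. F s (X n s)) (\<lambda>s. F s (x s)) sequentially"
    proof (rule uniform_limitI)
      fix e :: real assume "e > 0"
      have "e / (\<bar>L\<bar> + 1) > 0" using \<open>e > 0\<close> by simp
      from uniform_limitD[OF ul this]
      show "\<forall>\<^sub>F n in sequentially. \<forall>s\<in>{a..b}. dist (F s (X n s)) (F s (x s)) < e"
      proof eventually_elim
        case (elim n)
        show ?case
        proof
          fix s assume s: "s \<in> {a..b}"
          then have "dist (X n s) (x s) < e / (\<bar>L\<bar> + 1)" using elim by simp
          then have "(\<bar>L\<bar> + 1) * dist (X n s) (x s) < e" by (simp add: field_simps)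
          moreover have "dist (F s (X n s)) (F s (x s)) \<le> L * dist (X n s) (x s)"
            using lip[of s "X n s" "x s"] s by (simp add: dist_norm)
          moreover have "L * dist (X n s) (x s) \<le> (\<bar>L\<bar> + 1) * dist (X n s) (x s)"
            by (intro mult_right_mono) auto
          ultimately show "dist (F s (X n s)) (F s (x s)) < e" by linarith
        qed
      qed
    qed
    have lim: "(\<lambda>n. X n t) \<longlonglongrightarrow> x t" if "t \<in> {a..b}" for t
      by (rule tendsto_uniform_limitI[OF ul that])
    have eq: "x t = x0 + integral {a..t} (\<lambda>s. F s (x s))" if t: "t \<in> {a..b}" for t
    proof -
      have "uniform_limit {a..t} (\<lambda>n s. F s (X n s)) (\<lambda>s. F s (x s)) sequentially"
        by (rule uniform_limit_on_subset[OF ulF]) (use t in auto)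
      then obtain I J where I: "\<And>n. ((\<lambda>s. F s (X n s)) has_integral I n) {a..t}"
        and J: "((\<lambda>s. F s (x s)) has_integral J) {a..t}" and IJ: "I \<longlonglongrightarrow> J"
        by (rule uniform_limit_integral) (auto intro: contF contX)
      have "X (Suc n) t = x0 + I n" for n
        using integral_unique[OF I[of n]] by (simp add: XS)
      then have "(\<lambda>n. X (Suc n) t) \<longlonglongrightarrow> x0 + J"
        using IJ by (auto intro!: tendsto_intros)
      moreover have "(\<lambda>n. X (Suc n) t) \<longlonglongrightarrow> x t"
        using lim[OF t] by (rule LIMSEQ_Suc)
      ultimately have "x t = x0 + J" by (rule LIMSEQ_unique[rotated])
      then show ?thesis using integral_unique[OF J] by simp
    qed
    have "(x has_vector_derivative F t (x t)) (at t within {a..b})" if t: "t \<in> {a..b}" for t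
    proof (rule has_vector_derivative_transform[OF t eq])
      show "((\<lambda>t. x0 + integral {a..t} (\<lambda>s. F s (x s))) has_vector_derivative F t (x t))
          (at t within {a..b})"
        using integral_has_vector_derivative[OF contF[OF contx] t]
        by (auto intro!: derivative_eq_intros)
    qed
    with lim show ?thesis by blast
  qed
  then obtain xb where xb: "\<And>b t. t \<in> {a..b} \<Longrightarrow> (\<lambda>n. X n t) \<longlonglongrightarrow> xb b t"
      "\<And>b t. t \<in> {a..b} \<Longrightarrow> (xb b has_vector_derivative F t (xb b t)) (at t within {a..b})"
    by metis
  define x where "x t = lim (\<lambda>n. X n t)" for t
  have x_eq: "x t = xb b t" if "t \<in> {a..b}" for b t
    using xb(1)[OF that] by (simp add: x_def limI)
  show ?thesis
  proof
    have "X n a = x0" for n by (cases n) (simp_all add: X0 XS)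
    then show "x a = x0" by (simp add: x_def)
    fix t assume "t \<ge> a"
    \<comment> \<open>A right end beyond \<open>t\<close> makes the filters within
      \<open>{a..b}\<close> and within \<open>{a..}\<close> agree at \<open>t\<close>.\<close>
    define b where "b = t + 1"
    have "(xb b has_vector_derivative F t (xb b t)) (at t within {a..b})"
      using xb(2) \<open>t \<ge> a\<close> by (simp add: b_def)
    then have "(x has_vector_derivative F t (xb b t)) (at t within {a..b})"
      by (rule has_vector_derivative_transform[rotated 2])
        (use \<open>t \<ge> a\<close> in \<open>auto simp: b_def intro: x_eq\<close>)
    moreover have "xb b t = x t" using x_eq[of t b] \<open>t \<ge> a\<close> by (simp add: b_def)
    moreover have "at t within {a..b} = at t within {a..}"
      by (rule at_within_nhd[of _ "{..<b}"]) (auto simp: b_def)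
    ultimately show "(x has_vector_derivative F t (x t)) (at t within {a..})" by simp
  qed
qed

text \<open>Over a short window \<open>[t, t + h]\<close> the convergent \<open>f\<close> changes
  little, so \<open>f'\<close> is nearly nonnegative at some point of it; there \<open>u\<close> is
  small, and by its Lipschitz bound also at \<open>t\<close>. Uniform continuity is asked of
  \<open>u\<close> and not of \<open>f'\<close>: the rest of \<open>f'\<close> may vary wildly as
  long as a vanishing \<open>v\<close> bounds it. This tolerates a gain that is merely continuous in
  time.\<close>

lemma barbalat:
  fixes f :: "real \<Rightarrow> real"
  assumes lim: "(f \<longlongrightarrow> l) at_top"
    and der: "\<And>t. t \<ge> a \<Longrightarrow> (f has_vector_derivative f' t) (at t within {a..})"
    and le: "\<And>t. t \<ge> a \<Longrightarrow> f' t \<le> v t - u t"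
    and v: "(v \<longlongrightarrow> 0) at_top"
    and u: "\<And>s t. a \<le> s \<Longrightarrow> s \<le> t \<Longrightarrow> \<bar>u t - u s\<bar> \<le> L * (t - s)"
    and "e > 0"
  shows "\<forall>\<^sub>F t in at_top. u t < e"
proof -
  \<comment> \<open>The tolerance \<open>e\<close> is split into thirds: the mean slope of
    \<open>f\<close>, the size of \<open>v\<close>, the drift of \<open>u\<close> over the
    window.\<close>
  define h where "h = e / (3 * (\<bar>L\<bar> + 1))"
  have "h > 0" "\<bar>L\<bar> * h \<le> e / 3" using \<open>e > 0\<close> by (auto simp: h_def field_simps)
  have "\<forall>\<^sub>F t in at_top. dist (f t) l < h * e / 6"
    using \<open>h > 0\<close> \<open>e > 0\<close> by (intro tendstoD[OF lim]) auto
  then obtain N1 where N1: "\<And>t. t \<ge> N1 \<Longrightarrow> dist (f t) l < h * e / 6"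
    by (auto simp: eventually_at_top_linorder)
  have "\<forall>\<^sub>F t in at_top. dist (v t) 0 < e / 3"
    using \<open>e > 0\<close> by (intro tendstoD[OF v]) auto
  then obtain N2 where N2: "\<And>t. t \<ge> N2 \<Longrightarrow> dist (v t) 0 < e / 3"
    by (auto simp: eventually_at_top_linorder)
  have "u t < e" if t: "t \<ge> max a (max N1 N2)" for t
  proof -
    obtain \<xi> where \<xi>: "t < \<xi>" "\<xi> < t + h" "f (t + h) - f t = (t + h - t) * f' \<xi>"
    proof (rule mvt_within[of t "t + h" "{a..}" f f'])
      show "t < t + h" "{t..t + h} \<subseteq> {a..}" using \<open>h > 0\<close> t by auto
    qed (use der in auto)
    have "\<bar>f (t + h) - f t\<bar> < h * (e / 3)"
      using N1[of t] N1[of "t + h"] t \<open>h > 0\<close> dist_triangle2[of "f (t + h)" "f t" l]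
      by (simp add: dist_real_def[of "f (t + h)" "f t", symmetric])
    then have "\<bar>h * f' \<xi>\<bar> < h * (e / 3)" using \<xi> by simp
    then have "- f' \<xi> < e / 3" using \<open>h > 0\<close> by (auto simp: abs_mult)
    moreover have "f' \<xi> \<le> v \<xi> - u \<xi>" using le \<xi> t by auto
    moreover have "v \<xi> < e / 3" using N2[of \<xi>] \<xi> t by auto
    moreover have "\<bar>u \<xi> - u t\<bar> \<le> L * (\<xi> - t)" using u[of t \<xi>] \<xi> t by auto
    moreover have "L * (\<xi> - t) \<le> \<bar>L\<bar> * h" using \<xi> by (intro mult_mono) auto
    ultimately show ?thesis using \<open>\<bar>L\<bar> * h \<le> e / 3\<close> by linarith
  qed
  then show ?thesis unfolding eventually_at_top_linorder by blast
qed

lemma tendsto_at_top_nonincreasing: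
  fixes f :: "real \<Rightarrow> real"
  assumes "\<And>s t. a \<le> s \<Longrightarrow> s \<le> t \<Longrightarrow> f t \<le> f s" "\<And>t. a \<le> t \<Longrightarrow> B \<le> f t"
  obtains l where "(f \<longlongrightarrow> l) at_top" "\<And>t. a \<le> t \<Longrightarrow> l \<le> f t"
proof
  define l where "l = Inf (f ` {a..})"
  have bdd: "bdd_below (f ` {a..})" using assms(2) by (auto intro!: bdd_belowI[of _ B])
  show le: "l \<le> f t" if "a \<le> t" for t
    unfolding l_def using bdd that by (auto intro: cInf_lower)
  show "(f \<longlongrightarrow> l) at_top"
  proof (rule tendstoI)
    fix e :: real assume "e > 0"
    then obtain s where s: "s \<ge> a" "f s < l + e"
      using cInf_lessD[of "f ` {a..}" "l + e"] by (auto simp: l_def)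
    have "dist (f t) l < e" if "t \<ge> s" for t
      using le[of t] assms(1)[of s t] s that by (simp add: dist_real_def)
    then show "\<forall>\<^sub>F t in at_top. dist (f t) l < e"
      by (auto simp: eventually_at_top_linorder)
  qed
qed

section \<open>Rotation matrices and the potential\<close>

lemma bounded_bilinear_matrix_matrix_mult:
  "bounded_bilinear ((**) :: real^'n^'m \<Rightarrow> real^'p^'n \<Rightarrow> real^'p^'m)"
  unfolding bilinear_conv_bounded_bilinear[symmetric] bilinear_def
  by (intro conjI allI linearI)
    (simp_all add: matrix_matrix_mult_def vec_eq_iff sum.distrib algebra_simps sum_distrib_left)

lemmas matrix_mult_diff =
  bounded_bilinear.diff_left[OF bounded_bilinear_matrix_matrix_mult]
  bounded_bilinear.diff_right[OF bounded_bilinear_matrix_matrix_mult]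

lemmas matrix_mult_add =
  bounded_bilinear.add_left[OF bounded_bilinear_matrix_matrix_mult]
  bounded_bilinear.add_right[OF bounded_bilinear_matrix_matrix_mult]

lemmas matrix_mult_minus =
  bounded_bilinear.minus_left[OF bounded_bilinear_matrix_matrix_mult]
  bounded_bilinear.minus_right[OF bounded_bilinear_matrix_matrix_mult]

lemmas matrix_mult_0 =
  bounded_bilinear.zero_left[OF bounded_bilinear_matrix_matrix_mult]
  bounded_bilinear.zero_right[OF bounded_bilinear_matrix_matrix_mult]

lemma bounded_bilinear_matrix_vector_mult:
  "bounded_bilinear ((*v) :: real^'n^'m \<Rightarrow> real^'n \<Rightarrow> real^'m)"
  unfolding bilinear_conv_bounded_bilinear[symmetric] bilinear_def
  by (intro conjI allI linearI)
    (simp_all add: matrix_vector_mult_def vec_eq_iff sum.distrib algebra_simps sum_distrib_left)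

lemma bounded_linear_transpose: "bounded_linear (transpose :: real^'n^'m \<Rightarrow> real^'m^'n)"
  by (rule bounded_linearI') (simp_all add: transpose_def vec_eq_iff)

lemma skew_eq: "skew a = vector [vector [0, - a$3, a$2], vector [a$3, 0, - a$1], vector [- a$2, a$1, 0]]"
  by (simp add: skew_def matrix_def axis_def cross3_simps vec_eq_iff forall_3)

lemma bounded_linear_skew: "bounded_linear skew"
  by (rule bounded_linearI') (simp_all add: skew_eq vec_eq_iff forall_3)

lemma bounded_bilinear_skew_mult:
  "bounded_bilinear (\<lambda>z (P :: real^3^3). skew z ** P)"
  by (rule bounded_bilinear.comp1[OF bounded_bilinear_matrix_matrix_mult bounded_linear_skew])

lemmas matrix_continuous_intros =
  bounded_bilinear.continuous_on[OF bounded_bilinear_matrix_matrix_mult]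
  bounded_bilinear.continuous_on[OF bounded_bilinear_matrix_vector_mult]
  bounded_linear.continuous_on[OF bounded_linear_transpose]
  bounded_linear.continuous_on[OF bounded_linear_skew]

lemmas matrix_vector_derivative_intros =
  bounded_bilinear.has_vector_derivative[OF bounded_bilinear_matrix_matrix_mult]
  bounded_bilinear.has_vector_derivative[OF bounded_bilinear_matrix_vector_mult]
  bounded_linear.has_vector_derivative[OF bounded_linear_transpose]
  bounded_linear.has_vector_derivative[OF bounded_linear_skew]

lemma transpose_skew: "transpose (skew a) = - skew a"
  by (simp add: skew_eq vec_eq_iff forall_3 transpose_def)

section \<open>The rotation group and the Frobenius norm\<close>

lemma SO3_iff: "P \<in> SO3 \<longleftrightarrow> P ** transpose P = mat 1 \<and> det P = 1"
  by (auto simp: SO3_def rotation_matrix_def orthogonal_matrix_def matrix_left_right_inverse)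

lemma SO3_mult_transpose: "P \<in> SO3 \<Longrightarrow> P ** transpose P = mat 1"
  and SO3_transpose_mult: "P \<in> SO3 \<Longrightarrow> transpose P ** P = mat 1"
  by (auto simp: SO3_def rotation_matrix_def orthogonal_matrix_def)

lemma SO3_transpose: "P \<in> SO3 \<Longrightarrow> transpose P \<in> SO3"
  using SO3_transpose_mult[of P] by (simp add: SO3_iff det_transpose)

lemma SO3_mult: "P \<in> SO3 \<Longrightarrow> Q \<in> SO3 \<Longrightarrow> P ** Q \<in> SO3"
  by (simp add: SO3_def rotation_matrix_def orthogonal_matrix_mul det_mul)

lemma mat_1_SO3: "mat 1 \<in> SO3"
  by (simp add: SO3_iff transpose_mat)

lemma SO3_row: 
  assumes "P \<in> SO3" shows "(\<Sum>j\<in>UNIV. (P$i$j)\<^sup>2) = 1"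
proof -
  have "(P ** transpose P)$i$i = 1"
    using assms by (simp add: SO3_iff mat_def)
  then show ?thesis
    by (simp add: matrix_matrix_mult_def transpose_def power2_eq_square)
qed

lemma norm_matrix_power2:
  "(norm (A :: real^'n^'m))\<^sup>2 = (\<Sum>i\<in>UNIV. \<Sum>j\<in>UNIV. (A$i$j)\<^sup>2)"
  unfolding power2_norm_eq_inner inner_vec_def by (simp add: power2_eq_square)

lemma norm_SO3: "P \<in> SO3 \<Longrightarrow> (norm P)\<^sup>2 = 3"
  by (simp add: norm_matrix_power2 SO3_row)

text \<open>The exact value is the square root of 3; the bound 2 becomes the radius to which the
  attitude is truncated in \<open>truncated_exists\<close>.\<close>

lemma norm_SO3_le: "P \<in> SO3 \<Longrightarrow> norm P \<le> 2"
  using norm_SO3[of P] power2_le_imp_le[of "norm P" 2] by simp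

lemma norm_transpose: "norm (transpose (Y :: real^3^3)) = norm Y"
  using sum.swap[of "\<lambda>i j. (Y$i$j)\<^sup>2" UNIV UNIV]
  by (simp add: norm_eq_sqrt_inner inner_vec_def transpose_def power2_eq_square)

lemma norm_orthogonal_mult_left:
  fixes U :: "real^3^3" and X :: "real^3^3"
  assumes "U \<in> SO3"
  shows "norm (U ** X) = norm X"
proof -
  have *: "(norm Y)\<^sup>2 = trace (transpose Y ** Y)" for Y :: "real^3^3"
    unfolding norm_matrix_power2
    by (subst sum.swap) (simp add: trace_def matrix_matrix_mult_def transpose_def power2_eq_square)
  have "transpose (U ** X) ** (U ** X) = transpose X ** (transpose U ** U) ** X"
    by (simp add: matrix_transpose_mul matrix_mul_assoc)
  then have "(norm (U ** X))\<^sup>2 = (norm X)\<^sup>2"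
    using SO3_transpose_mult[OF assms] by (simp add: *)
  then show ?thesis by simp
qed

lemma norm_orthogonal_mult_right:
  fixes U :: "real^3^3" and X :: "real^3^3"
  assumes "U \<in> SO3"
  shows "norm (X ** U) = norm X"
  using norm_orthogonal_mult_left[OF SO3_transpose[OF assms], of "transpose X"]
  by (simp add: matrix_transpose_mul[symmetric] norm_transpose)

lemma norm_SO3_mult_vector: "U \<in> SO3 \<Longrightarrow> norm (U *v x) = norm x"
  using orthogonal_transformation_norm[of "(*v) U" x]
  by (simp add: SO3_def rotation_matrix_def orthogonal_transformation_matrix)

lemma closed_SO3: "closed SO3"
proof -
  have "continuous_on UNIV (\<lambda>P::real^3^3. det P)"
    unfolding det_3 by (intro continuous_intros)
  then have "closed {P::real^3^3. det P = 1}"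
    by (intro closed_Collect_eq continuous_intros)
  moreover have "closed {P::real^3^3. P ** transpose P = mat 1}"
    by (intro closed_Collect_eq continuous_intros matrix_continuous_intros)
  ultimately have "closed ({P::real^3^3. P ** transpose P = mat 1} \<inter> {P. det P = 1})"
    by (rule closed_Int[rotated])
  moreover have "SO3 = {P. P ** transpose P = mat 1} \<inter> {P. det P = 1}"
    by (auto simp: SO3_iff)
  ultimately show ?thesis by simp
qed

lemma compact_SO3: "compact SO3"
  by (simp add: compact_eq_bounded_closed closed_SO3 bounded_iff) (use norm_SO3_le in blast)

text \<open>Rotations commute with the cross product, whereas a reflection would add a sign. This is
  why the diagonalising matrix must have determinant 1.\<close>

lemma skew_rotation:
  assumes "B \<in> SO3"
  shows "skew (B *v v) = B ** skew v ** transpose B"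
proof -
  have "skew (B *v v) *v c = (B ** skew v ** transpose B) *v c" for c
  proof -
    have "B *v (transpose B *v c) = c"
      by (simp only: matrix_vector_mul_assoc SO3_mult_transpose[OF assms] matrix_vector_mul_lid)
    then have "skew (B *v v) *v c = B *v (cross3 v (transpose B *v c))"
      using cross_rotation_matrix[of B v "transpose B *v c"] assms by (simp add: skew_mult SO3_def)
    then show ?thesis by (simp only: skew_mult[symmetric] matrix_vector_mul_assoc matrix_mul_assoc)
  qed
  then show ?thesis by (simp add: matrix_eq)
qed

section \<open>Radial projection onto balls\<close>

definition radial_proj :: "real \<Rightarrow> 'a::real_normed_vector \<Rightarrow> 'a" where
  "radial_proj \<rho> x = (if norm x \<le> \<rho> then x else (\<rho> / norm x) *\<^sub>R x)"

lemma radial_proj_id: "norm x \<le> \<rho> \<Longrightarrow> radial_proj \<rho> x = x"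
  by (simp add: radial_proj_def)

lemma norm_radial_proj: "\<rho> > 0 \<Longrightarrow> norm (radial_proj \<rho> x) \<le> \<rho>"
  by (simp add: radial_proj_def)

lemma radial_proj_scaleR: "\<exists>c. radial_proj \<rho> x = c *\<^sub>R x"
  by (metis radial_proj_def scaleR_one)

text \<open>This is the nearest-point projection onto a closed convex set, hence nonexpansive. The
  explicit formula is kept because invariance of \<open>SO3\<close> under the truncated equation
  rests on the value being a multiple of the argument.\<close>

lemma radial_proj_lipschitz:
  fixes x y :: "'a::euclidean_space"
  assumes "\<rho> > 0"
  shows "norm (radial_proj \<rho> x - radial_proj \<rho> y) \<le> norm (x - y)"
proof -
  have "radial_proj \<rho> x = closest_point (cball 0 \<rho>) x" for x :: 'a
  proof (rule closest_point_unique)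
    show "\<forall>z\<in>cball 0 \<rho>. dist x (radial_proj \<rho> x) \<le> dist x z"
    proof
      fix z :: 'a assume z: "z \<in> cball 0 \<rho>"
      show "dist x (radial_proj \<rho> x) \<le> dist x z"
      proof (cases "norm x \<le> \<rho>")
        case False
        have "x - (\<rho> / norm x) *\<^sub>R x = (1 - \<rho> / norm x) *\<^sub>R x" by (simp add: algebra_simps)
        then have "norm (x - (\<rho> / norm x) *\<^sub>R x) = \<bar>1 - \<rho> / norm x\<bar> * norm x" by simp
        also have "\<dots> = norm x - \<rho>"
          using False assms norm_ge_zero[of x] by (simp add: abs_if field_simps del: norm_ge_zero) auto
        finally have "dist x (radial_proj \<rho> x) = norm x - \<rho>"
          using False by (simp add: radial_proj_def dist_norm)
        also have "\<dots> \<le> dist x z"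
          using z norm_triangle_ineq2[of x z] by (simp add: dist_norm)
        finally show ?thesis .
      qed (simp add: radial_proj_id)
    qed
  qed (use norm_radial_proj[OF assms] in auto)
  then show ?thesis
    using closest_point_lipschitz[of "cball 0 \<rho>" x y] assms by (simp add: dist_norm)
qed

section \<open>The diagonalised potential and its critical points\<close>

definition dmat :: "real^'n \<Rightarrow> real^'n^'n" where
  "dmat d = (\<chi> i j. if i = j then d$i else 0)"

lemma dmat_nth: "dmat d $ i $ j = (if i = j then d$i else 0)"
  by (simp add: dmat_def)

lemma transpose_dmat [simp]: "transpose (dmat d) = dmat d"
  by (simp add: dmat_def transpose_def vec_eq_iff)

lemma dmat_mult_nth: "(dmat d ** X) $ i $ j = d$i * X$i$j"
  by (simp add: matrix_matrix_mult_def dmat_nth if_distrib if_distribR sum.delta cong: if_cong)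

lemma mult_dmat_nth: "(X ** dmat d) $ i $ j = X$i$j * d$j"
  by (simp add: matrix_matrix_mult_def dmat_nth if_distrib if_distribR sum.delta cong: if_cong)

text \<open>The trace of \<open>dmat d ** (mat 1 - P)\<close>; by \<open>U0_eq_pot\<close> it is the
  measurement cost \<open>U0\<close> in the eigenframe of
  \<open>E ** W ** transpose E\<close>.\<close>

definition pot :: "real^3 \<Rightarrow> real^3^3 \<Rightarrow> real" where
  "pot d P = (\<Sum>i\<in>UNIV. d$i * (1 - P$i$i))"

text \<open>\<open>skew_torque\<close> identifies this as \<open>vex\<close> of
  \<open>dmat d ** transpose P - P ** dmat d\<close>. The coordinate form is linear on all matrices,
  in particular on differences of rotations, to which it is applied at the saddles.\<close>

definition torque :: "real^3 \<Rightarrow> real^3^3 \<Rightarrow> real^3" where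
  "torque d P = vector [d$3 * P$2$3 - d$2 * P$3$2, d$1 * P$3$1 - d$3 * P$1$3,
                        d$2 * P$1$2 - d$1 * P$2$1]"

lemma skew_torque: "skew (torque d P) = dmat d ** transpose P - P ** dmat d"
  by (simp add: vec_eq_iff forall_3 dmat_mult_nth mult_dmat_nth skew_eq torque_def transpose_def)

lemma bounded_linear_torque: "bounded_linear (torque d)"
  by (rule bounded_linearI') (simp_all add: torque_def vec_eq_iff forall_3 algebra_simps)

lemma continuous_on_torque [continuous_intros]:
  "continuous_on S f \<Longrightarrow> continuous_on S (\<lambda>x. torque d (f x))"
  by (rule bounded_linear.continuous_on[OF bounded_linear_torque])

lemma continuous_on_pot [continuous_intros]:
  "continuous_on S f \<Longrightarrow> continuous_on S (\<lambda>x. pot d (f x))"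
  unfolding pot_def by (intro continuous_intros)

lemma pot_mat_1 [simp]: "pot d (mat 1) = 0"
  by (simp add: pot_def mat_def)

lemma torque_mat_1 [simp]: "torque d (mat 1) = 0"
  by (simp add: torque_def mat_def vec_eq_iff forall_3)

lemma pot_has_vector_derivative:
  assumes "(P has_vector_derivative skew z ** P t) (at t within T)"
  shows "((\<lambda>t. pot d (P t)) has_vector_derivative - (z \<bullet> torque d (P t))) (at t within T)"
proof -
  have "((\<lambda>t. pot d (P t)) has_vector_derivative
      (\<Sum>i\<in>UNIV. d$i * (0 - (skew z ** P t)$i$i))) (at t within T)"
    unfolding pot_def
    by (intro has_vector_derivative_sum has_vector_derivative_mult_right derivative_intros
        bounded_linear.has_vector_derivative[OF bounded_linear_vec_nth] assms)
  moreover have "(\<Sum>i\<in>UNIV. d$i * (0 - (skew z ** P t)$i$i)) = - (z \<bullet> torque d (P t))"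
    by (simp add: sum_3 matrix_matrix_mult_def skew_eq torque_def inner_vec_def algebra_simps)
  ultimately show ?thesis by simp
qed

lemma SO3_entry_le_1: "P \<in> SO3 \<Longrightarrow> P$i$j \<le> 1"
  using SO3_row[of P i] member_le_sum[of j UNIV "\<lambda>j. (P$i$j)\<^sup>2"]
  by (simp add: abs_square_le_1 abs_le_iff)

text \<open>Each row of \<open>P\<close> is a unit vector, so only the cross terms
  \<open>- 2 * P$i$i\<close> survive: the squared distance to the identity is itself a potential
  with equal weights.\<close>

lemma norm_SO3_minus_1:
  assumes "P \<in> SO3"
  shows "(norm (P - mat 1))\<^sup>2 = (\<Sum>i\<in>UNIV. 2 * (1 - P$i$i))"
proof -
  have "(P$i$1)\<^sup>2 + (P$i$2)\<^sup>2 + (P$i$3)\<^sup>2 = 1" for i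
    using SO3_row[OF assms, of i] by (simp add: sum_3)
  from this[of 1] this[of 2] this[of 3] show ?thesis
    by (simp add: norm_matrix_power2 sum_3 mat_def power2_diff algebra_simps)
qed

lemma norm_le_pot:
  assumes "P \<in> SO3" "\<And>i. c \<le> d$i"
  shows "c * (norm (P - mat 1))\<^sup>2 \<le> 2 * pot d P"
proof -
  have "(\<Sum>i\<in>UNIV. c * (2 * (1 - P$i$i))) \<le> (\<Sum>i\<in>UNIV. d$i * (2 * (1 - P$i$i)))"
    using assms SO3_entry_le_1[OF assms(1)] by (intro sum_mono mult_right_mono) auto
  then show ?thesis
    by (simp add: norm_SO3_minus_1[OF assms(1)] pot_def sum_distrib_left algebra_simps)
qed

lemma dmat_SO3_iff:
  "dmat e \<in> SO3 \<longleftrightarrow> (\<forall>i. (e$i)\<^sup>2 = 1) \<and> e$1 * e$2 * e$3 = 1"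
  by (auto simp: SO3_iff vec_eq_iff dmat_mult_nth dmat_nth mat_def det_3 power2_eq_square)

text \<open>The critical points of the potential: \<open>S = P ** dmat d\<close> is symmetric, so
  \<open>P ** (dmat d)\<^sup>2 ** transpose P = S ** S = transpose S ** S = (dmat d)\<^sup>2\<close>; hence \<open>P\<close> commutes
  with a diagonal matrix with distinct entries.\<close>

lemma critical_point:
  assumes P: "P \<in> SO3" and crit: "torque d P = 0"
    and pos: "\<And>i. d$i > 0" and inj: "\<And>i j. d$i = d$j \<Longrightarrow> i = j"
  obtains e where "P = dmat e" "\<And>i. e$i = 1 \<or> e$i = -1" "e$1 * e$2 * e$3 = 1"
proof -
  let ?D = "dmat d"
  have skew0: "skew 0 = 0" by (simp add: skew_eq vec_eq_iff forall_3)
  have sym: "?D ** transpose P = P ** ?D"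
    using skew_torque[of d P] by (simp add: crit skew0)
  have "P ** (?D ** ?D) = (P ** ?D) ** (?D ** (transpose P ** P))"
    by (simp add: SO3_transpose_mult[OF P] matrix_mul_assoc)
  also have "\<dots> = (?D ** transpose P) ** (P ** ?D) ** P"
    by (simp only: sym matrix_mul_assoc)
  also have "\<dots> = ?D ** (transpose P ** P) ** ?D ** P"
    by (simp only: matrix_mul_assoc)
  also have "\<dots> = (?D ** ?D) ** P"
    by (simp add: SO3_transpose_mult[OF P])
  finally have comm: "P ** (?D ** ?D) = (?D ** ?D) ** P" .
  have offdiag: "P$i$j = 0" if "i \<noteq> j" for i j
  proof -
    have "(P ** (?D ** ?D))$i$j = P$i$j * (d$j * d$j)"
      by (simp add: matrix_mul_assoc mult_dmat_nth)
    moreover have "((?D ** ?D) ** P)$i$j = (d$i * d$i) * P$i$j"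
      by (simp add: matrix_mul_assoc[symmetric] dmat_mult_nth)
    ultimately have "P$i$j * (d$j * d$j) = (d$i * d$i) * P$i$j"
      unfolding comm by metis
    moreover have "d$j * d$j \<noteq> d$i * d$i"
      using that pos[of i] pos[of j] inj[of i j] by (auto simp: square_eq_iff)
    ultimately show ?thesis by auto
  qed
  define e where "e = (\<chi> i. P$i$i)"
  have "P = dmat e" using offdiag by (simp add: vec_eq_iff dmat_nth e_def)
  moreover have "dmat e \<in> SO3" using P calculation by simp
  ultimately show ?thesis
    using that[of e] by (auto simp: dmat_SO3_iff power2_eq_1_iff)
qed

text \<open>Product 1 means an even number of minus signs: the identity and the half-turns about the
  three coordinate axes.\<close>

lemma sign_triple:
  fixes e :: "real^3"
  assumes "\<And>i. e$i = 1 \<or> e$i = -1" "e$1 * e$2 * e$3 = 1"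
  shows "(e$1, e$2, e$3) \<in> {(1, 1, 1), (1, -1, -1), (-1, 1, -1), (-1, -1, 1)}"
  using assms(1)[of 1] assms(1)[of 2] assms(1)[of 3] assms(2) by auto

text \<open>At the half-turns the potential is \<open>2 * (d$i + d$j)\<close>, at the identity 0;
  distinct positive entries make these four values distinct. The limit of the energy therefore
  singles out one equilibrium.\<close>

lemma critical_point_eqI:
  assumes "P \<in> SO3" "torque d P = 0" "Q \<in> SO3" "torque d Q = 0" "pot d P = pot d Q"
    and pos: "\<And>i. d$i > 0" and inj: "\<And>i j. d$i = d$j \<Longrightarrow> i = j"
  shows "P = Q"
proof -
  obtain e where e: "P = dmat e" "(e$1, e$2, e$3) \<in> {(1, 1, 1), (1, -1, -1), (-1, 1, -1), (-1, -1, 1)}"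
    using critical_point[OF assms(1,2) pos inj] sign_triple by metis
  obtain f where f: "Q = dmat f" "(f$1, f$2, f$3) \<in> {(1, 1, 1), (1, -1, -1), (-1, 1, -1), (-1, -1, 1)}"
    using critical_point[OF assms(3,4) pos inj] sign_triple by metis
  have ne: "d$1 \<noteq> d$2" "d$1 \<noteq> d$3" "d$2 \<noteq> d$3" using inj by force+
  have "d$1 * (1 - e$1) + d$2 * (1 - e$2) + d$3 * (1 - e$3)
      = d$1 * (1 - f$1) + d$2 * (1 - f$2) + d$3 * (1 - f$3)"
    using assms(5) by (simp add: pot_def sum_3 dmat_nth e(1) f(1))
  with e(2) f(2) ne pos[of 1] pos[of 2] pos[of 3] have "e$1 = f$1 \<and> e$2 = f$2 \<and> e$3 = f$3"
    unfolding insert_iff empty_iff prod.inject by (elim disjE conjE; simp)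
  then show ?thesis by (simp add: e(1) f(1) vec_eq_iff dmat_nth forall_3)
qed

text \<open>A half-turn reverses two axes, each contributing at least \<open>2 * c\<close>. This is
  the origin of the energy threshold \<open>\<Phi> (4 * d_min)\<close> used later.\<close>

lemma critical_pot_ge:
  assumes "P \<in> SO3" "torque d P = 0" "P \<noteq> mat 1" "\<And>i. c \<le> d$i" "c > 0"
    and inj: "\<And>i j. d$i = d$j \<Longrightarrow> i = j"
  shows "4 * c \<le> pot d P"
proof -
  have pos: "d$i > 0" for i using assms(4)[of i] assms(5) by simp
  obtain e where e: "P = dmat e" "(e$1, e$2, e$3) \<in> {(1, 1, 1), (1, -1, -1), (-1, 1, -1), (-1, -1, 1)}"
    using critical_point[OF assms(1,2) pos inj] sign_triple by metis
  have "\<not> (e$1 = 1 \<and> e$2 = 1 \<and> e$3 = 1)"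
    using assms(3) by (auto simp: e(1) vec_eq_iff dmat_nth mat_def forall_3)
  moreover have "pot d P = d$1 * (1 - e$1) + d$2 * (1 - e$2) + d$3 * (1 - e$3)"
    by (simp add: pot_def sum_3 dmat_nth e(1))
  ultimately show ?thesis
    using e(2) assms(4)[of 1] assms(4)[of 2] assms(4)[of 3]
    unfolding insert_iff empty_iff prod.inject by (elim disjE conjE; simp)
qed

section \<open>The error system\<close>

lemma norm2_has_vector_derivative:
  fixes z :: "real \<Rightarrow> 'a::real_inner"
  assumes "(z has_vector_derivative z') (at t within T)"
  shows "((\<lambda>t. (norm (z t))\<^sup>2) has_vector_derivative 2 * (z t \<bullet> z')) (at t within T)"
  using bounded_bilinear.has_vector_derivative[OF bounded_bilinear_inner assms assms]
  by (simp add: power2_norm_eq_inner inner_commute)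

text \<open>Skew-symmetry makes \<open>transpose P ** P\<close> constant, and the determinant,
  continuous with values 1 and -1, cannot jump. \<open>v\<close> carries no regularity, so
  \<open>truncated_exists\<close> may supply it by choice.\<close>

lemma SO3_invariant:
  assumes P0: "P a \<in> SO3" and "a \<le> t"
    and der: "\<And>t. t \<ge> a \<Longrightarrow> (P has_vector_derivative skew (v t) ** P t) (at t within {a..})"
  shows "P t \<in> SO3"
proof -
  have "((\<lambda>t. transpose (P t) ** P t) has_vector_derivative 0) (at s within {a..})"
    if "s \<in> {a..}" for s
  proof -
    have "((\<lambda>t. transpose (P t) ** P t) has_vector_derivative
        transpose (P s) ** (skew (v s) ** P s) + transpose (skew (v s) ** P s) ** P s) (at s within {a..})"
      by (intro matrix_vector_derivative_intros der) (use that in auto)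
    moreover have "transpose (skew (v s) ** P s) ** P s = - (transpose (P s) ** (skew (v s) ** P s))"
      by (simp add: matrix_transpose_mul transpose_skew matrix_mul_assoc
          bounded_bilinear.minus_right[OF bounded_bilinear_matrix_matrix_mult]
          bounded_bilinear.minus_left[OF bounded_bilinear_matrix_matrix_mult])
    ultimately show ?thesis by simp
  qed
  then obtain C where C: "\<And>s. s \<in> {a..} \<Longrightarrow> transpose (P s) ** P s = C"
    using has_vector_derivative_zero_constant[of "{a..}" "\<lambda>t. transpose (P t) ** P t"] by force
  then have orth: "orthogonal_matrix (P s)" if "s \<ge> a" for s
    using that SO3_transpose_mult[OF P0] C[of a] C[of s] by (simp add: orthogonal_matrix)
  have contP: "continuous_on {a..} P"
    using der by (auto intro!: continuous_on_vector_derivative)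
  have "continuous_on {a..} (\<lambda>s. det (P s))"
    unfolding det_3 by (intro continuous_intros contP)
  then have "connected ((\<lambda>s. det (P s)) ` {a..})"
    by (intro connected_continuous_image) auto
  moreover have "1 \<in> (\<lambda>s. det (P s)) ` {a..}"
    using P0 by (auto simp: SO3_iff intro!: image_eqI[of _ _ a])
  ultimately have "det (P t) = 1"
  proof -
    have "det (P t) = 1 \<or> det (P t) = -1"
      using orth[OF \<open>a \<le> t\<close>] det_orthogonal_matrix by blast
    moreover have "det (P t) \<noteq> -1"
    proof
      assume "det (P t) = -1"
      then have "-1 \<in> (\<lambda>s. det (P s)) ` {a..}"
        using \<open>a \<le> t\<close> by (intro image_eqI[of _ _ t]) auto
      then have "0 \<in> (\<lambda>s. det (P s)) ` {a..}"
        using \<open>connected _\<close> \<open>1 \<in> _\<close> by (auto intro: connectedD_interval[of _ "-1" 1])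
      then show False using orth det_orthogonal_matrix by force
    qed
    ultimately show ?thesis by blast
  qed
  then show ?thesis using orth[OF \<open>a \<le> t\<close>] by (simp add: SO3_def rotation_matrix_def)
qed

text \<open>The error system after diagonalisation. \<open>A\<close> is \<open>D\<close> conjugated
  by a time-dependent rotation, so coercivity and boundedness survive with constants independent of
  time; \<open>D\<close> is not assumed symmetric, hence neither is \<open>A\<close>.\<close>

locale observer =
  fixes m lam alpha :: real and d :: "real^3" and A :: "real \<Rightarrow> real^3^3"
    and \<Phi> \<Phi>' :: "real \<Rightarrow> real" and t0 :: real
  assumes m_pos: "m > 0" and lam_pos: "lam > 0"
    and d_pos: "\<And>i. d$i > 0" and d_inj: "\<And>i j. d$i = d$j \<Longrightarrow> i = j"
    and A_cont: "continuous_on {t0..} A"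
    and A_coercive: "\<And>t x. t \<ge> t0 \<Longrightarrow> lam * (norm x)\<^sup>2 \<le> x \<bullet> (A t *v x)"
    and A_bound: "\<And>t x. t \<ge> t0 \<Longrightarrow> norm (A t *v x) \<le> alpha * norm x"
    and potential: "admissible_potential \<Phi> \<Phi>'"
begin

lemma alpha_nonneg: "alpha \<ge> 0"
proof -
  have "0 \<le> norm (A t0 *v axis 1 1)" by simp
  also have "\<dots> \<le> alpha * norm (axis 1 1 :: real^3)" by (rule A_bound) simp
  finally show ?thesis by simp
qed

lemma \<Phi>'_pos: "x > 0 \<Longrightarrow> \<Phi>' x > 0"
  using potential by (auto simp: admissible_potential_def)

lemma \<Phi>_deriv: "x \<ge> 0 \<Longrightarrow> (\<Phi> has_real_derivative \<Phi>' x) (at x within {0..})"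
  using potential by (auto simp: admissible_potential_def)

lemma \<Phi>_zero: "\<Phi> 0 = 0" and \<Phi>_nonneg: "x \<ge> 0 \<Longrightarrow> \<Phi> x \<ge> 0"
  using potential by (auto simp: admissible_potential_def)

lemma \<Phi>_strict_mono: "0 \<le> x \<Longrightarrow> x < y \<Longrightarrow> \<Phi> x < \<Phi> y"
proof -
  assume "0 \<le> x" "x < y"
  obtain \<xi> where "x < \<xi>" "\<Phi> y - \<Phi> x = (y - x) * \<Phi>' \<xi>"
    by (rule mvt_within[OF \<open>x < y\<close>, of "{0..}" \<Phi> \<Phi>'])
      (use \<open>0 \<le> x\<close> \<Phi>_deriv in \<open>auto simp: has_real_derivative_iff_has_vector_derivative[symmetric]\<close>)
  moreover have "(y - x) * \<Phi>' \<xi> > 0"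
    using \<Phi>'_pos[of \<xi>] calculation \<open>0 \<le> x\<close> \<open>x < y\<close> by auto
  ultimately show "\<Phi> x < \<Phi> y" by linarith
qed

lemma \<Phi>_inj: "0 \<le> x \<Longrightarrow> 0 \<le> y \<Longrightarrow> \<Phi> x = \<Phi> y \<Longrightarrow> x = y"
  using \<Phi>_strict_mono[of x y] \<Phi>_strict_mono[of y x] by linarith

lemma \<Phi>_less_imp: "0 \<le> x \<Longrightarrow> 0 \<le> y \<Longrightarrow> \<Phi> x < \<Phi> y \<Longrightarrow> x < y"
  using \<Phi>_strict_mono[of y x] by (cases x y rule: linorder_cases) auto

lemma \<Phi>_continuous: "continuous_on {0..} \<Phi>"
  using \<Phi>_deriv by (auto intro!: DERIV_continuous_on)

text \<open>Here the second derivative enters: it is bounded on compact intervals, which makes the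
  force field Lipschitz on bounded sets.\<close>

lemma \<Phi>'_lipschitz:
  obtains L where "L \<ge> 0" "\<And>x y. x \<in> {0..b} \<Longrightarrow> y \<in> {0..b} \<Longrightarrow> \<bar>\<Phi>' x - \<Phi>' y\<bar> \<le> L * \<bar>x - y\<bar>"
proof -
  obtain \<Phi>'' where der: "\<And>x. x \<ge> 0 \<Longrightarrow> (\<Phi>' has_real_derivative \<Phi>'' x) (at x within {0..})"
    and cont: "continuous_on {0..} \<Phi>''"
    using potential by (auto simp: admissible_potential_def)
  have "compact (\<Phi>'' ` {0..b})"
    by (intro compact_continuous_image continuous_on_subset[OF cont]) auto
  then obtain B where B: "\<And>x. x \<in> {0..b} \<Longrightarrow> \<bar>\<Phi>'' x\<bar> \<le> B"
    by (metis bounded_real compact_imp_bounded imageI)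
  have "\<bar>\<Phi>' x - \<Phi>' y\<bar> \<le> max 0 B * \<bar>x - y\<bar>" if "x \<in> {0..b}" "y \<in> {0..b}" for x y
    using field_differentiable_bound[of "{0..b}" \<Phi>' \<Phi>'' "max 0 B" x y] that B
    by (force intro: DERIV_subset[OF der] simp: le_max_iff_disj)
  then show ?thesis using that[of "max 0 B"] by auto
qed

lemma pot_nonneg: "P \<in> SO3 \<Longrightarrow> pot d P \<ge> 0"
  using SO3_entry_le_1[of P] d_pos unfolding pot_def
  by (intro sum_nonneg mult_nonneg_nonneg) (auto simp: less_imp_le)

text \<open>Off \<open>SO3\<close> the potential can be negative, where \<open>\<Phi>'\<close> is
  arbitrary. Clamping at 0 gives a Lipschitz field on a whole ball of matrices, as the existence
  theorem wants, and by \<open>pot_nonneg\<close> changes nothing on \<open>SO3\<close>.\<close>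

definition force :: "real^3^3 \<Rightarrow> real^3" where
  "force P = \<Phi>' (max 0 (pot d P)) *\<^sub>R torque d P"

lemma pot_lipschitz:
  obtains K where "K \<ge> 0" "\<And>P Q. \<bar>pot d P - pot d Q\<bar> \<le> K * norm (P - Q)"
proof -
  \<comment> \<open>\<open>pot d\<close> is affine; this difference is minus its linear
    part.\<close>
  have "bounded_linear (\<lambda>P. pot d 0 - pot d P)"
    by (rule bounded_linearI') (simp_all add: pot_def sum_3 algebra_simps)
  then interpret bounded_linear "\<lambda>P. pot d 0 - pot d P" .
  obtain K where K: "K > 0" "\<And>P. norm (pot d 0 - pot d P) \<le> norm P * K"
    using pos_bounded by blast
  have "\<bar>pot d P - pot d Q\<bar> \<le> K * norm (P - Q)" for P Q
    using K(2)[of "P - Q"] diff[of P Q] by (simp add: mult.commute)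
  with K(1) show ?thesis using that[of K] by simp
qed

lemma torque_bound:
  obtains K where "K > 0" "\<And>P. norm (torque d P) \<le> K * norm P"
  using bounded_linear.pos_bounded[OF bounded_linear_torque[of d]] by (metis mult.commute)

lemma force_lipschitz:
  obtains L where "L \<ge> 0" "\<And>P Q. norm P \<le> 2 \<Longrightarrow> norm Q \<le> 2 \<Longrightarrow> norm (force P - force Q) \<le> L * norm (P - Q)"
proof -
  obtain Kv where Kv: "Kv \<ge> 0" "\<And>P Q. \<bar>pot d P - pot d Q\<bar> \<le> Kv * norm (P - Q)"
    using pot_lipschitz by blast
  obtain Kt where Kt: "Kt > 0" "\<And>P. norm (torque d P) \<le> Kt * norm P"
    using torque_bound by blast
  define b where "b = \<bar>pot d 0\<bar> + Kv * 2"
  have "b \<ge> 0" using Kv(1) by (simp add: b_def)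
  have pb: "max 0 (pot d P) \<in> {0..b}" if "norm P \<le> 2" for P
  proof -
    have "\<bar>pot d P - pot d 0\<bar> \<le> Kv * 2"
      using Kv(2)[of P 0] mult_left_mono[OF that Kv(1)] by simp
    then show ?thesis using \<open>b \<ge> 0\<close> by (auto simp: b_def)
  qed
  obtain L where L: "L \<ge> 0" "\<And>x y. x \<in> {0..b} \<Longrightarrow> y \<in> {0..b} \<Longrightarrow> \<bar>\<Phi>' x - \<Phi>' y\<bar> \<le> L * \<bar>x - y\<bar>"
    using \<Phi>'_lipschitz by blast
  define M where "M = \<bar>\<Phi>' 0\<bar> + L * b"
  have M: "\<bar>\<Phi>' x\<bar> \<le> M" if "x \<in> {0..b}" for x
  proof -
    have "L * \<bar>x - 0\<bar> \<le> L * b" using that L(1) by (intro mult_left_mono) auto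
    then show ?thesis using L(2)[OF that, of 0] \<open>b \<ge> 0\<close> by (auto simp: M_def)
  qed
  have "M \<ge> 0" using M[of 0] \<open>b \<ge> 0\<close> by force
  have "norm (force P - force Q) \<le> (M * Kt + L * Kv * (Kt * 2)) * norm (P - Q)"
    if P: "norm P \<le> 2" and Q: "norm Q \<le> 2" for P Q
  proof -
    let ?p = "max 0 (pot d P)" and ?q = "max 0 (pot d Q)"
    have "force P - force Q = \<Phi>' ?p *\<^sub>R torque d (P - Q) + (\<Phi>' ?p - \<Phi>' ?q) *\<^sub>R torque d Q"
      by (simp add: force_def linear_diff[OF bounded_linear.linear[OF bounded_linear_torque]] algebra_simps)
    then have "norm (force P - force Q)
        \<le> \<bar>\<Phi>' ?p\<bar> * norm (torque d (P - Q)) + \<bar>\<Phi>' ?p - \<Phi>' ?q\<bar> * norm (torque d Q)"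
      using norm_triangle_ineq by (metis norm_scaleR)
    also have "\<dots> \<le> M * (Kt * norm (P - Q)) + (L * (Kv * norm (P - Q))) * (Kt * 2)"
    proof (intro add_mono mult_mono)
      show "\<bar>\<Phi>' ?p\<bar> \<le> M" using M pb[OF P] by simp
      show "norm (torque d (P - Q)) \<le> Kt * norm (P - Q)" by (rule Kt)
      have "\<bar>?p - ?q\<bar> \<le> \<bar>pot d P - pot d Q\<bar>" by auto
      also have "\<dots> \<le> Kv * norm (P - Q)" by (rule Kv)
      finally have "L * \<bar>?p - ?q\<bar> \<le> L * (Kv * norm (P - Q))" using L(1) by (rule mult_left_mono)
      then show "\<bar>\<Phi>' ?p - \<Phi>' ?q\<bar> \<le> L * (Kv * norm (P - Q))"
        using L(2)[OF pb[OF P] pb[OF Q]] by linarith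
      show "norm (torque d Q) \<le> Kt * 2"
        using Kt(2)[of Q] mult_left_mono[OF Q, of Kt] Kt(1) by linarith
    qed (use \<open>M \<ge> 0\<close> L Kv Kt in auto)
    finally show ?thesis by (simp add: algebra_simps)
  qed
  then show ?thesis
    using that[of "M * Kt + L * Kv * (Kt * 2)"] \<open>M \<ge> 0\<close> L(1) Kv(1) Kt(1) by simp
qed

lemma force_mat_1 [simp]: "force (mat 1) = 0"
  by (simp add: force_def)

lemma force_bound:
  obtains C where "C > 0" "\<And>P. norm P \<le> 2 \<Longrightarrow> norm (force P) \<le> C"
proof -
  obtain L where L: "L \<ge> 0" "\<And>P Q. norm P \<le> 2 \<Longrightarrow> norm Q \<le> 2 \<Longrightarrow> norm (force P - force Q) \<le> L * norm (P - Q)"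
    using force_lipschitz by blast
  have "norm (force P) \<le> L * 4 + 1" if "norm P \<le> 2" for P
  proof -
    have "norm (force P - force (mat 1)) \<le> L * norm (P - mat 1)"
      using L(2)[OF that norm_SO3_le[OF mat_1_SO3]] .
    also have "\<dots> \<le> L * 4"
      using norm_triangle_ineq4[of P "mat 1 :: real^3^3"] norm_SO3_le[OF mat_1_SO3] that L(1)
      by (intro mult_left_mono) auto
    finally show ?thesis by simp
  qed
  then show ?thesis using that[of "L * 4 + 1"] L(1) by simp
qed

text \<open>\<open>\<Phi>'\<close> may vanish at 0, but a rotation of potential 0 is the identity,
  where the torque vanishes anyway.\<close>

lemma force_eq_0_iff: "P \<in> SO3 \<Longrightarrow> force P = 0 \<longleftrightarrow> torque d P = 0"
proof
  assume P: "P \<in> SO3" and "force P = 0"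
  then have "\<Phi>' (pot d P) = 0 \<or> torque d P = 0" using pot_nonneg[OF P] by (simp add: force_def)
  moreover have "torque d P = 0" if "\<Phi>' (pot d P) = 0"
  proof -
    have "pot d P = 0" using that \<Phi>'_pos[of "pot d P"] pot_nonneg[OF P] by force
    moreover define c where "c = min (d$1) (min (d$2) (d$3))"
    have c: "c \<le> d$i" "c > 0" for i using d_pos exhaust_3[of i] by (auto simp: c_def)
    ultimately have "(norm (P - mat 1))\<^sup>2 \<le> 0"
      using norm_le_pot[OF P, of c d] by (simp add: mult_le_0_iff)
    then show ?thesis by simp
  qed
  ultimately show "torque d P = 0" by blast
qed (simp add: force_def)

text \<open>The time set is a parameter because half-lines serve the forward problem and compact
  intervals the backward one; derivatives are one-sided at its ends.\<close>

definition sol :: "real set \<Rightarrow> (real \<Rightarrow> real^3^3) \<Rightarrow> (real \<Rightarrow> real^3) \<Rightarrow> bool" where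
  "sol T P z \<longleftrightarrow> (\<forall>t\<in>T. P t \<in> SO3 \<and>
     (P has_vector_derivative skew (z t) ** P t) (at t within T) \<and>
     (z has_vector_derivative (1/m) *\<^sub>R (force (P t) - A t *v z t)) (at t within T))"

lemma solD:
  assumes "sol T P z" "t \<in> T"
  shows "P t \<in> SO3" "(P has_vector_derivative skew (z t) ** P t) (at t within T)"
    "(z has_vector_derivative (1/m) *\<^sub>R (force (P t) - A t *v z t)) (at t within T)"
  using assms by (auto simp: sol_def)

lemma sol_subset: "sol T P z \<Longrightarrow> T' \<subseteq> T \<Longrightarrow> sol T' P z"
  unfolding sol_def by (blast intro: has_vector_derivative_within_subset)

definition energy :: "real^3^3 \<Rightarrow> real^3 \<Rightarrow> real" where
  "energy P z = m/2 * (norm z)\<^sup>2 + \<Phi> (pot d P)"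

lemma norm_le_energy: "P \<in> SO3 \<Longrightarrow> (norm z)\<^sup>2 \<le> 2 * energy P z / m"
  and \<Phi>_le_energy: "\<Phi> (pot d P) \<le> energy P z"
  and energy_nonneg: "P \<in> SO3 \<Longrightarrow> 0 \<le> energy P z"
  using m_pos \<Phi>_nonneg[OF pot_nonneg, of P] by (auto simp: energy_def field_simps)

lemma energy_deriv:
  assumes "sol T P z" "t \<in> T"
  shows "((\<lambda>t. energy (P t) (z t)) has_vector_derivative - (z t \<bullet> (A t *v z t))) (at t within T)"
proof -
  have p: "((\<lambda>t. pot d (P t)) has_vector_derivative - (z t \<bullet> torque d (P t))) (at t within T)"
    by (intro pot_has_vector_derivative solD[OF assms])
  have sub: "(\<lambda>t. pot d (P t)) ` T \<subseteq> {0..}"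
    using pot_nonneg solD(1)[OF assms(1)] by auto
  \<comment> \<open>\<open>\<Phi>\<close> is differentiable only within \<open>{0..}\<close>, so the
    chain rule is taken relative to the image of the potential, which lies there.\<close>
  have "(\<Phi> has_real_derivative \<Phi>' (pot d (P t))) (at (pot d (P t)) within (\<lambda>t. pot d (P t)) ` T)"
    using sub assms(2) by (intro DERIV_subset[OF \<Phi>_deriv]) auto
  from field_vector_diff_chain_within[OF p this]
  have "((\<lambda>t. \<Phi> (pot d (P t))) has_vector_derivative
      - (z t \<bullet> torque d (P t)) * \<Phi>' (pot d (P t))) (at t within T)"
    by (simp add: o_def)
  moreover have "((\<lambda>t. m/2 * (norm (z t))\<^sup>2) has_vector_derivative
      m/2 * (2 * (z t \<bullet> ((1/m) *\<^sub>R (force (P t) - A t *v z t))))) (at t within T)"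
    by (intro has_vector_derivative_mult_right norm2_has_vector_derivative solD[OF assms])
  ultimately have "((\<lambda>t. energy (P t) (z t)) has_vector_derivative
      m/2 * (2 * (z t \<bullet> ((1/m) *\<^sub>R (force (P t) - A t *v z t))))
      + - (z t \<bullet> torque d (P t)) * \<Phi>' (pot d (P t))) (at t within T)"
    unfolding energy_def by (intro has_vector_derivative_add)
  moreover have "max 0 (pot d (P t)) = pot d (P t)"
    using pot_nonneg solD(1)[OF assms] by simp
  then have "m/2 * (2 * (z t \<bullet> ((1/m) *\<^sub>R (force (P t) - A t *v z t))))
      + - (z t \<bullet> torque d (P t)) * \<Phi>' (pot d (P t)) = - (z t \<bullet> (A t *v z t))"
    using m_pos by (simp add: force_def inner_diff_right field_simps)
  ultimately show ?thesis by simp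
qed

lemma energy_nonincreasing:
  assumes "sol T P z" "s \<le> t" "{s..t} \<subseteq> T" "t0 \<le> s"
  shows "energy (P t) (z t) \<le> energy (P s) (z s)"
proof (rule nonincreasing_within[OF assms(2,3) energy_deriv[OF assms(1)]])
  fix x assume "x \<in> {s..t}"
  then have "lam * (norm (z x))\<^sup>2 \<le> z x \<bullet> (A x *v z x)" using assms by (intro A_coercive) auto
  moreover have "0 \<le> lam * (norm (z x))\<^sup>2" using lam_pos by simp
  ultimately show "- (z x \<bullet> (A x *v z x)) \<le> 0" by linarith
qed

end

section \<open>Existence and continuous dependence of solutions\<close>

context observer
begin

text \<open>Here \<open>u\<close> is the force and \<open>v\<close> the damping. Adding 1 to the
  squared norm lets a single linear rate absorb the bounded force as well, through
  \<open>2 |z| <= |z|^2 + 1\<close>.\<close>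

lemma norm2_deriv_bound:
  assumes "norm u \<le> C" "norm v \<le> alpha * norm z" "C \<ge> 0"
  shows "\<bar>2 * (z \<bullet> ((1/m) *\<^sub>R (u - v)))\<bar> \<le> (C + 2 * alpha) / m * ((norm z)\<^sup>2 + 1)"
proof -
  have "\<bar>z \<bullet> (u - v)\<bar> \<le> norm z * norm (u - v)" by (rule Cauchy_Schwarz_ineq2)
  also have "\<dots> \<le> norm z * (C + alpha * norm z)"
    using norm_triangle_ineq4[of u v] assms by (intro mult_left_mono) auto
  finally have "2 * \<bar>z \<bullet> (u - v)\<bar> \<le> 2 * (norm z * (C + alpha * norm z))" by simp
  also have "\<dots> = C * (2 * norm z) + 2 * alpha * (norm z)\<^sup>2"
    by (simp add: algebra_simps power2_eq_square)
  also have "\<dots> \<le> C * ((norm z)\<^sup>2 + 1) + 2 * alpha * ((norm z)\<^sup>2 + 1)"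
    using assms(3) alpha_nonneg sum_squares_bound[of "norm z" 1]
    by (intro add_mono mult_left_mono) auto
  finally have "2 * \<bar>z \<bullet> (u - v)\<bar> / m \<le> (C + 2 * alpha) * ((norm z)\<^sup>2 + 1) / m"
    using m_pos by (intro divide_right_mono) (auto simp: algebra_simps)
  then show ?thesis using m_pos by (simp add: abs_mult)
qed

text \<open>The sign \<open>c\<close> covers reversed time, where damping turns into antidamping and
  only an exponential bound on \<open>z\<close> remains.\<close>

lemma norm_z_growth:
  fixes z u :: "real \<Rightarrow> real^3" and B :: "real \<Rightarrow> real^3^3"
  assumes der: "\<And>t. t \<in> {a..b} \<Longrightarrow>
      (z has_vector_derivative c *\<^sub>R ((1/m) *\<^sub>R (u t - B t *v z t))) (at t within {a..b})"
    and u: "\<And>t. t \<in> {a..b} \<Longrightarrow> norm (u t) \<le> C"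
    and B: "\<And>t x. t \<in> {a..b} \<Longrightarrow> norm (B t *v x) \<le> alpha * norm x"
    and c: "\<bar>c\<bar> = 1" and C: "C \<ge> 0" and "s \<in> {a..b}" "t \<in> {a..b}"
  shows "(norm (z t))\<^sup>2 + 1 \<le> ((norm (z s))\<^sup>2 + 1) * exp ((C + 2 * alpha) / m * (b - a))"
proof (rule gronwall[where f = "\<lambda>t. (norm (z t))\<^sup>2 + 1"
      and f' = "\<lambda>t. 2 * (z t \<bullet> (c *\<^sub>R ((1/m) *\<^sub>R (u t - B t *v z t))))"])
  fix x assume x: "x \<in> {a..b}"
  show "((\<lambda>t. (norm (z t))\<^sup>2 + 1) has_vector_derivative
      2 * (z x \<bullet> (c *\<^sub>R ((1/m) *\<^sub>R (u x - B x *v z x))))) (at x within {a..b})"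
    using has_vector_derivative_add[OF norm2_has_vector_derivative[OF der[OF x]]
        has_vector_derivative_const[of 1]] by simp
  have "\<bar>2 * (z x \<bullet> ((1/m) *\<^sub>R (u x - B x *v z x)))\<bar> \<le> (C + 2 * alpha) / m * ((norm (z x))\<^sup>2 + 1)"
    by (intro norm2_deriv_bound u B x C)
  then show "\<bar>2 * (z x \<bullet> (c *\<^sub>R ((1/m) *\<^sub>R (u x - B x *v z x))))\<bar>
      \<le> (C + 2 * alpha) / m * ((norm (z x))\<^sup>2 + 1)"
    using c by (simp add: abs_mult)
qed (use C alpha_nonneg m_pos assms in auto)

text \<open>The vector field is made globally Lipschitz by projecting the state radially onto balls;
  a radial projection of \<open>P\<close> keeps \<open>transpose P ** P\<close> invariant.\<close>

lemma truncated_exists: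
  assumes B_cont: "continuous_on {a..} B"
    and B: "\<And>t x. t \<ge> a \<Longrightarrow> norm (B t *v x) \<le> alpha * norm x"
    and c: "\<bar>c\<bar> = 1" and \<rho>: "\<rho> > 0" and P0: "P0 \<in> SO3"
  obtains P z where "P a = P0" "z a = z0" "\<And>t. t \<ge> a \<Longrightarrow> P t \<in> SO3"
    "\<And>t. t \<ge> a \<Longrightarrow> (P has_vector_derivative c *\<^sub>R (skew (radial_proj \<rho> (z t)) ** P t)) (at t within {a..})"
    "\<And>t. t \<ge> a \<Longrightarrow>
      (z has_vector_derivative c *\<^sub>R ((1/m) *\<^sub>R (force (P t) - B t *v z t))) (at t within {a..})"
proof -
  let ?p = "radial_proj 2 :: real^3^3 \<Rightarrow> real^3^3" and ?r = "radial_proj \<rho> :: real^3 \<Rightarrow> real^3"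
  define F where "F t x = (c *\<^sub>R (skew (?r (snd x)) ** ?p (fst x)),
      c *\<^sub>R ((1/m) *\<^sub>R (force (?p (fst x)) - B t *v snd x)))" for t x
  obtain Lf where Lf: "Lf \<ge> 0" "\<And>P Q. norm P \<le> 2 \<Longrightarrow> norm Q \<le> 2 \<Longrightarrow> norm (force P - force Q) \<le> Lf * norm (P - Q)"
    using force_lipschitz by blast
  interpret S: bounded_bilinear "\<lambda>z (P :: real^3^3). skew z ** P"
    by (rule bounded_bilinear_skew_mult)
  obtain K where K: "K > 0" "\<And>z (P :: real^3^3). norm (skew z ** P) \<le> norm z * norm P * K"
    using S.pos_bounded by blast
  have p2: "norm (?p x) \<le> 2" for x by (rule norm_radial_proj) simp
  have plip: "norm (?p x - ?p y) \<le> norm (x - y)" for x y by (rule radial_proj_lipschitz) simp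
  have rr: "norm (?r x) \<le> \<rho>" for x by (rule norm_radial_proj[OF \<rho>])
  have rlip: "norm (?r x - ?r y) \<le> norm (x - y)" for x y by (rule radial_proj_lipschitz[OF \<rho>])
  have flip: "norm (force (?p x) - force (?p y)) \<le> Lf * norm (x - y)" for x y
    using Lf(2)[OF p2 p2, of x y] mult_left_mono[OF plip[of x y] Lf(1)] by linarith
  have contp: "continuous_on UNIV ?p"
    by (rule lipschitz_on_continuous_on[of 1]) (auto intro!: lipschitz_onI simp: dist_norm plip)
  have contr: "continuous_on UNIV ?r"
    by (rule lipschitz_on_continuous_on[of 1]) (auto intro!: lipschitz_onI simp: dist_norm rlip)
  have contf: "continuous_on UNIV (\<lambda>x. force (?p x))"
    by (rule lipschitz_on_continuous_on[of Lf]) (auto intro!: lipschitz_onI simp: dist_norm flip Lf(1))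
  have "continuous_on ({a..} \<times> UNIV) (\<lambda>(t, x). F t x)"
    unfolding F_def case_prod_beta
    by (intro continuous_intros matrix_continuous_intros continuous_on_compose2[OF contp]
        continuous_on_compose2[OF contr] continuous_on_compose2[OF contf]
        continuous_on_compose2[OF B_cont]) auto
  moreover have "norm (F t x - F t y) \<le> ((\<rho> * K + 2 * K) + (Lf + alpha) / m) * norm (x - y)"
    if "t \<ge> a" for t x y
  proof -
    have xy: "x - y = (fst x - fst y, snd x - snd y)" by (simp add: prod_eq_iff)
    have n1: "norm (fst x - fst y) \<le> norm (x - y)" unfolding xy by (rule norm_fst_le)
    have n2: "norm (snd x - snd y) \<le> norm (x - y)" unfolding xy by (rule norm_snd_le)
    have "skew (?r (snd x)) ** ?p (fst x) - skew (?r (snd y)) ** ?p (fst y)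
        = skew (?r (snd x)) ** (?p (fst x) - ?p (fst y)) + skew (?r (snd x) - ?r (snd y)) ** ?p (fst y)"
      by (simp add: S.diff_left S.diff_right)
    then have "norm (skew (?r (snd x)) ** ?p (fst x) - skew (?r (snd y)) ** ?p (fst y))
        \<le> norm (skew (?r (snd x)) ** (?p (fst x) - ?p (fst y)))
          + norm (skew (?r (snd x) - ?r (snd y)) ** ?p (fst y))"
      by (metis norm_triangle_ineq)
    also have "\<dots> \<le> norm (?r (snd x)) * norm (?p (fst x) - ?p (fst y)) * K
        + norm (?r (snd x) - ?r (snd y)) * norm (?p (fst y)) * K"
      by (intro add_mono K)
    also have "\<dots> \<le> \<rho> * norm (x - y) * K + norm (x - y) * 2 * K"
      using K(1) rr p2 \<rho> order_trans[OF plip n1] order_trans[OF rlip n2]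
      by (intro add_mono mult_right_mono mult_mono) auto
    also have "\<dots> = (\<rho> * K + 2 * K) * norm (x - y)" by (simp add: algebra_simps)
    finally have 1: "norm (fst (F t x - F t y)) \<le> (\<rho> * K + 2 * K) * norm (x - y)"
      using c by (simp add: F_def scaleR_diff_right[symmetric] del: scaleR_diff_right)
    have "norm ((force (?p (fst x)) - B t *v snd x) - (force (?p (fst y)) - B t *v snd y))
        = norm ((force (?p (fst x)) - force (?p (fst y))) - B t *v (snd x - snd y))"
      by (simp add: matrix_vector_mult_diff_distrib algebra_simps)
    also have "\<dots> \<le> norm (force (?p (fst x)) - force (?p (fst y))) + norm (B t *v (snd x - snd y))"
      by (rule norm_triangle_ineq4)
    also have "\<dots> \<le> Lf * norm (fst x - fst y) + alpha * norm (snd x - snd y)"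
      by (intro add_mono flip B that)
    also have "\<dots> \<le> Lf * norm (x - y) + alpha * norm (x - y)"
      using n1 n2 Lf(1) alpha_nonneg by (intro add_mono mult_left_mono)
    finally have "norm ((force (?p (fst x)) - B t *v snd x) - (force (?p (fst y)) - B t *v snd y)) / m
        \<le> (Lf * norm (x - y) + alpha * norm (x - y)) / m"
      using m_pos by (intro divide_right_mono) auto
    moreover have "snd (F t x - F t y)
        = (c / m) *\<^sub>R ((force (?p (fst x)) - B t *v snd x) - (force (?p (fst y)) - B t *v snd y))"
      by (simp add: F_def algebra_simps)
    then have "norm (snd (F t x - F t y))
        = norm ((force (?p (fst x)) - B t *v snd x) - (force (?p (fst y)) - B t *v snd y)) / m"
      unfolding norm_scaleR by (simp only: norm_scaleR) (use c m_pos in simp)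
    ultimately have 2: "norm (snd (F t x - F t y)) \<le> (Lf + alpha) / m * norm (x - y)"
      by (simp add: field_simps)
    have "norm (F t x - F t y) \<le> norm (fst (F t x - F t y)) + norm (snd (F t x - F t y))"
      by (metis norm_Pair_le prod.collapse)
    then show ?thesis using 1 2 by (simp add: algebra_simps)
  qed
  ultimately obtain X where X0: "X a = (P0, z0)"
    and X: "\<And>t. t \<ge> a \<Longrightarrow> (X has_vector_derivative F t (X t)) (at t within {a..})"
    using picard_lindeloef[of a F _ "(P0, z0)"] by blast
  define P where "P = (\<lambda>t. fst (X t))"
  define z where "z = (\<lambda>t. snd (X t))"
  have dP: "(P has_vector_derivative c *\<^sub>R (skew (?r (z t)) ** ?p (P t))) (at t within {a..})" if "t \<ge> a" for t
    using bounded_linear.has_vector_derivative[OF bounded_linear_fst X[OF that]]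
    by (simp add: P_def z_def F_def)
  have dz: "(z has_vector_derivative c *\<^sub>R ((1/m) *\<^sub>R (force (?p (P t)) - B t *v z t))) (at t within {a..})"
    if "t \<ge> a" for t
    using bounded_linear.has_vector_derivative[OF bounded_linear_snd X[OF that]]
    by (simp add: P_def z_def F_def)
  \<comment> \<open>The truncated attitude is a multiple of \<open>P t\<close>, so the truncated
    equation still has the form \<open>P' = skew v ** P\<close>, and \<open>SO3_invariant\<close>
    applies before the truncation is known to be inactive.\<close>
  have "\<exists>v. c *\<^sub>R (skew (?r (z t)) ** ?p (P t)) = skew v ** P t" for t
  proof -
    obtain k where "?p (P t) = k *\<^sub>R P t" using radial_proj_scaleR by blast
    then have "c *\<^sub>R (skew (?r (z t)) ** ?p (P t)) = skew ((c * k) *\<^sub>R ?r (z t)) ** P t"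
      by (simp add: S.scaleR_left S.scaleR_right)
    then show ?thesis by blast
  qed
  then obtain v where v: "\<And>t. c *\<^sub>R (skew (?r (z t)) ** ?p (P t)) = skew (v t) ** P t" by metis
  have SO3: "P t \<in> SO3" if "t \<ge> a" for t
    by (rule SO3_invariant[OF _ that, of _ v]) (use P0 X0 dP v in \<open>auto simp: P_def\<close>)
  \<comment> \<open>Rotations lie inside the ball of radius 2. Only the velocity remains truncated,
    and only in the attitude equation; the callers remove this by an a priori bound on
    \<open>z\<close>.\<close>
  have pP: "?p (P t) = P t" if "t \<ge> a" for t
    using norm_SO3_le[OF SO3[OF that]] by (rule radial_proj_id)
  show ?thesis
    by (rule that[of P z]) (use X0 SO3 dP dz pP in \<open>auto simp: P_def z_def\<close>)
qed

text \<open>Damping against a bounded force bounds \<open>z\<close> independently of the truncation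
  radius, because the equation of \<open>z\<close> is not truncated in \<open>z\<close>. The energy
  cannot serve here: with a truncated velocity in the attitude equation the work terms no longer
  cancel.\<close>

lemma forward_exists:
  assumes "t1 \<ge> t0" "P0 \<in> SO3"
  obtains P z where "sol {t1..} P z" "P t1 = P0" "z t1 = z0"
proof -
  obtain C where C: "C > 0" "\<And>P. norm P \<le> 2 \<Longrightarrow> norm (force P) \<le> C" using force_bound by blast
  \<comment> \<open>\<open>C / lam\<close> is the speed at which damping balances the largest force;
    the 1 makes the radius positive.\<close>
  define \<rho> where "\<rho> = norm z0 + C / lam + 1"
  have "\<rho> > 0" using C lam_pos by (simp add: \<rho>_def add_nonneg_pos)
  obtain P z where Pz: "P t1 = P0" "z t1 = z0" "\<And>t. t \<ge> t1 \<Longrightarrow> P t \<in> SO3"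
    "\<And>t. t \<ge> t1 \<Longrightarrow> (P has_vector_derivative 1 *\<^sub>R (skew (radial_proj \<rho> (z t)) ** P t)) (at t within {t1..})"
    "\<And>t. t \<ge> t1 \<Longrightarrow>
      (z has_vector_derivative 1 *\<^sub>R ((1/m) *\<^sub>R (force (P t) - A t *v z t))) (at t within {t1..})"
    by (rule truncated_exists[of t1 A 1 \<rho> P0 z0])
      (use assms \<open>\<rho> > 0\<close> A_bound in \<open>auto intro: continuous_on_subset[OF A_cont]\<close>)
  have bound: "norm (z t) \<le> \<rho>" if "t \<ge> t1" for t
  proof -
    \<comment> \<open>The excess over the balance speed, in squares: it obeys a decay inequality
      with rate \<open>lam / m\<close>, though it may itself be negative.\<close>
    let ?f = "\<lambda>t. (norm (z t))\<^sup>2 - (C / lam)\<^sup>2"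
    have "?f t \<le> ?f t1 * exp (- lam / m * (t - t1))"
    proof (rule gronwall_forward[OF that, where T = "{t1..}"
          and f' = "\<lambda>t. 2 * (z t \<bullet> ((1/m) *\<^sub>R (force (P t) - A t *v z t)))"])
      fix x assume "x \<in> {t1..}"
      then have "(z has_vector_derivative (1/m) *\<^sub>R (force (P x) - A x *v z x)) (at x within {t1..})"
        using Pz(5) by simp
      from norm2_has_vector_derivative[OF this]
      show "(?f has_vector_derivative 2 * (z x \<bullet> ((1/m) *\<^sub>R (force (P x) - A x *v z x)))) (at x within {t1..})"
        using has_vector_derivative_diff[OF _ has_vector_derivative_const] by fastforce
    next
      fix x assume "x \<in> {t1..t}"
      then have x: "x \<ge> t1" by simp
      have "z x \<bullet> force (P x) \<le> norm (z x) * norm (force (P x))" by (rule norm_cauchy_schwarz)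
      also have "\<dots> \<le> norm (z x) * C"
        using C(2)[OF norm_SO3_le[OF Pz(3)[OF x]]] by (intro mult_left_mono) auto
      finally have "z x \<bullet> (force (P x) - A x *v z x) \<le> norm (z x) * C - lam * (norm (z x))\<^sup>2"
        using A_coercive[of x "z x"] x assms(1) by (simp add: inner_diff_right)
      \<comment> \<open>Young's inequality in the form \<open>2 a q <= a^2 + q^2\<close>.\<close>
      moreover have "2 * X \<le> - lam * (a\<^sup>2 - q\<^sup>2)" if "X \<le> a * (lam * q) - lam * a\<^sup>2" for X a q :: real
      proof -
        have "0 \<le> lam * (a - q)\<^sup>2" using lam_pos by simp
        then show ?thesis using that by (simp add: power2_diff algebra_simps)
      qed
      ultimately have "2 * (z x \<bullet> (force (P x) - A x *v z x)) \<le> - lam * ((norm (z x))\<^sup>2 - (C/lam)\<^sup>2)"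
        using lam_pos by simp
      then have "2 * (z x \<bullet> (force (P x) - A x *v z x)) / m \<le> - lam * ((norm (z x))\<^sup>2 - (C/lam)\<^sup>2) / m"
        using m_pos by (intro divide_right_mono) auto
      then show "2 * (z x \<bullet> ((1/m) *\<^sub>R (force (P x) - A x *v z x))) \<le> - lam / m * ((norm (z x))\<^sup>2 - (C/lam)\<^sup>2)"
        by simp
    qed auto
    also have "\<dots> \<le> (norm z0)\<^sup>2"
    proof -
      have "(norm z0)\<^sup>2 - (C/lam)\<^sup>2 \<le> (norm z0)\<^sup>2" by simp
      then have "((norm z0)\<^sup>2 - (C/lam)\<^sup>2) * exp (- lam / m * (t - t1)) \<le> (norm z0)\<^sup>2 * exp (- lam / m * (t - t1))"
        by (intro mult_right_mono) auto
      also have "\<dots> \<le> (norm z0)\<^sup>2 * 1"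
        using lam_pos m_pos that by (intro mult_left_mono) auto
      finally show ?thesis by (simp add: Pz)
    qed
    finally have "(norm (z t))\<^sup>2 \<le> (norm z0)\<^sup>2 + (C/lam)\<^sup>2" by simp
    also have "\<dots> \<le> (norm z0 + C / lam)\<^sup>2" using C lam_pos by (simp add: power2_sum)
    finally have "norm (z t) \<le> norm z0 + C / lam"
      using C(1) lam_pos by (auto intro: power2_le_imp_le)
    then show ?thesis by (simp add: \<rho>_def)
  qed
  have "sol {t1..} P z"
    unfolding sol_def using Pz(3-5) radial_proj_id[OF bound] by auto
  then show ?thesis using that Pz(1,2) by blast
qed

text \<open>Solved in the reversed time \<open>T - t\<close>. Damping now feeds the velocity, so its
  bound is the exponential one over the finite length \<open>T - t0\<close>.\<close>

lemma backward_exists: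
  assumes "t0 \<le> T" "P0 \<in> SO3"
  obtains P z where "sol {t0..T} P z" "P T = P0" "z T = z0"
proof -
  obtain C where C: "C > 0" "\<And>P. norm P \<le> 2 \<Longrightarrow> norm (force P) \<le> C" using force_bound by blast
  define \<rho> where "\<rho> = sqrt (((norm z0)\<^sup>2 + 1) * exp ((C + 2 * alpha) / m * (T - t0)))"
  have "\<rho> > 0" by (auto simp: \<rho>_def intro!: mult_pos_pos add_nonneg_pos)
  \<comment> \<open>\<open>truncated_exists\<close> wants a coefficient on a whole half-line, while
    \<open>A\<close> is controlled only from \<open>t0\<close> on; the clamp extends it by the
    constant \<open>A t0\<close>.\<close>
  define B where "B s = A (max t0 (T - s))" for s
  have B: "norm (B t *v x) \<le> alpha * norm x" for t x
    unfolding B_def by (rule A_bound) simp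
  have "continuous_on {0..} B"
    unfolding B_def by (intro continuous_on_compose2[OF A_cont] continuous_intros) auto
  then obtain P z where Pz: "P 0 = P0" "z 0 = z0" "\<And>t. t \<ge> 0 \<Longrightarrow> P t \<in> SO3"
    "\<And>t. t \<ge> 0 \<Longrightarrow> (P has_vector_derivative (-1) *\<^sub>R (skew (radial_proj \<rho> (z t)) ** P t)) (at t within {0..})"
    "\<And>t. t \<ge> 0 \<Longrightarrow>
      (z has_vector_derivative (-1) *\<^sub>R ((1/m) *\<^sub>R (force (P t) - B t *v z t))) (at t within {0..})"
    using truncated_exists[of 0 B "-1" \<rho> P0 z0] B \<open>\<rho> > 0\<close> assms by auto
  have bound: "norm (z t) \<le> \<rho>" if "t \<in> {0..T - t0}" for t
  proof -
    have "(norm (z t))\<^sup>2 + 1 \<le> ((norm (z 0))\<^sup>2 + 1) * exp ((C + 2 * alpha) / m * (T - t0 - 0))"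
    proof (rule norm_z_growth)
      show "(z has_vector_derivative (-1) *\<^sub>R ((1/m) *\<^sub>R (force (P s) - B s *v z s))) (at s within {0..T - t0})"
        if "s \<in> {0..T - t0}" for s
        by (rule has_vector_derivative_within_subset[OF Pz(5)]) (use that in auto)
    qed (use C B Pz(3) norm_SO3_le that assms in auto)
    then have "(norm (z t))\<^sup>2 \<le> \<rho>\<^sup>2"
      by (simp add: \<rho>_def Pz)
    then show ?thesis by (rule power2_le_imp_le) (use \<open>\<rho> > 0\<close> in simp)
  qed
  have rev: "((\<lambda>t. f (T - t)) has_vector_derivative f') (at t within {t0..T})"
    if "(f has_vector_derivative (-1) *\<^sub>R f') (at (T - t) within {0..})" for f :: "real \<Rightarrow> 'b::real_normed_vector" and f' t
  proof -
    have "((\<lambda>t. T - t) has_vector_derivative -1) (at t within {t0..T})"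
      by (auto intro!: derivative_eq_intros)
    moreover have "(f has_vector_derivative (-1) *\<^sub>R f') (at (T - t) within (\<lambda>t. T - t) ` {t0..T})"
      by (rule has_vector_derivative_within_subset[OF that]) auto
    ultimately have "(f \<circ> (\<lambda>t. T - t) has_vector_derivative (-1) *\<^sub>R ((-1) *\<^sub>R f')) (at t within {t0..T})"
      by (rule vector_diff_chain_within)
    then show ?thesis by (simp add: o_def)
  qed
  have "sol {t0..T} (\<lambda>t. P (T - t)) (\<lambda>t. z (T - t))"
    unfolding sol_def
  proof (intro ballI conjI)
    fix t assume t: "t \<in> {t0..T}"
    then have Tt: "T - t \<ge> 0" "T - t \<in> {0..T - t0}" by auto
    show "P (T - t) \<in> SO3" by (rule Pz(3)[OF Tt(1)])
    show "((\<lambda>t. P (T - t)) has_vector_derivative skew (z (T - t)) ** P (T - t)) (at t within {t0..T})"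
      by (rule rev) (use Pz(4)[OF Tt(1)] radial_proj_id[OF bound[OF Tt(2)]] in simp)
    have "B (T - t) = A t" using t by (simp add: B_def)
    then show "((\<lambda>t. z (T - t)) has_vector_derivative (1/m) *\<^sub>R (force (P (T - t)) - A t *v z (T - t)))
        (at t within {t0..T})"
      by (intro rev) (use Pz(5)[OF Tt(1)] in simp)
  qed
  then show ?thesis using that[of "\<lambda>t. P (T - t)" "\<lambda>t. z (T - t)"] Pz(1,2) by simp
qed

text \<open>The constant depends on the speed bound alone, not on the interval or the solutions, and
  \<open>s\<close>, \<open>t\<close> are unordered: one form serves uniqueness, forward dependence
  and backward dependence. The sum of squares is differentiable and equals the squared product
  distance.\<close>

definition growth_rate :: "real \<Rightarrow> real \<Rightarrow> bool" where
  "growth_rate \<rho> K \<longleftrightarrow> (\<forall>a b s t P1 z1 P2 z2. sol {a..b} P1 z1 \<longrightarrow> sol {a..b} P2 z2 \<longrightarrow> t0 \<le> a \<longrightarrow>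
      s \<in> {a..b} \<longrightarrow> t \<in> {a..b} \<longrightarrow> (\<forall>t\<in>{a..b}. norm (z1 t) \<le> \<rho> \<and> norm (z2 t) \<le> \<rho>) \<longrightarrow>
      (norm (P1 t - P2 t))\<^sup>2 + (norm (z1 t - z2 t))\<^sup>2
        \<le> ((norm (P1 s - P2 s))\<^sup>2 + (norm (z1 s - z2 s))\<^sup>2) * exp (K * (b - a)))"

lemma growth_rate_exists:
  obtains K where "growth_rate \<rho> K"
proof -
  obtain Lf where Lf: "Lf \<ge> 0" "\<And>P Q. norm P \<le> 2 \<Longrightarrow> norm Q \<le> 2 \<Longrightarrow> norm (force P - force Q) \<le> Lf * norm (P - Q)"
    using force_lipschitz by blast
  interpret S: bounded_bilinear "\<lambda>z (P :: real^3^3). skew z ** P"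
    by (rule bounded_bilinear_skew_mult)
  obtain k where k: "k > 0" "\<And>z (P :: real^3^3). norm (skew z ** P) \<le> norm z * norm P * k"
    using S.pos_bounded by blast
  \<comment> \<open>Keeps the rate nonnegative, since \<open>\<rho>\<close> is unrestricted.\<close>
  define r where "r = max 0 \<rho>"
  define K where "K = 2 * (r * k + 2 * k + Lf / m + alpha / m)"
  have "K \<ge> 0" using k(1) Lf(1) alpha_nonneg m_pos by (simp add: K_def r_def)
  have main: "(norm (P1 t - P2 t))\<^sup>2 + (norm (z1 t - z2 t))\<^sup>2
        \<le> ((norm (P1 s - P2 s))\<^sup>2 + (norm (z1 s - z2 s))\<^sup>2) * exp (K * (b - a))"
    if s1: "sol {a..b} P1 z1" and s2: "sol {a..b} P2 z2" and "t0 \<le> a" and st: "s \<in> {a..b}" "t \<in> {a..b}"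
      and b1: "\<And>t. t \<in> {a..b} \<Longrightarrow> norm (z1 t) \<le> \<rho>" and b2: "\<And>t. t \<in> {a..b} \<Longrightarrow> norm (z2 t) \<le> \<rho>"
    for a b s t P1 z1 P2 z2
  proof (rule gronwall[OF st, where f = "\<lambda>t. (norm (P1 t - P2 t))\<^sup>2 + (norm (z1 t - z2 t))\<^sup>2"
        and f' = "\<lambda>t. 2 * ((P1 t - P2 t) \<bullet> (skew (z1 t) ** P1 t - skew (z2 t) ** P2 t))
          + 2 * ((z1 t - z2 t) \<bullet> ((1/m) *\<^sub>R (force (P1 t) - A t *v z1 t) - (1/m) *\<^sub>R (force (P2 t) - A t *v z2 t)))"])
    fix x assume x: "x \<in> {a..b}"
    show "((\<lambda>t. (norm (P1 t - P2 t))\<^sup>2 + (norm (z1 t - z2 t))\<^sup>2) has_vector_derivative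
        2 * ((P1 x - P2 x) \<bullet> (skew (z1 x) ** P1 x - skew (z2 x) ** P2 x))
          + 2 * ((z1 x - z2 x) \<bullet> ((1/m) *\<^sub>R (force (P1 x) - A x *v z1 x) - (1/m) *\<^sub>R (force (P2 x) - A x *v z2 x))))
        (at x within {a..b})"
      by (intro has_vector_derivative_add norm2_has_vector_derivative has_vector_derivative_diff
          solD[OF s1 x] solD[OF s2 x])
    define Z w where "Z = P1 x - P2 x" and "w = z1 x - z2 x"
    \<comment> \<open>Bilinearity leaves one difference in each summand; the other factor is bounded
      by the speed bound or by \<open>norm_SO3_le\<close>.\<close>
    have "skew (z1 x) ** P1 x - skew (z2 x) ** P2 x = skew (z1 x) ** Z + skew w ** P2 x"
      by (simp add: S.diff_left S.diff_right Z_def w_def)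
    then have "norm (skew (z1 x) ** P1 x - skew (z2 x) ** P2 x) \<le> norm (skew (z1 x) ** Z) + norm (skew w ** P2 x)"
      by (metis norm_triangle_ineq)
    also have "\<dots> \<le> norm (z1 x) * norm Z * k + norm w * norm (P2 x) * k"
      by (intro add_mono k)
    also have "\<dots> \<le> r * norm Z * k + norm w * 2 * k"
      using b1[OF x] norm_SO3_le[OF solD(1)[OF s2 x]] k(1)
      by (intro add_mono mult_right_mono mult_left_mono) (auto simp: r_def)
    finally have "norm Z * norm (skew (z1 x) ** P1 x - skew (z2 x) ** P2 x)
        \<le> norm Z * (r * norm Z * k + norm w * 2 * k)"
      by (rule mult_left_mono) simp
    then have 1: "\<bar>Z \<bullet> (skew (z1 x) ** P1 x - skew (z2 x) ** P2 x)\<bar> \<le> r * k * (norm Z)\<^sup>2 + k * (2 * norm Z * norm w)"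
      using Cauchy_Schwarz_ineq2[of Z "skew (z1 x) ** P1 x - skew (z2 x) ** P2 x"]
      by (simp add: algebra_simps power2_eq_square)
    have "(1/m) *\<^sub>R (force (P1 x) - A x *v z1 x) - (1/m) *\<^sub>R (force (P2 x) - A x *v z2 x)
        = (1/m) *\<^sub>R ((force (P1 x) - force (P2 x)) - A x *v w)"
      by (simp add: w_def matrix_vector_mult_diff_distrib algebra_simps)
    then have "norm ((1/m) *\<^sub>R (force (P1 x) - A x *v z1 x) - (1/m) *\<^sub>R (force (P2 x) - A x *v z2 x))
        = norm ((force (P1 x) - force (P2 x)) - A x *v w) / m"
      using m_pos by simp
    also have "\<dots> \<le> (norm (force (P1 x) - force (P2 x)) + norm (A x *v w)) / m"
      using m_pos by (intro divide_right_mono norm_triangle_ineq4) auto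
    also have "\<dots> \<le> (Lf * norm Z + alpha * norm w) / m"
      using m_pos Lf(2) norm_SO3_le[OF solD(1)[OF s1 x]] norm_SO3_le[OF solD(1)[OF s2 x]] A_bound[of x w] x \<open>t0 \<le> a\<close>
      by (intro divide_right_mono add_mono) (auto simp: Z_def)
    finally have "norm w * norm ((1/m) *\<^sub>R (force (P1 x) - A x *v z1 x) - (1/m) *\<^sub>R (force (P2 x) - A x *v z2 x))
        \<le> norm w * ((Lf * norm Z + alpha * norm w) / m)"
      by (rule mult_left_mono) simp
    with Cauchy_Schwarz_ineq2
    have "\<bar>w \<bullet> ((1/m) *\<^sub>R (force (P1 x) - A x *v z1 x) - (1/m) *\<^sub>R (force (P2 x) - A x *v z2 x))\<bar>
        \<le> norm w * ((Lf * norm Z + alpha * norm w) / m)"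
      by (rule order_trans)
    also have "\<dots> = Lf / m * (norm Z * norm w) + alpha / m * (norm w)\<^sup>2"
      by (simp add: add_divide_distrib algebra_simps power2_eq_square)
    finally have 2: "\<bar>w \<bullet> ((1/m) *\<^sub>R (force (P1 x) - A x *v z1 x) - (1/m) *\<^sub>R (force (P2 x) - A x *v z2 x))\<bar>
        \<le> Lf / m * (norm Z * norm w) + alpha / m * (norm w)\<^sup>2" .
    let ?N = "(norm Z)\<^sup>2 + (norm w)\<^sup>2"
    have "0 \<le> norm Z * norm w" by simp
    then have n: "2 * norm Z * norm w \<le> ?N" "norm Z * norm w \<le> ?N" "(norm Z)\<^sup>2 \<le> ?N" "(norm w)\<^sup>2 \<le> ?N"
      using sum_squares_bound[of "norm Z" "norm w"] by (auto simp: mult.assoc simp del: mult_nonneg_nonneg)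
    have "r * k * (norm Z)\<^sup>2 + k * (2 * norm Z * norm w) \<le> r * k * ?N + k * ?N"
      by (intro add_mono mult_left_mono n) (use k(1) in \<open>simp_all add: r_def\<close>)
    also have "\<dots> \<le> (r * k + 2 * k) * ?N"
      using k(1) by (simp add: distrib_right)
    finally have 3: "\<bar>Z \<bullet> (skew (z1 x) ** P1 x - skew (z2 x) ** P2 x)\<bar> \<le> (r * k + 2 * k) * ?N"
      using 1 by linarith
    have "Lf / m * (norm Z * norm w) + alpha / m * (norm w)\<^sup>2 \<le> Lf / m * ?N + alpha / m * ?N"
      by (intro add_mono mult_left_mono n) (use Lf(1) alpha_nonneg m_pos in simp_all)
    with 2 have 4: "\<bar>w \<bullet> ((1/m) *\<^sub>R (force (P1 x) - A x *v z1 x) - (1/m) *\<^sub>R (force (P2 x) - A x *v z2 x))\<bar>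
        \<le> (Lf / m + alpha / m) * ?N"
      by (simp only: distrib_right)
    have "\<bar>2 * p + 2 * q\<bar> \<le> 2 * (X + Y)" if "\<bar>p\<bar> \<le> X" "\<bar>q\<bar> \<le> Y" for p q X Y :: real
      using that by (simp add: abs_le_iff)
    moreover have "2 * ((r * k + 2 * k) * ?N + (Lf / m + alpha / m) * ?N) = K * ?N"
      by (simp add: K_def algebra_simps)
    ultimately show "\<bar>2 * ((P1 x - P2 x) \<bullet> (skew (z1 x) ** P1 x - skew (z2 x) ** P2 x))
          + 2 * ((z1 x - z2 x) \<bullet> ((1/m) *\<^sub>R (force (P1 x) - A x *v z1 x) - (1/m) *\<^sub>R (force (P2 x) - A x *v z2 x)))\<bar>
        \<le> K * ((norm (P1 x - P2 x))\<^sup>2 + (norm (z1 x - z2 x))\<^sup>2)"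
      using 3 4 unfolding Z_def w_def by metis
  qed (use \<open>K \<ge> 0\<close> in auto)
  have "growth_rate \<rho> K"
    unfolding growth_rate_def by (intro allI impI main) auto
  then show ?thesis by (rule that)
qed

end

section \<open>Convergence and stability\<close>

lemma dist_pair_less:
  fixes P Q :: "'a::real_normed_vector" and z w :: "'b::real_normed_vector"
  assumes "(norm (P - Q))\<^sup>2 + (norm (z - w))\<^sup>2 < e\<^sup>2" "e > 0"
  shows "dist (P, z) (Q, w) < e"
  using assms real_sqrt_less_iff[of _ "e\<^sup>2"] unfolding dist_Pair_Pair by (simp add: dist_norm)

lemma dist_pair_power2:
  fixes P Q :: "'a::real_normed_vector" and z w :: "'b::real_normed_vector"
  shows "(dist (P, z) (Q, w))\<^sup>2 = (norm (P - Q))\<^sup>2 + (norm (z - w))\<^sup>2"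
  unfolding dist_Pair_Pair by (simp add: dist_norm)

lemma lipschitz_of_derivative_bound:
  fixes f :: "real \<Rightarrow> 'a::real_normed_vector"
  assumes der: "\<And>t. t \<ge> a \<Longrightarrow> (f has_vector_derivative f' t) (at t within {a..})"
    and le: "\<And>t. t \<ge> a \<Longrightarrow> norm (f' t) \<le> M" and "a \<le> s" "s \<le> t"
  shows "norm (f t - f s) \<le> M * (t - s)"
proof -
  have "norm (f t - f s) \<le> M * norm (t - s)"
  proof (rule differentiable_bound[of "{a..}" f "\<lambda>x h. h *\<^sub>R f' x"])
    fix x :: real assume "x \<in> {a..}"
    then show "(f has_derivative (\<lambda>h. h *\<^sub>R f' x)) (at x within {a..})"
      using der by (simp add: has_vector_derivative_def)
    show "onorm (\<lambda>h. h *\<^sub>R f' x) \<le> M"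
      using le[of x] \<open>x \<in> {a..}\<close> order_trans[OF norm_ge_zero le[of x]]
      by (intro onorm_bound) (auto simp: mult.commute[of M] intro: mult_left_mono)
  qed (use assms in auto)
  then show ?thesis using assms by simp
qed

context observer
begin

lemma continuous_on_force: "continuous_on SO3 force"
proof -
  obtain L where L: "L \<ge> 0" "\<And>P Q. norm P \<le> 2 \<Longrightarrow> norm Q \<le> 2 \<Longrightarrow> norm (force P - force Q) \<le> L * norm (P - Q)"
    using force_lipschitz by blast
  show ?thesis
    by (rule lipschitz_on_continuous_on[of L])
      (use L norm_SO3_le in \<open>auto intro!: lipschitz_onI simp: dist_norm\<close>)
qed

lemma continuous_on_energy: "continuous_on (SO3 \<times> UNIV) (\<lambda>x. energy (fst x) (snd x))"
  unfolding energy_def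
  by (intro continuous_intros continuous_on_compose2[OF \<Phi>_continuous]) (auto simp: pot_nonneg)

lemma energy_mat_1 [simp]: "energy (mat 1) 0 = 0"
  by (simp add: energy_def \<Phi>_zero)

lemma sol_norm_le:
  assumes S: "sol {a..} P z" and "t0 \<le> a" "a \<le> t"
  shows "norm (z t) \<le> sqrt (2 * energy (P a) (z a) / m)"
proof -
  have "energy (P t) (z t) \<le> energy (P a) (z a)"
    by (rule energy_nonincreasing[OF S]) (use assms in auto)
  then have "2 * energy (P t) (z t) / m \<le> 2 * energy (P a) (z a) / m"
    using m_pos by (intro divide_right_mono) auto
  then have "(norm (z t))\<^sup>2 \<le> 2 * energy (P a) (z a) / m"
    using norm_le_energy[OF solD(1)[OF S], of t "z t"] assms by auto
  then show ?thesis by (rule real_le_rsqrt)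
qed

lemma
  assumes S: "sol {a..} P z" and a: "t0 \<le> a"
  shows z_tendsto_0: "(z \<longlongrightarrow> 0) at_top"
    and force_tendsto_0: "((\<lambda>t. force (P t)) \<longlongrightarrow> 0) at_top"
proof -
  obtain C where C: "C > 0" "\<And>P. norm P \<le> 2 \<Longrightarrow> norm (force P) \<le> C" using force_bound by blast
  obtain Lf where Lf: "Lf \<ge> 0" "\<And>P Q. norm P \<le> 2 \<Longrightarrow> norm Q \<le> 2 \<Longrightarrow> norm (force P - force Q) \<le> Lf * norm (P - Q)"
    using force_lipschitz by blast
  obtain k where k: "k > 0" "\<And>z (P :: real^3^3). norm (skew z ** P) \<le> norm z * norm P * k"
    using bounded_bilinear.pos_bounded[OF bounded_bilinear_skew_mult] by blast
  define \<rho> where "\<rho> = sqrt (2 * energy (P a) (z a) / m)"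
  have zb: "norm (z t) \<le> \<rho>" if "t \<ge> a" for t
    unfolding \<rho>_def by (rule sol_norm_le[OF S a that])
  have "\<rho> \<ge> 0" using order_trans[OF norm_ge_zero zb[of a]] by simp
  have dP: "(P has_vector_derivative skew (z t) ** P t) (at t within {a..})" if "t \<ge> a" for t
    using solD(2)[OF S] that by simp
  have dz: "(z has_vector_derivative (1/m) *\<^sub>R (force (P t) - A t *v z t)) (at t within {a..})" if "t \<ge> a" for t
    using solD(3)[OF S] that by simp
  have P2: "norm (P t) \<le> 2" if "t \<ge> a" for t
    using norm_SO3_le solD(1)[OF S] that by simp
  define M where "M = (C + alpha * \<rho>) / m"
  have zM: "norm ((1/m) *\<^sub>R (force (P t) - A t *v z t)) \<le> M" if "t \<ge> a" for t
  proof -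
    have "norm (force (P t) - A t *v z t) \<le> C + alpha * \<rho>"
    proof (rule order_trans[OF norm_triangle_ineq4 add_mono])
      show "norm (force (P t)) \<le> C" using C(2) P2[OF that] by simp
      show "norm (A t *v z t) \<le> alpha * \<rho>"
        using A_bound[of t "z t"] mult_left_mono[OF zb[OF that] alpha_nonneg] a that by simp
    qed
    then show ?thesis using m_pos by (simp add: M_def divide_right_mono)
  qed
  have "M \<ge> 0" using order_trans[OF norm_ge_zero zM[of a]] by simp
  obtain h where h: "((\<lambda>t. energy (P t) (z t)) \<longlongrightarrow> h) at_top"
  proof (rule tendsto_at_top_nonincreasing[of a "\<lambda>t. energy (P t) (z t)" 0])
    show "energy (P t) (z t) \<le> energy (P s) (z s)" if "a \<le> s" "s \<le> t" for s t
      by (rule energy_nonincreasing[OF S]) (use that a in auto)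
    show "0 \<le> energy (P t) (z t)" if "a \<le> t" for t
      using solD(1)[OF S] that by (simp add: energy_nonneg)
  qed blast
  have ev: "\<forall>\<^sub>F t in at_top. lam * (norm (z t))\<^sup>2 < e" if "e > 0" for e
  proof (rule barbalat[OF h _ _ tendsto_const _ that, where a = a])
    show "((\<lambda>t. energy (P t) (z t)) has_vector_derivative - (z t \<bullet> (A t *v z t))) (at t within {a..})"
      if "a \<le> t" for t by (rule energy_deriv[OF S]) (use that in simp)
    show "- (z t \<bullet> (A t *v z t)) \<le> 0 - lam * (norm (z t))\<^sup>2" if "a \<le> t" for t
      using A_coercive[of t "z t"] that a by simp
    show "\<bar>lam * (norm (z t))\<^sup>2 - lam * (norm (z s))\<^sup>2\<bar> \<le> lam * (2 * (\<rho> * M)) * (t - s)" if "a \<le> s" "s \<le> t" for s t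
    proof -
      have "norm ((norm (z t))\<^sup>2 - (norm (z s))\<^sup>2) \<le> 2 * (\<rho> * M) * (t - s)"
      proof (rule lipschitz_of_derivative_bound[OF _ _ that])
        fix t assume t: "a \<le> t"
        show "((\<lambda>t. (norm (z t))\<^sup>2) has_vector_derivative
            2 * (z t \<bullet> ((1/m) *\<^sub>R (force (P t) - A t *v z t)))) (at t within {a..})"
          by (rule norm2_has_vector_derivative[OF dz[OF t]])
        have "\<bar>z t \<bullet> ((1/m) *\<^sub>R (force (P t) - A t *v z t))\<bar> \<le> norm (z t) * norm ((1/m) *\<^sub>R (force (P t) - A t *v z t))"
          by (rule Cauchy_Schwarz_ineq2)
        also have "\<dots> \<le> \<rho> * M" using zb[OF t] zM[OF t] \<open>\<rho> \<ge> 0\<close> by (intro mult_mono) auto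
        finally show "norm (2 * (z t \<bullet> ((1/m) *\<^sub>R (force (P t) - A t *v z t)))) \<le> 2 * (\<rho> * M)"
          by (simp add: abs_mult)
      qed
      then have "lam * \<bar>(norm (z t))\<^sup>2 - (norm (z s))\<^sup>2\<bar> \<le> lam * (2 * (\<rho> * M) * (t - s))"
        using lam_pos by (intro mult_left_mono) auto
      then show ?thesis
        using lam_pos by (simp add: right_diff_distrib[symmetric] abs_mult mult.assoc)
    qed
  qed
  show z0: "(z \<longlongrightarrow> 0) at_top"
  proof (rule tendstoI)
    fix e :: real assume "e > 0"
    then have "lam * e\<^sup>2 > 0" using lam_pos by simp
    from ev[OF this] show "\<forall>\<^sub>F t in at_top. dist (z t) 0 < e"
    proof eventually_elim
      case (elim t)
      then have "(norm (z t))\<^sup>2 < e\<^sup>2" using lam_pos by simp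
      then have "norm (z t) < e" by (rule power_less_imp_less_base) (use \<open>e > 0\<close> in simp)
      then show ?case by simp
    qed
  qed
  have Az: "((\<lambda>t. A t *v z t) \<longlongrightarrow> 0) at_top"
  proof (rule Lim_null_comparison)
    show "\<forall>\<^sub>F t in at_top. norm (A t *v z t) \<le> alpha * norm (z t)"
      using A_bound a by (auto simp: eventually_at_top_linorder intro!: exI[of _ a])
    show "((\<lambda>t. alpha * norm (z t)) \<longlongrightarrow> 0) at_top"
      using tendsto_mult_right_zero[OF tendsto_norm_zero[OF z0]] by simp
  qed
  have flip: "norm (force (P t) - force (P s)) \<le> Lf * (2 * \<rho> * k) * (t - s)" if "a \<le> s" "s \<le> t" for s t
  proof -
    have "norm (P t - P s) \<le> (2 * \<rho> * k) * (t - s)"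
    proof (rule lipschitz_of_derivative_bound[OF dP _ that])
      fix t assume t: "a \<le> t"
      have "norm (skew (z t) ** P t) \<le> norm (z t) * norm (P t) * k" by (rule k)
      also have "\<dots> \<le> \<rho> * 2 * k"
        using zb[OF t] P2[OF t] \<open>\<rho> \<ge> 0\<close> k(1) by (intro mult_right_mono mult_mono) auto
      finally show "norm (skew (z t) ** P t) \<le> 2 * \<rho> * k" by simp
    qed
    then have "Lf * norm (P t - P s) \<le> Lf * ((2 * \<rho> * k) * (t - s))" using Lf(1) by (rule mult_left_mono)
    moreover have "norm (force (P t) - force (P s)) \<le> Lf * norm (P t - P s)"
      using that by (intro Lf P2) auto
    ultimately show ?thesis by (simp add: mult.assoc)
  qed
  \<comment> \<open>\<open>barbalat\<close> bounds \<open>u\<close> from above only; the signs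
    \<open>c = 1\<close> and \<open>c = -1\<close> together bound the modulus of each
    component.\<close>
  have half: "\<forall>\<^sub>F t in at_top. c * (force (P t) $ i) / m < e" if "e > 0" and c: "\<bar>c\<bar> = 1" for e c i
  proof (rule barbalat[where f = "\<lambda>t. - c * (z t $ i)" and l = "- c * (0 :: real^3) $ i"
        and f' = "\<lambda>t. - c * (((1/m) *\<^sub>R (force (P t) - A t *v z t)) $ i)"
        and v = "\<lambda>t. c * ((A t *v z t) $ i) / m" and a = a, OF _ _ _ _ _ \<open>e > 0\<close>])
    show "((\<lambda>t. - c * (z t $ i)) \<longlongrightarrow> - c * (0 :: real^3) $ i) at_top"
      by (intro tendsto_intros z0)
    show "((\<lambda>t. - c * (z t $ i)) has_vector_derivative - c * (((1/m) *\<^sub>R (force (P t) - A t *v z t)) $ i)) (at t within {a..})"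
      if "a \<le> t" for t
      by (intro has_vector_derivative_mult_right bounded_linear.has_vector_derivative[OF bounded_linear_vec_nth] dz that)
    show "- c * (((1/m) *\<^sub>R (force (P t) - A t *v z t)) $ i) \<le> c * ((A t *v z t) $ i) / m - c * (force (P t) $ i) / m" for t
      using m_pos by (simp add: field_simps)
    show "((\<lambda>t. c * ((A t *v z t) $ i) / m) \<longlongrightarrow> 0) at_top"
      using tendsto_divide[OF tendsto_mult[OF tendsto_const tendsto_vec_nth[OF Az]] tendsto_const, of m c i] m_pos by simp
    show "\<bar>c * (force (P t) $ i) / m - c * (force (P s) $ i) / m\<bar> \<le> (Lf * (2 * \<rho> * k) / m) * (t - s)"
      if "a \<le> s" "s \<le> t" for s t
    proof -
      have "\<bar>c * (force (P t) $ i) / m - c * (force (P s) $ i) / m\<bar> = \<bar>(force (P t) - force (P s)) $ i\<bar> / m"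
        using m_pos c by (simp add: diff_divide_distrib[symmetric] right_diff_distrib[symmetric] abs_mult)
      also have "\<dots> \<le> (Lf * (2 * \<rho> * k) * (t - s)) / m"
        using order_trans[OF component_le_norm_cart flip[OF that]] m_pos by (intro divide_right_mono) auto
      finally show ?thesis by simp
    qed
  qed
  show "((\<lambda>t. force (P t)) \<longlongrightarrow> 0) at_top"
  proof (rule vec_tendstoI)
    fix i
    show "((\<lambda>t. force (P t) $ i) \<longlongrightarrow> 0 $ i) at_top"
    proof (rule tendstoI)
      fix e :: real assume "e > 0"
      then have em: "e / m > 0" using m_pos by simp
      have "\<forall>\<^sub>F t in at_top. 1 * (force (P t) $ i) / m < e / m" by (rule half[OF em]) simp
      moreover have "\<forall>\<^sub>F t in at_top. (-1) * (force (P t) $ i) / m < e / m" by (rule half[OF em]) simp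
      ultimately show "\<forall>\<^sub>F t in at_top. dist (force (P t) $ i) (0 $ i) < e"
      proof eventually_elim
        case (elim t)
        then have "force (P t) $ i < e" "- (force (P t) $ i) < e"
          using m_pos by (simp_all only: divide_less_cancel) simp_all
        then show ?case by (simp add: dist_real_def)
      qed
    qed
  qed
qed

text \<open>Every cluster point in the compact \<open>SO3\<close> is critical and has the potential
  prescribed by the limit of the energy; critical points of equal potential coincide, so the cluster
  point is unique.\<close>

lemma sol_converges:
  assumes S: "sol {a..} P z" and a: "t0 \<le> a"
  obtains Pe where "Pe \<in> SO3" "torque d Pe = 0" "(P \<longlongrightarrow> Pe) at_top"
    "\<Phi> (pot d Pe) \<le> energy (P a) (z a)"
proof -
  obtain h where h: "((\<lambda>t. energy (P t) (z t)) \<longlongrightarrow> h) at_top" "h \<le> energy (P a) (z a)"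
  proof (rule tendsto_at_top_nonincreasing[of a "\<lambda>t. energy (P t) (z t)" 0])
    show "energy (P t) (z t) \<le> energy (P s) (z s)" if "a \<le> s" "s \<le> t" for s t
      by (rule energy_nonincreasing[OF S]) (use that a in auto)
    show "0 \<le> energy (P t) (z t)" if "a \<le> t" for t
      using solD(1)[OF S] that by (simp add: energy_nonneg)
  qed blast
  have cluster: "\<exists>l r. l \<in> SO3 \<and> strict_mono (r :: nat \<Rightarrow> nat) \<and> (\<lambda>n. P (\<tau> (r n))) \<longlonglongrightarrow> l \<and>
      torque d l = 0 \<and> \<Phi> (pot d l) = h"
    if \<tau>: "filterlim \<tau> at_top sequentially" "\<And>n. \<tau> n \<ge> a" for \<tau> :: "nat \<Rightarrow> real"
  proof -
    have PS: "P (\<tau> n) \<in> SO3" for n using solD(1)[OF S] \<tau>(2) by simp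
    then obtain l r where l: "l \<in> SO3" and r: "strict_mono r" and lim: "(\<lambda>n. P (\<tau> (r n))) \<longlonglongrightarrow> l"
      using seq_compactE[OF compact_SO3[THEN compact_imp_seq_compact], of "\<lambda>n. P (\<tau> n)"]
      unfolding o_def by blast
    have \<tau>r: "filterlim (\<lambda>n. \<tau> (r n)) at_top sequentially"
      by (rule filterlim_compose[OF \<tau>(1) filterlim_subseq[OF r]])
    have "(\<lambda>n. force (P (\<tau> (r n)))) \<longlonglongrightarrow> force l"
      by (rule continuous_on_tendsto_compose[OF continuous_on_force lim l]) (simp add: PS)
    moreover have "(\<lambda>n. force (P (\<tau> (r n)))) \<longlonglongrightarrow> 0"
      by (rule filterlim_compose[OF force_tendsto_0[OF S a] \<tau>r])
    ultimately have "force l = 0" by (rule LIMSEQ_unique)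
    then have t0: "torque d l = 0" using force_eq_0_iff[OF l] by simp
    have z: "(\<lambda>n. z (\<tau> (r n))) \<longlonglongrightarrow> 0"
      by (rule filterlim_compose[OF z_tendsto_0[OF S a] \<tau>r])
    have g: "(\<lambda>n. (P (\<tau> (r n)), z (\<tau> (r n)))) \<longlonglongrightarrow> (l, 0)"
      by (intro tendsto_Pair lim z)
    have "(\<lambda>n. energy (P (\<tau> (r n))) (z (\<tau> (r n)))) \<longlonglongrightarrow> energy l 0"
      using continuous_on_tendsto_compose[OF continuous_on_energy g] by (simp add: PS l)
    moreover have "(\<lambda>n. energy (P (\<tau> (r n))) (z (\<tau> (r n)))) \<longlonglongrightarrow> h"
      by (rule filterlim_compose[OF h(1) \<tau>r])
    ultimately have "energy l 0 = h" by (rule LIMSEQ_unique)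
    then have "\<Phi> (pot d l) = h" by (simp add: energy_def)
    with l r lim t0 show ?thesis by blast
  qed
  have lim0: "filterlim (\<lambda>n. a + real n) at_top sequentially"
    by (intro filterlim_tendsto_add_at_top[OF tendsto_const] filterlim_real_sequentially)
  then obtain Pe where Pe: "Pe \<in> SO3" "torque d Pe = 0" "\<Phi> (pot d Pe) = h"
    using cluster[OF lim0] by auto
  have "(P \<longlongrightarrow> Pe) at_top"
  proof (rule ccontr)
    assume "\<not> (P \<longlongrightarrow> Pe) at_top"
    then obtain e where "e > 0" and e: "\<not> (\<forall>\<^sub>F t in at_top. dist (P t) Pe < e)"
      by (auto simp: tendsto_iff)
    then have "\<forall>n. \<exists>t\<ge>a + real n. \<not> dist (P t) Pe < e"
      by (auto simp: eventually_at_top_linorder)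
    then obtain \<tau> where \<tau>: "\<And>n. \<tau> n \<ge> a + real n" "\<And>n. \<not> dist (P (\<tau> n)) Pe < e" by metis
    have "filterlim \<tau> at_top sequentially"
      by (rule filterlim_at_top_mono[OF lim0]) (simp add: \<tau>)
    moreover have "\<tau> n \<ge> a" for n using \<tau>(1)[of n] by simp
    ultimately obtain l r where l: "l \<in> SO3" "(\<lambda>n. P (\<tau> (r n))) \<longlonglongrightarrow> l" "torque d l = 0" "\<Phi> (pot d l) = h"
      using cluster by blast
    have "pot d l = pot d Pe" by (rule \<Phi>_inj) (use l Pe pot_nonneg in auto)
    then have "l = Pe" using critical_point_eqI[OF l(1,3) Pe(1,2) _ d_pos d_inj] by blast
    then have "\<forall>\<^sub>F n in sequentially. dist (P (\<tau> (r n))) Pe < e"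
      using tendstoD[OF l(2) \<open>e > 0\<close>] by simp
    then show False using \<tau>(2) by (auto simp: eventually_sequentially)
  qed
  then show ?thesis using that[of Pe] Pe h(2) by simp
qed

section \<open>Stability of the identity\<close>

definition d_min :: real where "d_min = min (d$1) (min (d$2) (d$3))"

lemma d_min: "d_min > 0" "d_min \<le> d$i"
  using d_pos exhaust_3[of i] by (auto simp: d_min_def)

text \<open>Energy is nonincreasing and every half-turn has energy at least
  \<open>\<Phi> (4 * d_min)\<close>, so the identity is the only equilibrium left as a
  limit.\<close>

lemma low_energy_converges:
  assumes S: "sol {a..} P z" and a: "t0 \<le> a" and low: "energy (P a) (z a) < \<Phi> (4 * d_min)"
  shows "(P \<longlongrightarrow> mat 1) at_top"
proof -
  obtain Pe where Pe: "Pe \<in> SO3" "torque d Pe = 0" "(P \<longlongrightarrow> Pe) at_top"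
    "\<Phi> (pot d Pe) \<le> energy (P a) (z a)"
    using sol_converges[OF S a] by blast
  have "pot d Pe < 4 * d_min"
    by (rule \<Phi>_less_imp) (use Pe low d_min(1) pot_nonneg in auto)
  then have "Pe = mat 1"
    using critical_pot_ge[OF Pe(1,2) _ d_min(2,1) d_inj] by force
  with Pe show ?thesis by simp
qed

text \<open>\<open>\<delta>\<close> is found before the initial time \<open>a\<close>: the energy
  does not involve time explicitly, so stability is uniform.\<close>

lemma stable:
  assumes "e > 0"
  obtains \<delta> where "\<delta> > 0" "\<And>a P z t. sol {a..} P z \<Longrightarrow> t0 \<le> a \<Longrightarrow> dist (P a, z a) (mat 1, 0) < \<delta> \<Longrightarrow> a \<le> t \<Longrightarrow>
     dist (P t, z t) (mat 1, 0) < e"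
proof -
  \<comment> \<open>The first bound forces \<open>(norm z)^2 < e^2 / 4\<close> through the kinetic
    part, the second \<open>(norm (P - mat 1))^2 < e^2 / 4\<close> through
    \<open>norm_le_pot\<close> and the monotonicity of \<open>\<Phi>\<close>.\<close>
  define \<eta> where "\<eta> = min (m * e\<^sup>2 / 8) (\<Phi> (d_min * e\<^sup>2 / 8))"
  have "\<Phi> (d_min * e\<^sup>2 / 8) > 0"
    using \<Phi>_strict_mono[of 0 "d_min * e\<^sup>2 / 8"] \<Phi>_zero d_min(1) assms by simp
  then have "\<eta> > 0" using m_pos assms by (simp add: \<eta>_def)
  have "(mat 1, 0) \<in> SO3 \<times> (UNIV :: (real^3) set)" by (simp add: mat_1_SO3)
  then obtain \<delta> where "\<delta> > 0" and \<delta>: "\<And>x. x \<in> SO3 \<times> UNIV \<Longrightarrow> dist x (mat 1, 0) < \<delta> \<Longrightarrow>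
      dist (energy (fst x) (snd x)) (energy (fst (mat 1 :: real^3^3, 0 :: real^3)) (snd (mat 1 :: real^3^3, 0))) < \<eta>"
    using continuous_on_energy[unfolded continuous_on_iff] \<open>\<eta> > 0\<close> by metis
  show ?thesis
  proof (rule that[OF \<open>\<delta> > 0\<close>])
    fix a P z t
    assume S: "sol {a..} P z" and a: "t0 \<le> a" and x0: "dist (P a, z a) (mat 1, 0) < \<delta>" and "a \<le> t"
    have "energy (P a) (z a) < \<eta>"
      using \<delta>[OF _ x0] solD(1)[OF S, of a] by (simp add: dist_real_def)
    moreover have "energy (P t) (z t) \<le> energy (P a) (z a)"
      by (rule energy_nonincreasing[OF S]) (use \<open>a \<le> t\<close> a in auto)
    ultimately have E: "energy (P t) (z t) < \<eta>" by linarith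
    have PS: "P t \<in> SO3" using solD(1)[OF S] \<open>a \<le> t\<close> by simp
    have "energy (P t) (z t) < m * e\<^sup>2 / 8" using E by (simp add: \<eta>_def)
    then have "2 * energy (P t) (z t) / m < e\<^sup>2 / 4" using m_pos by (simp add: field_simps)
    then have 1: "(norm (z t))\<^sup>2 < e\<^sup>2 / 4" using norm_le_energy[OF PS, of "z t"] by linarith
    have "\<Phi> (pot d (P t)) < \<Phi> (d_min * e\<^sup>2 / 8)"
      using E \<Phi>_le_energy[of "P t" "z t"] PS by (simp add: \<eta>_def)
    then have "pot d (P t) < d_min * e\<^sup>2 / 8"
      by (rule \<Phi>_less_imp[rotated 2]) (use pot_nonneg[OF PS] d_min(1) in auto)
    then have "d_min * (norm (P t - mat 1))\<^sup>2 < d_min * (e\<^sup>2 / 4)"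
      using norm_le_pot[OF PS d_min(2)] by simp
    then have "(norm (P t - mat 1))\<^sup>2 < e\<^sup>2 / 4" using d_min(1) by simp
    moreover have "e\<^sup>2 > 0" using assms by simp
    ultimately have "(norm (P t - mat 1))\<^sup>2 + (norm (z t))\<^sup>2 < e\<^sup>2" using 1 by linarith
    then have "sqrt ((norm (P t - mat 1))\<^sup>2 + (norm (z t))\<^sup>2) < e"
      using assms real_sqrt_less_iff[of _ "e\<^sup>2"] by simp
    then show "dist (P t, z t) (mat 1, 0) < e"
      unfolding dist_Pair_Pair by (simp add: dist_norm)
  qed
qed

section \<open>Uniqueness and dependence on data\<close>

lemma sol_unique:
  assumes "sol {a..b} P1 z1" "sol {a..b} P2 z2" "t0 \<le> a" "P1 a = P2 a" "z1 a = z2 a" "t \<in> {a..b}"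
  shows "P1 t = P2 t" "z1 t = z2 t"
proof -
  have bound: "\<exists>\<rho>. \<forall>t\<in>{a..b}. norm (z t) \<le> \<rho>" if "sol {a..b} P z" for P z
  proof -
    have "continuous_on {a..b} z"
      using solD(3)[OF that] by (rule continuous_on_vector_derivative)
    then have "compact (z ` {a..b})" by (intro compact_continuous_image) auto
    then show ?thesis by (meson bounded_iff compact_imp_bounded imageI)
  qed
  obtain \<rho>1 \<rho>2 where \<rho>: "\<And>t. t \<in> {a..b} \<Longrightarrow> norm (z1 t) \<le> \<rho>1" "\<And>t. t \<in> {a..b} \<Longrightarrow> norm (z2 t) \<le> \<rho>2"
    using bound[OF assms(1)] bound[OF assms(2)] by metis
  obtain K where K: "growth_rate (max \<rho>1 \<rho>2) K"
    by (rule growth_rate_exists)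
  have "(norm (P1 t - P2 t))\<^sup>2 + (norm (z1 t - z2 t))\<^sup>2
        \<le> ((norm (P1 a - P2 a))\<^sup>2 + (norm (z1 a - z2 a))\<^sup>2) * exp (K * (b - a))"
    by (rule K[unfolded growth_rate_def, rule_format, OF assms(1,2,3)]) (use assms(6) \<rho> in \<open>auto simp: le_max_iff_disj\<close>)
  then have "(norm (P1 t - P2 t))\<^sup>2 + (norm (z1 t - z2 t))\<^sup>2 \<le> 0" using assms(4,5) by simp
  then show "P1 t = P2 t" "z1 t = z2 t" by (simp_all add: sum_power2_le_zero_iff)
qed

lemma continuous_dependence:
  assumes S: "sol {t0..} P z" and "t0 \<le> T" "e > 0"
  obtains \<delta> where "\<delta> > 0" "\<And>Q w. sol {t0..} Q w \<Longrightarrow> dist (Q t0, w t0) (P t0, z t0) < \<delta> \<Longrightarrow>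
    dist (Q T, w T) (P T, z T) < e"
proof -
  \<comment> \<open>The margin 1 makes one energy bound, hence one speed bound for all times, valid
    for every solution starting near the given one.\<close>
  define E where "E = energy (P t0) (z t0) + 1"
  define \<rho> where "\<rho> = sqrt (2 * E / m)"
  have PS: "(P t0, z t0) \<in> SO3 \<times> UNIV" using solD(1)[OF S] by simp
  then obtain \<delta>1 where "\<delta>1 > 0" and \<delta>1: "\<And>x. x \<in> SO3 \<times> UNIV \<Longrightarrow> dist x (P t0, z t0) < \<delta>1 \<Longrightarrow>
      dist (energy (fst x) (snd x)) (energy (fst (P t0, z t0)) (snd (P t0, z t0))) < 1"
    using continuous_on_energy[unfolded continuous_on_iff] by (metis zero_less_one)
  have bound: "norm (w t) \<le> \<rho>" if "sol {t0..} Q w" "energy (Q t0) (w t0) \<le> E" "t0 \<le> t" for Q w t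
  proof -
    have "sqrt (2 * energy (Q t0) (w t0) / m) \<le> \<rho>"
      unfolding \<rho>_def using that(2) m_pos by (intro real_sqrt_le_mono divide_right_mono) auto
    then show ?thesis using sol_norm_le[OF that(1) order_refl that(3)] by linarith
  qed
  obtain K where K: "growth_rate \<rho> K"
    by (rule growth_rate_exists)
  \<comment> \<open>Distances enter \<open>growth_rate\<close> squared, hence half of the
    exponent.\<close>
  define \<delta> where "\<delta> = min \<delta>1 (e * exp (- (K * (T - t0) / 2)))"
  have "\<delta> > 0" using \<open>\<delta>1 > 0\<close> assms by (simp add: \<delta>_def)
  show ?thesis
  proof (rule that[OF \<open>\<delta> > 0\<close>])
    fix Q w assume S2: "sol {t0..} Q w" and near: "dist (Q t0, w t0) (P t0, z t0) < \<delta>"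
    have "dist (Q t0, w t0) (P t0, z t0) < \<delta>1" using near by (simp add: \<delta>_def)
    then have "\<bar>energy (Q t0) (w t0) - energy (P t0) (z t0)\<bar> < 1"
      using \<delta>1[of "(Q t0, w t0)"] solD(1)[OF S2] by (simp add: dist_real_def)
    then have E2: "energy (Q t0) (w t0) \<le> E" by (simp add: E_def)
    have "(norm (Q T - P T))\<^sup>2 + (norm (w T - z T))\<^sup>2
        \<le> ((norm (Q t0 - P t0))\<^sup>2 + (norm (w t0 - z t0))\<^sup>2) * exp (K * (T - t0))"
      by (rule K[unfolded growth_rate_def, rule_format]) (use bound[OF S2 E2] bound[OF S] assms(2) in
        \<open>auto simp: E_def intro: sol_subset[OF S] sol_subset[OF S2]\<close>)
    also have "\<dots> < \<delta>\<^sup>2 * exp (K * (T - t0))"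
      using near \<open>\<delta> > 0\<close> unfolding dist_pair_power2[symmetric]
      by (intro mult_strict_right_mono power_strict_mono) auto
    also have "\<dots> \<le> (e * exp (- (K * (T - t0) / 2)))\<^sup>2 * exp (K * (T - t0))"
      using \<open>\<delta> > 0\<close> by (intro mult_right_mono power_mono) (auto simp: \<delta>_def)
    also have "\<dots> = e\<^sup>2"
      by (simp add: power_mult_distrib exp_double[symmetric] exp_add[symmetric] power2_eq_square mult_exp_exp)
    finally show "dist (Q T, w T) (P T, z T) < e"
      using assms(3) by (rule dist_pair_less)
  qed
qed

text \<open>Only the attitude at time \<open>T\<close> is perturbed while the velocity is kept, as
  \<open>repelling\<close> demands. The backward solution lives on \<open>[t0, T]\<close>; solving
  forward again from its value at \<open>t0\<close> gives one on the half-line, and uniqueness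
  identifies both on \<open>[t0, T]\<close>.\<close>

lemma backward_dependence:
  assumes S: "sol {t0..} P z" and "t0 \<le> T" "e > 0"
  obtains \<delta> where "\<delta> > 0" "\<And>Q0. Q0 \<in> SO3 \<Longrightarrow> norm (Q0 - P T) < \<delta> \<Longrightarrow>
    \<exists>Q w. sol {t0..} Q w \<and> Q T = Q0 \<and> w T = z T \<and> dist (Q t0, w t0) (P t0, z t0) < e"
proof -
  obtain C where C: "C > 0" "\<And>P. norm P \<le> 2 \<Longrightarrow> norm (force P) \<le> C" using force_bound by blast
  \<comment> \<open>Both solutions share the velocity at \<open>T\<close>, which bounds them
    backwards in time; the energy is controlled only forwards.\<close>
  define \<rho> where "\<rho> = sqrt (((norm (z T))\<^sup>2 + 1) * exp ((C + 2 * alpha) / m * (T - t0)))"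
  have bound: "norm (w t) \<le> \<rho>" if S': "sol {t0..T} Q w" and "w T = z T" and t: "t \<in> {t0..T}" for Q w t
  proof -
    have "(norm (w t))\<^sup>2 + 1 \<le> ((norm (w T))\<^sup>2 + 1) * exp ((C + 2 * alpha) / m * (T - t0))"
    proof (rule norm_z_growth[of t0 T w 1 "\<lambda>t. force (Q t)" A C])
      show "(w has_vector_derivative 1 *\<^sub>R ((1/m) *\<^sub>R (force (Q t) - A t *v w t))) (at t within {t0..T})"
        if "t \<in> {t0..T}" for t using solD(3)[OF S' that] by simp
      show "norm (force (Q t)) \<le> C" if "t \<in> {t0..T}" for t
        using C(2) norm_SO3_le solD(1)[OF S' that] by blast
    qed (use C(1) A_bound t in auto)
    then show ?thesis unfolding \<rho>_def \<open>w T = z T\<close> by (intro real_le_rsqrt) simp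
  qed
  obtain K where K: "growth_rate \<rho> K"
    by (rule growth_rate_exists)
  define \<delta> where "\<delta> = e * exp (- (K * (T - t0) / 2))"
  have "\<delta> > 0" using assms by (simp add: \<delta>_def)
  show ?thesis
  proof (rule that[OF \<open>\<delta> > 0\<close>])
    fix Q0 assume "Q0 \<in> SO3" and near: "norm (Q0 - P T) < \<delta>"
    obtain Q w where S1: "sol {t0..T} Q w" and QT: "Q T = Q0" "w T = z T"
      using backward_exists[OF \<open>t0 \<le> T\<close> \<open>Q0 \<in> SO3\<close>] by blast
    have SP: "sol {t0..T} P z" by (rule sol_subset[OF S]) auto
    have "Q t0 \<in> SO3" using solD(1)[OF S1] assms(2) by simp
    then obtain Q' w' where S2: "sol {t0..} Q' w'" and init: "Q' t0 = Q t0" "w' t0 = w t0"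
      using forward_exists[OF order_refl, of "Q t0" "w t0"] by blast
    have "sol {t0..T} Q' w'" by (rule sol_subset[OF S2]) auto
    then have T: "Q' T = Q0" "w' T = z T"
      using sol_unique[OF _ S1, of Q' w' T] init assms(2) QT by auto
    have "(norm (Q t0 - P t0))\<^sup>2 + (norm (w t0 - z t0))\<^sup>2
        \<le> ((norm (Q T - P T))\<^sup>2 + (norm (w T - z T))\<^sup>2) * exp (K * (T - t0))"
      by (rule K[unfolded growth_rate_def, rule_format, OF S1 SP]) (use bound[OF S1] bound[OF SP] QT assms(2) in auto)
    also have "\<dots> = (norm (Q0 - P T))\<^sup>2 * exp (K * (T - t0))" by (simp add: QT)
    also have "\<dots> < \<delta>\<^sup>2 * exp (K * (T - t0))"
      using near by (intro mult_strict_right_mono power_strict_mono) auto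
    also have "\<dots> = e\<^sup>2"
      by (simp add: \<delta>_def power_mult_distrib exp_double[symmetric] exp_add[symmetric] power2_eq_square mult_exp_exp)
    finally have "dist (Q t0, w t0) (P t0, z t0) < e" using assms(3) by (rule dist_pair_less)
    with S2 T init show "\<exists>Q w. sol {t0..} Q w \<and> Q T = Q0 \<and> w T = z T \<and> dist (Q t0, w t0) (P t0, z t0) < e"
      by metis
  qed
qed

end

section \<open>Saddle points\<close>

lemma abs_inner_le: "norm x \<le> a \<Longrightarrow> norm y \<le> b \<Longrightarrow> \<bar>x \<bullet> y\<bar> \<le> a * b"
  by (meson Cauchy_Schwarz_ineq2 mult_mono norm_ge_zero order_trans)

lemma inner_dmat_mult: "X \<bullet> (dmat n ** Y) = (\<Sum>i\<in>UNIV. n$i * (\<Sum>j\<in>UNIV. X$i$j * Y$i$j))"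
  by (simp add: inner_vec_def dmat_mult_nth sum_distrib_left mult_ac)

lemma inner_dmat_mult_commute: "X \<bullet> (dmat n ** Y) = Y \<bullet> (dmat n ** X)"
  by (simp add: inner_dmat_mult mult.commute)

lemma quadratic_form_derivative:
  fixes Z :: "real \<Rightarrow> real^3^3"
  assumes "(Z has_vector_derivative Z') (at t within T)"
  shows "((\<lambda>t. Z t \<bullet> (dmat n ** Z t)) has_vector_derivative 2 * (Z t \<bullet> (dmat n ** Z'))) (at t within T)"
proof -
  have "((\<lambda>t. dmat n ** Z t) has_vector_derivative dmat n ** Z') (at t within T)"
    using bounded_linear.has_vector_derivative[OF
        bounded_bilinear.bounded_linear_right[OF bounded_bilinear_matrix_matrix_mult] assms] .
  from bounded_bilinear.has_vector_derivative[OF bounded_bilinear_inner assms this]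
  show ?thesis by (simp add: inner_dmat_mult_commute[of Z' n])
qed

text \<open>The first-order part of the derivative of the quadratic form is \<open>- (w \<bullet> torque d Z)\<close> up to the
  defect \<open>Z ** dmat e + dmat e ** transpose Z\<close>, which vanishes for \<open>Z\<close> tangent at \<open>dmat e\<close>.\<close>

lemma saddle_identity:
  fixes Z :: "real^3^3"
  assumes "\<And>i. e$i * e$i = 1"
  shows "Z \<bullet> (dmat (\<chi> i. e$i * d$i) ** (skew w ** dmat e)) =
    - (w \<bullet> torque d Z) + (dmat (\<chi> i. e$i * d$i) ** skew w) \<bullet> (Z ** dmat e + dmat e ** transpose Z)"
proof -
  have e: "e$i * (e$i * x) = x" for i x using assms[of i] by (simp add: mult.assoc[symmetric])
  show ?thesis
    by (simp add: inner_vec_def sum_3 dmat_mult_nth mult_dmat_nth skew_eq torque_def transpose_def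
        algebra_simps e)
qed

text \<open>Since \<open>P1 P1^T = P2 P2^T\<close>, one has
  \<open>(P1 - P2) P1^T + P2 (P1 - P2)^T = 0\<close>. Replacing \<open>P1\<close> and
  \<open>P2\<close> by \<open>Q\<close> costs the right-hand side: near \<open>Q\<close>, a chord of
  the rotation group is tangent at \<open>Q\<close> up to a small multiple of its length.\<close>

lemma tangent_defect:
  assumes "P1 \<in> SO3" "P2 \<in> SO3"
  shows "(P1 - P2) ** transpose Q + Q ** transpose (P1 - P2)
    = - ((P1 - P2) ** transpose (P1 - Q) + (P2 - Q) ** transpose (P1 - P2))"
proof -
  have t: "transpose (X - Y) = transpose X - transpose Y" for X Y :: "real^3^3"
    by (simp add: transpose_def vec_eq_iff)
  show ?thesis
    using SO3_mult_transpose[OF assms(1)] SO3_mult_transpose[OF assms(2)]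
    by (simp add: t matrix_mult_diff)
qed

text \<open>Rotation about the axis \<open>k\<close> with cosine \<open>1 - \<eta>\<close>; by
  \<open>rotated_difference_row\<close> its diagonal is all that matters.\<close>

lemma plane_rotation:
  fixes k :: 3 and \<eta> :: real
  assumes "0 \<le> \<eta>" "\<eta> \<le> 1"
  obtains Q where "Q \<in> SO3" "\<And>i. Q$i$i = (if i = k then 1 else 1 - \<eta>)"
proof -
  define s where "s = sqrt (1 - (1 - \<eta>)\<^sup>2)"
  have "(1 - \<eta>)\<^sup>2 \<le> 1" using assms by (simp add: power_le_one)
  then have s: "s * s = 1 - (1 - \<eta>) * (1 - \<eta>)" by (simp add: s_def power2_eq_square)
  define Q where "Q = (if k = 1 then vector [vector [1, 0, 0], vector [0, 1 - \<eta>, - s], vector [0, s, 1 - \<eta>]]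
    else if k = 2 then vector [vector [1 - \<eta>, 0, s], vector [0, 1, 0], vector [- s, 0, 1 - \<eta>]]
    else (vector [vector [1 - \<eta>, - s, 0], vector [s, 1 - \<eta>, 0], vector [0, 0, 1]] :: real^3^3))"
  have "Q \<in> SO3" "\<forall>i. Q$i$i = (if i = k then 1 else 1 - \<eta>)"
    using exhaust_3[of k] s
    by (auto simp: SO3_iff Q_def vec_eq_iff forall_3 matrix_matrix_mult_def sum_3 transpose_def mat_def det_3
        algebra_simps)
  then show ?thesis using that by blast
qed

text \<open>\<open>Q P - P = (Q - 1) P\<close>, and right multiplication by a rotation preserves row
  lengths, so these are the row lengths of \<open>Q - 1\<close>. The quadratic form at a saddle is
  thus computed exactly for a finite rotation.\<close>

lemma rotated_difference_row:
  assumes "P \<in> SO3" "Q \<in> SO3"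
  shows "(\<Sum>j\<in>UNIV. ((Q ** P - P)$i$j)\<^sup>2) = 2 * (1 - Q$i$i)"
proof -
  have t: "transpose (X - Y) = transpose X - transpose Y" for X Y :: "real^3^3"
    by (simp add: transpose_def vec_eq_iff)
  have PP: "P ** (transpose P ** X) = X" "X ** P ** transpose P = X" for X
    using SO3_mult_transpose[OF assms(1)] by (simp_all add: matrix_mul_assoc[symmetric])
      (simp add: matrix_mul_assoc)
  have "(Q ** P - P) ** transpose (Q ** P - P) = mat 1 - Q - transpose Q + mat 1"
    using SO3_mult_transpose[OF assms(1)] SO3_mult_transpose[OF assms(2)]
    by (simp add: t matrix_mult_diff matrix_transpose_mul PP matrix_mul_assoc)
  then have "((Q ** P - P) ** transpose (Q ** P - P))$i$i = 2 * (1 - Q$i$i)"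
    by (simp add: mat_def transpose_def)
  then show ?thesis by (simp add: matrix_matrix_mult_def transpose_def power2_eq_square)
qed

text \<open>\<open>W\<close> and \<open>Y\<close> stand for the norms of the velocity and attitude
  differences. The weight \<open>\<epsilon>\<close> of the cross term is chosen first, small against
  the damping; it produces the negative \<open>Y\<close> term of size
  \<open>\<epsilon> * \<beta>\<close>, and only then is the radius chosen small against what is
  left.\<close>

lemma young_constants:
  fixes lam \<beta> C :: real
  assumes "lam > 0" "\<beta> > 0" "C > 0"
  obtains \<epsilon> r1 c where "0 < \<epsilon>" "\<epsilon> \<le> 1" "0 < r1" "r1 \<le> 1" "0 < c"
    "\<And>r W Y. 0 \<le> r \<Longrightarrow> r \<le> r1 \<Longrightarrow> 0 \<le> W \<Longrightarrow> 0 \<le> Y \<Longrightarrow>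
      - lam * W\<^sup>2 - \<epsilon> * \<beta> * Y\<^sup>2 + C * (r * (W * Y) + r * Y\<^sup>2 + \<epsilon> * (W * Y) + \<epsilon> * W\<^sup>2) \<le> - c * (W\<^sup>2 + Y\<^sup>2)"
proof -
  \<comment> \<open>The cost in \<open>W\<^sup>2\<close> once half of
    \<open>\<beta> * Y\<^sup>2\<close> has absorbed \<open>C * W * Y\<close> by completing the
    square.\<close>
  define B where "B = C + C\<^sup>2 / (2 * \<beta>)"
  have "B > 0" using assms by (simp add: B_def add_pos_pos)
  define \<epsilon> where "\<epsilon> = min 1 (lam / (2 * B))"
  have \<epsilon>: "0 < \<epsilon>" "\<epsilon> \<le> 1" "\<epsilon> * B \<le> lam / 2"
    using assms \<open>B > 0\<close> by (auto simp: \<epsilon>_def min_def field_simps)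
  \<comment> \<open>Half of each negative coefficient is spent on the \<open>\<epsilon>\<close>
    terms; the \<open>r\<close> terms may take half of the remainder \<open>c0\<close>.\<close>
  define c0 where "c0 = min (lam / 2) (\<epsilon> * \<beta> / 2)"
  have c0: "0 < c0" "c0 \<le> lam / 2" "c0 \<le> \<epsilon> * \<beta> / 2" using assms \<epsilon> by (auto simp: c0_def)
  define r1 where "r1 = min 1 (c0 / (4 * C))"
  have r1: "0 < r1" "r1 \<le> 1" "2 * (C * r1) \<le> c0 / 2" using assms c0 by (auto simp: r1_def min_def field_simps)
  show ?thesis
  proof (rule that[of \<epsilon> r1 "c0 / 2"])
    fix r W Y :: real assume r: "0 \<le> r" "r \<le> r1" and "0 \<le> W" "0 \<le> Y"
    have sq: "0 \<le> W\<^sup>2" "0 \<le> Y\<^sup>2" by auto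
    have "0 \<le> (\<beta> * Y - C * W)\<^sup>2 / (2 * \<beta>)" using assms by simp
    also have "\<dots> = \<beta> / 2 * Y\<^sup>2 - C * (W * Y) + C\<^sup>2 / (2 * \<beta>) * W\<^sup>2"
      using assms by (simp add: power2_eq_square field_simps)
    finally have "C * (W * Y) + C * W\<^sup>2 \<le> \<beta> / 2 * Y\<^sup>2 + B * W\<^sup>2" by (simp add: B_def distrib_right)
    then have "\<epsilon> * (C * (W * Y) + C * W\<^sup>2) \<le> \<epsilon> * (\<beta> / 2 * Y\<^sup>2 + B * W\<^sup>2)" using \<epsilon>(1) by simp
    also have "\<dots> = \<epsilon> * \<beta> / 2 * Y\<^sup>2 + (\<epsilon> * B) * W\<^sup>2" by (simp add: algebra_simps)
    also have "\<dots> \<le> \<epsilon> * \<beta> / 2 * Y\<^sup>2 + lam / 2 * W\<^sup>2"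
      using \<epsilon>(3) sq by (intro add_left_mono mult_right_mono)
    finally have 1: "\<epsilon> * (C * (W * Y) + C * W\<^sup>2) \<le> \<epsilon> * \<beta> / 2 * Y\<^sup>2 + lam / 2 * W\<^sup>2" .
    have "0 \<le> (W - Y)\<^sup>2" by simp
    then have "2 * (W * Y) \<le> W\<^sup>2 + Y\<^sup>2" by (simp add: power2_diff)
    then have "W * Y + Y\<^sup>2 \<le> 2 * (W\<^sup>2 + Y\<^sup>2)" using sq \<open>0 \<le> W\<close> \<open>0 \<le> Y\<close>
      unfolding distrib_left by linarith
    then have "C * r * (W * Y + Y\<^sup>2) \<le> C * r * (2 * (W\<^sup>2 + Y\<^sup>2))"
      using assms r by (intro mult_left_mono) auto
    also have "\<dots> = 2 * (C * r) * (W\<^sup>2 + Y\<^sup>2)" by simp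
    also have "\<dots> \<le> c0 / 2 * (W\<^sup>2 + Y\<^sup>2)"
    proof (rule mult_right_mono)
      have "C * r \<le> C * r1" using r assms by simp
      then show "2 * (C * r) \<le> c0 / 2" using r1(3) by simp
    qed (use sq in auto)
    finally have 2: "C * r * (W * Y + Y\<^sup>2) \<le> c0 / 2 * (W\<^sup>2 + Y\<^sup>2)" .
    have 3: "c0 * W\<^sup>2 \<le> lam / 2 * W\<^sup>2" "c0 * Y\<^sup>2 \<le> \<epsilon> * \<beta> / 2 * Y\<^sup>2"
      by (rule mult_right_mono[OF c0(2) sq(1)], rule mult_right_mono[OF c0(3) sq(2)])
    have "- lam * W\<^sup>2 - \<epsilon> * \<beta> * Y\<^sup>2 + C * (r * (W * Y) + r * Y\<^sup>2 + \<epsilon> * (W * Y) + \<epsilon> * W\<^sup>2)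
        = - 2 * (lam / 2 * W\<^sup>2) - 2 * (\<epsilon> * \<beta> / 2 * Y\<^sup>2) + C * r * (W * Y + Y\<^sup>2) + \<epsilon> * (C * (W * Y) + C * W\<^sup>2)"
      by (simp add: algebra_simps)
    also have "\<dots> \<le> - (lam / 2 * W\<^sup>2) - (\<epsilon> * \<beta> / 2 * Y\<^sup>2) + c0 / 2 * (W\<^sup>2 + Y\<^sup>2)"
      using 1 2 by linarith
    also have "\<dots> \<le> - (c0 * W\<^sup>2) - (c0 * Y\<^sup>2) + c0 / 2 * (W\<^sup>2 + Y\<^sup>2)"
      using 3 by linarith
    also have "\<dots> = - (c0 / 2) * (W\<^sup>2 + Y\<^sup>2)" by (simp add: algebra_simps)
    finally show "- lam * W\<^sup>2 - \<epsilon> * \<beta> * Y\<^sup>2 + C * (r * (W * Y) + r * Y\<^sup>2 + \<epsilon> * (W * Y) + \<epsilon> * W\<^sup>2)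
        \<le> - (c0 / 2) * (W\<^sup>2 + Y\<^sup>2)" .
  qed (use \<epsilon> r1 c0 in auto)
qed

context observer
begin

text \<open>Nondegeneracy of the Hessian of the potential at \<open>dmat e\<close>: the second term
  measures the defect from tangency, and on tangent directions the torque is injective. An injective
  linear map in finite dimension is bounded below.\<close>

lemma torque_nondegenerate:
  assumes e: "\<And>i. e$i = 1 \<or> e$i = -1"
  obtains B where "B > 0" "\<And>Z. B * norm Z \<le> norm (torque d Z) + norm (Z ** dmat e + dmat e ** transpose Z)"
proof -
  let ?f = "\<lambda>Z. (torque d Z, Z ** dmat e + dmat e ** transpose Z)"
  have lin: "linear ?f"
    by (rule linearI)
      (simp_all add: linear_add[OF bounded_linear.linear[OF bounded_linear_torque]]
        linear_cmul[OF bounded_linear.linear[OF bounded_linear_torque]]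
        vec_eq_iff dmat_mult_nth mult_dmat_nth transpose_def algebra_simps)
  have "Z = 0" if "?f Z = 0" for Z
  proof -
    have Z0: "torque d Z = 0" "Z ** dmat e + dmat e ** transpose Z = 0"
      using that by (simp_all only: zero_prod_def prod.inject)
    have T: "Z$i$j * e$j + e$i * Z$j$i = 0" for i j
    proof -
      have "(Z ** dmat e + dmat e ** transpose Z)$i$j = 0" unfolding Z0(2) by simp
      then show ?thesis by (simp add: dmat_mult_nth mult_dmat_nth transpose_def)
    qed
    have tq: "d$3 * Z$2$3 = d$2 * Z$3$2" "d$1 * Z$3$1 = d$3 * Z$1$3" "d$2 * Z$1$2 = d$1 * Z$2$1"
      using Z0(1) by (simp_all add: torque_def vec_eq_iff forall_3)
    \<comment> \<open>Tangency makes two mirrored entries equal up to sign, so a vanishing torque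
      means that \<open>d$i - d$j\<close> or \<open>d$i + d$j\<close> annihilates them; both factors
      are nonzero.\<close>
    have off: "x = 0 \<and> y = 0" if "d$i * x = d$j * y" "x * e$i + e$j * y = 0" "i \<noteq> j" for i j x y
    proof -
      have "y = x \<or> y = - x" using e[of i] e[of j] that(2) by auto
      moreover have "d$i \<noteq> d$j" using that(3) d_inj by blast
      moreover have "d$i + d$j \<noteq> 0" using d_pos[of i] d_pos[of j] by simp
      then have "x = 0" if "d$i * x = - (d$j * x)"
        using that by (metis add_eq_0_iff distrib_right mult_eq_0_iff minus_minus)
      ultimately show ?thesis using that(1) by fastforce
    qed
    have "Z$i$i = 0" for i using T[of i i] e[of i] by auto
    moreover have "Z$2$3 = 0 \<and> Z$3$2 = 0" using off[of 3 _ 2] tq(1) T[of 2 3] by auto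
    moreover have "Z$3$1 = 0 \<and> Z$1$3 = 0" using off[of 1 _ 3] tq(2) T[of 3 1] by auto
    moreover have "Z$1$2 = 0 \<and> Z$2$1 = 0" using off[of 2 _ 1] tq(3) T[of 1 2] by auto
    ultimately show ?thesis by (simp add: vec_eq_iff forall_3)
  qed
  then have "inj ?f" using linear_injective_0[OF lin] by blast
  then obtain B where "B > 0" "\<And>Z. B * norm Z \<le> norm (?f Z)"
    using linear_inj_bounded_below_pos[OF lin] by blast
  then show ?thesis using that norm_Pair_le order_trans by blast
qed

lemma \<Phi>'_pot_lipschitz:
  obtains L where "L \<ge> 0" "\<And>P Q. P \<in> SO3 \<Longrightarrow> Q \<in> SO3 \<Longrightarrow> \<bar>\<Phi>' (pot d P) - \<Phi>' (pot d Q)\<bar> \<le> L * norm (P - Q)"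
proof -
  obtain Kv where Kv: "Kv \<ge> 0" "\<And>P Q. \<bar>pot d P - pot d Q\<bar> \<le> Kv * norm (P - Q)"
    using pot_lipschitz by blast
  define b where "b = \<bar>pot d 0\<bar> + Kv * 2"
  have pb: "pot d P \<in> {0..b}" if "P \<in> SO3" for P
  proof -
    have "\<bar>pot d P - pot d 0\<bar> \<le> Kv * 2"
      using Kv(2)[of P 0] mult_left_mono[OF norm_SO3_le[OF that] Kv(1)] by simp
    then show ?thesis using pot_nonneg[OF that] by (auto simp: b_def)
  qed
  obtain L where L: "L \<ge> 0" "\<And>x y. x \<in> {0..b} \<Longrightarrow> y \<in> {0..b} \<Longrightarrow> \<bar>\<Phi>' x - \<Phi>' y\<bar> \<le> L * \<bar>x - y\<bar>"
    using \<Phi>'_lipschitz by blast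
  have "\<bar>\<Phi>' (pot d P) - \<Phi>' (pot d Q)\<bar> \<le> L * Kv * norm (P - Q)" if "P \<in> SO3" "Q \<in> SO3" for P Q
    using L(2)[OF pb[OF that(1)] pb[OF that(2)]] mult_left_mono[OF Kv(2)[of P Q] L(1)]
    by (simp add: mult.assoc)
  then show ?thesis using that[of "L * Kv"] L(1) Kv(1) by simp
qed

text \<open>The left-hand side is the time derivative of the functional in
  \<open>saddle_repels\<close>, with \<open>M\<close> for \<open>A t\<close>; the pointwise form
  makes the constants independent of time. The coupling terms
  \<open>\<phi> * (w \<bullet> \<tau>)\<close> of the force and of the quadratic form cancel by
  \<open>saddle_identity\<close>, damping gives \<open>- lam |w|^2\<close>, the cross term gives
  \<open>- \<epsilon> \<phi> |\<tau>|^2\<close>, and the rest is small near the saddle or for small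
  \<open>\<epsilon>\<close>.\<close>

lemma saddle_estimate:
  assumes e: "\<And>i. e$i = 1 \<or> e$i = -1" and Pe: "dmat e \<in> SO3" and ne: "dmat e \<noteq> mat 1"
  defines "N \<equiv> dmat (\<chi> i. e$i * d$i)" and "\<phi> \<equiv> \<Phi>' (pot d (dmat e))"
  shows "\<phi> > 0 \<and> (\<exists>\<epsilon> r c. 0 < \<epsilon> \<and> \<epsilon> \<le> 1 \<and> 0 < r \<and> 0 < c \<and> (\<forall>P1 P2 z1 z2 M.
      P1 \<in> SO3 \<longrightarrow> P2 \<in> SO3 \<longrightarrow> norm (P1 - dmat e) \<le> r \<longrightarrow> norm (P2 - dmat e) \<le> r \<longrightarrow>
      norm z1 \<le> r \<longrightarrow> norm z2 \<le> r \<longrightarrow> (\<forall>x. lam * (norm x)\<^sup>2 \<le> x \<bullet> (M *v x)) \<longrightarrow>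
      (\<forall>x. norm (M *v x) \<le> alpha * norm x) \<longrightarrow>
      (z1 - z2) \<bullet> ((force P1 - M *v z1) - (force P2 - M *v z2))
        + \<phi> * ((P1 - P2) \<bullet> (N ** (skew z1 ** P1 - skew z2 ** P2)))
        - \<epsilon> * (((force P1 - M *v z1) - (force P2 - M *v z2)) \<bullet> torque d (P1 - P2)
               + m * ((z1 - z2) \<bullet> torque d (skew z1 ** P1 - skew z2 ** P2)))
      \<le> - c * ((norm (z1 - z2))\<^sup>2 + (norm (P1 - P2))\<^sup>2)))"
proof -
  have tq0: "torque d (dmat e) = 0" by (simp add: torque_def dmat_nth vec_eq_iff forall_3)
  have "pot d (dmat e) > 0"
    using critical_pot_ge[OF Pe tq0 ne d_min(2,1) d_inj] d_min(1) by simp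
  then have \<phi>: "\<phi> > 0" unfolding \<phi>_def by (rule \<Phi>'_pos)
  obtain B where B: "B > 0" "\<And>Z. B * norm Z \<le> norm (torque d Z) + norm (Z ** dmat e + dmat e ** transpose Z)"
    using torque_nondegenerate[OF e] by blast
  obtain L where L: "L \<ge> 0" "\<And>P Q. P \<in> SO3 \<Longrightarrow> Q \<in> SO3 \<Longrightarrow> \<bar>\<Phi>' (pot d P) - \<Phi>' (pot d Q)\<bar> \<le> L * norm (P - Q)"
    using \<Phi>'_pot_lipschitz by blast
  interpret S: bounded_bilinear "\<lambda>z (P :: real^3^3). skew z ** P"
    by (rule bounded_bilinear_skew_mult)
  obtain k where k: "k > 0" "\<And>z (P :: real^3^3). norm (skew z ** P) \<le> norm z * norm P * k"
    using S.pos_bounded by blast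
  obtain kM where kM: "kM > 0" "\<And>(X :: real^3^3) (Y :: real^3^3). norm (X ** Y) \<le> norm X * norm Y * kM"
    using bounded_bilinear.pos_bounded[OF bounded_bilinear_matrix_matrix_mult] by blast
  obtain kt where kt: "kt > 0" "\<And>P. norm (torque d P) \<le> kt * norm P"
    using torque_bound by blast
  interpret tq: linear "torque d" by (rule bounded_linear.linear[OF bounded_linear_torque])
  define n1 where "n1 = norm N * k * kM"
  define n0 where "n0 = norm N * (2 * k) * kM * (2 * kM)"
  have n: "n0 \<ge> 0" "n1 \<ge> 0" using k kM by (simp_all add: n0_def n1_def)
  \<comment> \<open>One constant dominating the coefficients of the four kinds of error terms, which
    \<open>C_ge\<close> lists; the 1 makes it positive.\<close>
  define C where "C = 2 * L * kt + \<phi> * (n0 + n1) + 2 * L * kt * kt + alpha * kt + 2 * (m * kt * k) + m * kt * k + 1"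
  have pos: "0 \<le> 2 * L * kt" "0 \<le> \<phi> * n0" "0 \<le> \<phi> * n1" "0 \<le> 2 * L * kt * kt" "0 \<le> alpha * kt" "0 \<le> m * kt * k"
    using L(1) kt(1) \<phi> n alpha_nonneg m_pos k(1) by simp_all
  then have "C > 0" unfolding C_def distrib_left by linarith
  have C_ge: "2 * L * kt + \<phi> * (n0 + n1) \<le> C" "\<phi> * n1 + 2 * L * kt * kt \<le> C"
    "alpha * kt + m * kt * k \<le> C" "2 * (m * kt * k) \<le> C"
    using pos unfolding C_def distrib_left by linarith+
  have "\<phi> * (B / 2)\<^sup>2 > 0" using \<phi> B(1) by simp
  then obtain \<epsilon> r1 c where \<epsilon>: "0 < \<epsilon>" "\<epsilon> \<le> 1" and r1: "0 < r1" "r1 \<le> 1" and c: "0 < c"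
    and young: "\<And>r W Y. 0 \<le> r \<Longrightarrow> r \<le> r1 \<Longrightarrow> 0 \<le> W \<Longrightarrow> 0 \<le> Y \<Longrightarrow>
      - lam * W\<^sup>2 - \<epsilon> * (\<phi> * (B / 2)\<^sup>2) * Y\<^sup>2 + C * (r * (W * Y) + r * Y\<^sup>2 + \<epsilon> * (W * Y) + \<epsilon> * W\<^sup>2) \<le> - c * (W\<^sup>2 + Y\<^sup>2)"
    using young_constants[OF lam_pos _ \<open>C > 0\<close>] by metis
  \<comment> \<open>The second bound lets the tangency defect consume at most half of the lower
    bound \<open>B\<close>.\<close>
  define r where "r = min r1 (B / (4 * kM))"
  have "r \<le> 1" using r1 by (simp add: r_def)
  then have r: "0 < r" "r \<le> r1" "r \<le> 1" "2 * (r * kM) \<le> B / 2"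
    using r1 B(1) kM(1) by (auto simp: r_def min_def field_simps)
  show ?thesis
  proof (rule conjI[OF \<phi>], rule exI[of _ \<epsilon>], rule exI[of _ r], rule exI[of _ c],
      intro conjI \<epsilon> r(1) c allI impI)
    fix P1 P2 :: "real^3^3" and z1 z2 :: "real^3" and M :: "real^3^3"
    assume P1: "P1 \<in> SO3" and P2: "P2 \<in> SO3" and X1: "norm (P1 - dmat e) \<le> r" and X2: "norm (P2 - dmat e) \<le> r"
      and z: "norm z1 \<le> r" "norm z2 \<le> r" and M: "\<forall>x. lam * (norm x)\<^sup>2 \<le> x \<bullet> (M *v x)"
      and M_le: "\<forall>x. norm (M *v x) \<le> alpha * norm x"
    define Z w where "Z = P1 - P2" and "w = z1 - z2"
    define \<tau> where "\<tau> = torque d Z"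
    define W Y where "W = norm w" and "Y = norm Z"
    have WY: "0 \<le> W" "0 \<le> Y" by (simp_all add: W_def Y_def)
    define T where "T = Z ** dmat e + dmat e ** transpose Z"
    have T: "norm T \<le> 2 * (r * kM) * Y"
    proof -
      have "T = - (Z ** transpose (P1 - dmat e) + (P2 - dmat e) ** transpose Z)"
        using tangent_defect[OF P1 P2, of "dmat e"] by (simp add: T_def Z_def)
      then have "norm T \<le> norm (Z ** transpose (P1 - dmat e)) + norm ((P2 - dmat e) ** transpose Z)"
        by (simp only: norm_minus_cancel norm_triangle_ineq)
      also have "\<dots> \<le> norm Z * norm (transpose (P1 - dmat e)) * kM + norm (P2 - dmat e) * norm (transpose Z) * kM"
        by (intro add_mono kM)
      also have "\<dots> = norm Z * norm (P1 - dmat e) * kM + norm (P2 - dmat e) * norm Z * kM"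
        by (simp only: norm_transpose)
      also have "\<dots> \<le> norm Z * r * kM + r * norm Z * kM"
        using X1 X2 kM(1) by (intro add_mono mult_right_mono mult_left_mono) auto
      finally show ?thesis by (simp add: Y_def mult_ac)
    qed
    have \<tau>_le: "norm \<tau> \<le> kt * Y" using kt(2) by (simp add: \<tau>_def Y_def)
    have \<tau>_ge: "(B / 2)\<^sup>2 * Y\<^sup>2 \<le> (norm \<tau>)\<^sup>2"
    proof -
      have "B * Y \<le> norm \<tau> + 2 * (r * kM) * Y"
        using B(2)[of Z] T by (simp add: \<tau>_def T_def Y_def)
      also have "2 * (r * kM) * Y \<le> B / 2 * Y" using r(4) WY(2) by (rule mult_right_mono)
      finally have "B / 2 * Y \<le> norm \<tau>" by simp
      then have "(B / 2 * Y)\<^sup>2 \<le> (norm \<tau>)\<^sup>2" using B(1) WY by (intro power_mono) auto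
      then show ?thesis by (simp only: power_mult_distrib)
    qed
    \<comment> \<open>Remainder of the force difference after linearisation. It is of size
      \<open>r * Y\<close> because \<open>\<Phi>'\<close> is Lipschitz along the potential and the
      torque vanishes at \<open>dmat e\<close>.\<close>
    define G where "G = force P1 - force P2 - \<phi> *\<^sub>R \<tau>"
    have G: "norm G \<le> 2 * L * kt * (r * Y)"
    proof -
      have "max 0 (pot d P1) = pot d P1" "max 0 (pot d P2) = pot d P2"
        using pot_nonneg P1 P2 by auto
      then have "G = (\<Phi>' (pot d P1) - \<phi>) *\<^sub>R \<tau> + (\<Phi>' (pot d P1) - \<Phi>' (pot d P2)) *\<^sub>R torque d (P2 - dmat e)"
        by (simp add: G_def \<tau>_def Z_def force_def tq.diff tq0 algebra_simps)
      then have "norm G \<le> \<bar>\<Phi>' (pot d P1) - \<phi>\<bar> * norm \<tau>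
          + \<bar>\<Phi>' (pot d P1) - \<Phi>' (pot d P2)\<bar> * norm (torque d (P2 - dmat e))"
        by (metis norm_triangle_ineq norm_scaleR)
      also have "\<dots> \<le> (L * r) * (kt * Y) + (L * Y) * (kt * r)"
      proof (intro add_mono mult_mono \<tau>_le)
        show "\<bar>\<Phi>' (pot d P1) - \<phi>\<bar> \<le> L * r"
          using L(2)[OF P1 Pe] mult_left_mono[OF X1 L(1)] by (simp add: \<phi>_def)
        show "\<bar>\<Phi>' (pot d P1) - \<Phi>' (pot d P2)\<bar> \<le> L * Y"
          using L(2)[OF P1 P2] by (simp add: Y_def Z_def)
        show "norm (torque d (P2 - dmat e)) \<le> kt * r"
          using order_trans[OF kt(2) mult_left_mono[OF X2]] kt(1) by simp
      qed (use L(1) r(1) kt(1) WY in auto)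
      finally show ?thesis by (simp add: algebra_simps)
    qed
    define Z' where "Z' = skew z1 ** P1 - skew z2 ** P2"
    have Z'1: "Z' = skew w ** P1 + skew z2 ** Z"
      by (simp add: Z'_def w_def Z_def S.diff_left S.diff_right)
    then have Z'2: "Z' = skew w ** dmat e + skew w ** (P1 - dmat e) + skew z2 ** Z"
      by (simp add: S.diff_right)
    have b1: "norm (skew w ** P1) \<le> 2 * k * W"
    proof -
      have "norm (skew w ** P1) \<le> W * norm P1 * k" unfolding W_def by (rule k)
      also have "\<dots> \<le> W * 2 * k"
        using norm_SO3_le[OF P1] k(1) WY by (intro mult_right_mono mult_left_mono) auto
      finally show ?thesis by (simp only: mult_ac)
    qed
    have b2: "norm (skew z2 ** Z) \<le> k * (r * Y)"
    proof -
      have "norm (skew z2 ** Z) \<le> norm z2 * Y * k" unfolding Y_def by (rule k)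
      also have "\<dots> \<le> r * Y * k" using z k(1) WY by (intro mult_right_mono) auto
      finally show ?thesis by (simp only: mult_ac)
    qed
    have b3: "norm (skew w ** (P1 - dmat e)) \<le> k * (r * W)"
    proof -
      have "norm (skew w ** (P1 - dmat e)) \<le> W * norm (P1 - dmat e) * k" unfolding W_def by (rule k)
      also have "\<dots> \<le> W * r * k" using X1 k(1) WY by (intro mult_right_mono mult_left_mono) auto
      finally show ?thesis by (simp only: mult_ac)
    qed
    have b4: "norm (skew w) \<le> 2 * k * W"
    proof -
      have "norm (skew w) \<le> W * norm (mat 1 :: real^3^3) * k"
        using k(2)[of w "mat 1"] by (simp add: W_def)
      also have "\<dots> \<le> W * 2 * k"
        using norm_SO3_le[OF mat_1_SO3] k(1) WY by (intro mult_right_mono mult_left_mono) auto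
      finally show ?thesis by (simp only: mult_ac)
    qed
    have NX: "norm (N ** X) \<le> norm N * b * kM" if "norm X \<le> b" for X :: "real^3^3" and b
      using kM(2)[of N X] that kM(1)
      by (meson mult_left_mono mult_right_mono norm_ge_zero order_trans less_imp_le)
    \<comment> \<open>Remainder in the derivative of the quadratic form: tangency defect,
      displacement of \<open>P1\<close> from the saddle, and turning of \<open>Z\<close> by the
      small velocity \<open>z2\<close>.\<close>
    define R where "R = (N ** skew w) \<bullet> T + Z \<bullet> (N ** (skew w ** (P1 - dmat e))) + Z \<bullet> (N ** (skew z2 ** Z))"
    have ee: "e$i * e$i = 1" for i using e[of i] by auto
    have NZ: "Z \<bullet> (N ** Z') = - (w \<bullet> \<tau>) + R"
      using saddle_identity[OF ee, of Z d w]
      by (simp add: Z'2 R_def T_def \<tau>_def N_def inner_add_right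
          bounded_bilinear.add_right[OF bounded_bilinear_matrix_matrix_mult])
    have R: "\<bar>R\<bar> \<le> (n0 + n1) * (r * (W * Y)) + n1 * (r * Y\<^sup>2)"
    proof -
      have "\<bar>(N ** skew w) \<bullet> T\<bar> \<le> (norm N * (2 * k * W) * kM) * (2 * (r * kM) * Y)"
        by (intro abs_inner_le NX b4 T)
      moreover have "\<bar>Z \<bullet> (N ** (skew w ** (P1 - dmat e)))\<bar> \<le> Y * (norm N * (k * (r * W)) * kM)"
        by (intro abs_inner_le NX b3) (simp add: Y_def)
      moreover have "\<bar>Z \<bullet> (N ** (skew z2 ** Z))\<bar> \<le> Y * (norm N * (k * (r * Y)) * kM)"
        by (intro abs_inner_le NX b2) (simp add: Y_def)
      moreover have "(norm N * (2 * k * W) * kM) * (2 * (r * kM) * Y) = n0 * (r * (W * Y))"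
        "Y * (norm N * (k * (r * W)) * kM) = n1 * (r * (W * Y))"
        "Y * (norm N * (k * (r * Y)) * kM) = n1 * (r * Y\<^sup>2)"
        by (simp_all add: n0_def n1_def power2_eq_square)
      ultimately show ?thesis unfolding R_def distrib_right by linarith
    qed
    have i1: "w \<bullet> G \<le> 2 * L * kt * (r * (W * Y))"
    proof -
      have "\<bar>w \<bullet> G\<bar> \<le> W * (2 * L * kt * (r * Y))" by (intro abs_inner_le G) (simp add: W_def)
      then show ?thesis by (simp add: mult_ac)
    qed
    have i2: "\<phi> * R \<le> \<phi> * (n0 + n1) * (r * (W * Y)) + \<phi> * n1 * (r * Y\<^sup>2)"
    proof -
      have "\<phi> * R \<le> \<phi> * ((n0 + n1) * (r * (W * Y)) + n1 * (r * Y\<^sup>2))"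
        using R \<phi> by (intro mult_left_mono) auto
      then show ?thesis by (simp only: distrib_left[of \<phi> "_ * _"] mult.assoc)
    qed
    have i3: "- (\<epsilon> * (G \<bullet> \<tau>)) \<le> 2 * L * kt * kt * (r * Y\<^sup>2)"
    proof -
      have g: "\<bar>G \<bullet> \<tau>\<bar> \<le> (2 * L * kt * (r * Y)) * (kt * Y)" by (intro abs_inner_le G \<tau>_le)
      have "\<epsilon> * \<bar>G \<bullet> \<tau>\<bar> \<le> 1 * \<bar>G \<bullet> \<tau>\<bar>" using \<epsilon> by (intro mult_right_mono) auto
      moreover have "- (\<epsilon> * (G \<bullet> \<tau>)) \<le> \<epsilon> * \<bar>G \<bullet> \<tau>\<bar>"
        using \<epsilon>(1) by (metis abs_ge_minus_self mult_left_mono mult_minus_right less_imp_le)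
      ultimately show ?thesis using g by (simp add: power2_eq_square mult_ac)
    qed
    have i4: "\<epsilon> * ((M *v w) \<bullet> \<tau>) \<le> alpha * kt * (\<epsilon> * (W * Y))"
    proof -
      have "\<bar>(M *v w) \<bullet> \<tau>\<bar> \<le> (alpha * W) * (kt * Y)"
        by (intro abs_inner_le \<tau>_le) (simp add: W_def M_le)
      then have "\<epsilon> * ((M *v w) \<bullet> \<tau>) \<le> \<epsilon> * ((alpha * W) * (kt * Y))"
        using \<epsilon>(1) by (intro mult_left_mono) auto
      then show ?thesis by (simp add: mult_ac)
    qed
    have i5: "- (\<epsilon> * (m * (w \<bullet> torque d Z'))) \<le> 2 * (m * kt * k) * (\<epsilon> * W\<^sup>2) + m * kt * k * (\<epsilon> * (W * Y))"
    proof -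
      have "norm Z' \<le> 2 * k * W + k * (r * Y)"
        unfolding Z'1 by (rule norm_triangle_le[OF add_mono[OF b1 b2]])
      also have "\<dots> \<le> 2 * k * W + k * (1 * Y)"
        using r(3) k(1) WY by (intro add_left_mono mult_left_mono mult_right_mono) auto
      finally have "norm (torque d Z') \<le> kt * (2 * k * W + k * Y)"
        using order_trans[OF kt(2) mult_left_mono[of "norm Z'" _ kt]] kt(1) by simp
      then have "\<bar>w \<bullet> torque d Z'\<bar> \<le> W * (kt * (2 * k * W + k * Y))"
        by (intro abs_inner_le) (simp_all add: W_def)
      then have "- (w \<bullet> torque d Z') \<le> W * (kt * (2 * k * W + k * Y))" by linarith
      then have "(\<epsilon> * m) * - (w \<bullet> torque d Z') \<le> (\<epsilon> * m) * (W * (kt * (2 * k * W + k * Y)))"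
        using \<epsilon>(1) m_pos by (intro mult_left_mono) auto
      then show ?thesis by (simp add: algebra_simps power2_eq_square)
    qed
    have i6: "- (\<epsilon> * (\<phi> * (norm \<tau>)\<^sup>2)) \<le> - (\<epsilon> * (\<phi> * (B / 2)\<^sup>2) * Y\<^sup>2)"
    proof -
      have "(\<epsilon> * \<phi>) * ((B / 2)\<^sup>2 * Y\<^sup>2) \<le> (\<epsilon> * \<phi>) * (norm \<tau>)\<^sup>2"
        using \<epsilon>(1) \<phi> \<tau>_ge by (intro mult_left_mono) auto
      then show ?thesis by (simp add: mult.assoc)
    qed
    have i7: "- (w \<bullet> (M *v w)) \<le> - lam * W\<^sup>2" using M by (simp add: W_def)
    have f: "(force P1 - M *v z1) - (force P2 - M *v z2) = \<phi> *\<^sub>R \<tau> + G - M *v w"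
      by (simp add: G_def w_def matrix_vector_mult_diff_distrib)
    \<comment> \<open>On the right the two terms \<open>\<phi> * (w \<bullet> \<tau>)\<close> have
      cancelled.\<close>
    have "w \<bullet> ((force P1 - M *v z1) - (force P2 - M *v z2)) + \<phi> * (Z \<bullet> (N ** Z'))
        - \<epsilon> * (((force P1 - M *v z1) - (force P2 - M *v z2)) \<bullet> \<tau> + m * (w \<bullet> torque d Z'))
      = w \<bullet> G + - (w \<bullet> (M *v w)) + \<phi> * R + - (\<epsilon> * (\<phi> * (norm \<tau>)\<^sup>2)) + - (\<epsilon> * (G \<bullet> \<tau>))
        + \<epsilon> * ((M *v w) \<bullet> \<tau>) + - (\<epsilon> * (m * (w \<bullet> torque d Z')))"
      unfolding f NZ power2_norm_eq_inner
      by (simp add: inner_add_left inner_add_right inner_diff_left inner_diff_right algebra_simps)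
    also have "\<dots> \<le> 2 * L * kt * (r * (W * Y)) + - lam * W\<^sup>2
        + (\<phi> * (n0 + n1) * (r * (W * Y)) + \<phi> * n1 * (r * Y\<^sup>2)) + - (\<epsilon> * (\<phi> * (B / 2)\<^sup>2) * Y\<^sup>2)
        + 2 * L * kt * kt * (r * Y\<^sup>2) + alpha * kt * (\<epsilon> * (W * Y))
        + (2 * (m * kt * k) * (\<epsilon> * W\<^sup>2) + m * kt * k * (\<epsilon> * (W * Y)))"
      by (intro add_mono i1 i2 i3 i4 i5 i6 i7)
    also have "\<dots> = - lam * W\<^sup>2 - \<epsilon> * (\<phi> * (B / 2)\<^sup>2) * Y\<^sup>2
        + ((2 * L * kt + \<phi> * (n0 + n1)) * (r * (W * Y)) + (\<phi> * n1 + 2 * L * kt * kt) * (r * Y\<^sup>2)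
          + (alpha * kt + m * kt * k) * (\<epsilon> * (W * Y)) + 2 * (m * kt * k) * (\<epsilon> * W\<^sup>2))"
      by (simp add: algebra_simps)
    also have "\<dots> \<le> - lam * W\<^sup>2 - \<epsilon> * (\<phi> * (B / 2)\<^sup>2) * Y\<^sup>2
        + (C * (r * (W * Y)) + C * (r * Y\<^sup>2) + C * (\<epsilon> * (W * Y)) + C * (\<epsilon> * W\<^sup>2))"
      using WY \<epsilon>(1) r(1) by (intro add_left_mono add_mono mult_right_mono C_ge) simp_all
    also have "\<dots> = - lam * W\<^sup>2 - \<epsilon> * (\<phi> * (B / 2)\<^sup>2) * Y\<^sup>2
        + C * (r * (W * Y) + r * Y\<^sup>2 + \<epsilon> * (W * Y) + \<epsilon> * W\<^sup>2)"
      by (simp add: algebra_simps)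
    also have "\<dots> \<le> - c * (W\<^sup>2 + Y\<^sup>2)"
      by (rule young) (use r WY in auto)
    finally show "(z1 - z2) \<bullet> ((force P1 - M *v z1) - (force P2 - M *v z2))
        + \<phi> * ((P1 - P2) \<bullet> (N ** (skew z1 ** P1 - skew z2 ** P2)))
        - \<epsilon> * (((force P1 - M *v z1) - (force P2 - M *v z2)) \<bullet> torque d (P1 - P2)
               + m * ((z1 - z2) \<bullet> torque d (skew z1 ** P1 - skew z2 ** P2)))
      \<le> - c * ((norm (z1 - z2))\<^sup>2 + (norm (P1 - P2))\<^sup>2)"
      unfolding Z_def w_def Z'_def \<tau>_def W_def Y_def .
  qed
qed

text \<open>Equal velocities at \<open>T\<close> leave only the quadratic part of the functional, so
  its sign alone decides. Read as a contrapositive: a solution that differs from a trapped one in a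
  direction where the form is negative is not trapped.\<close>

definition repelling :: "real^3 \<Rightarrow> real \<Rightarrow> bool" where
  "repelling e r \<longleftrightarrow> (\<forall>T P1 z1 P2 z2. sol {T..} P1 z1 \<longrightarrow> sol {T..} P2 z2 \<longrightarrow> t0 \<le> T \<longrightarrow> z1 T = z2 T \<longrightarrow>
      (\<forall>t\<ge>T. norm (P1 t - dmat e) \<le> r \<and> norm (z1 t) \<le> r) \<longrightarrow>
      (\<forall>t\<ge>T. norm (P2 t - dmat e) \<le> r \<and> norm (z2 t) \<le> r) \<longrightarrow>
      0 \<le> (P1 T - P2 T) \<bullet> (dmat (\<chi> i. e$i * d$i) ** (P1 T - P2 T)))"

text \<open>Two trajectories that stay near a saddle forever: the functional \<open>h\<close> of their difference
  decreases at a definite rate as long as it is negative, so it can never have been negative.\<close>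

lemma saddle_repels:
  assumes e: "\<And>i. e$i = 1 \<or> e$i = -1" and Pe: "dmat e \<in> SO3" and ne: "dmat e \<noteq> mat 1"
  shows "\<exists>r>0. repelling e r"
proof -
  define N where "N = dmat (\<chi> i. e$i * d$i)"
  define \<phi> where "\<phi> = \<Phi>' (pot d (dmat e))"
  obtain \<epsilon> r c where \<phi>: "\<phi> > 0" and \<epsilon>: "0 < \<epsilon>" "\<epsilon> \<le> 1" and r: "0 < r" and c: "0 < c"
    and est: "\<forall>P1 P2 z1 z2 M. P1 \<in> SO3 \<longrightarrow> P2 \<in> SO3 \<longrightarrow> norm (P1 - dmat e) \<le> r \<longrightarrow> norm (P2 - dmat e) \<le> r \<longrightarrow>
      norm z1 \<le> r \<longrightarrow> norm z2 \<le> r \<longrightarrow> (\<forall>x. lam * (norm x)\<^sup>2 \<le> x \<bullet> (M *v x)) \<longrightarrow>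
      (\<forall>x. norm (M *v x) \<le> alpha * norm x) \<longrightarrow>
      (z1 - z2) \<bullet> ((force P1 - M *v z1) - (force P2 - M *v z2))
        + \<phi> * ((P1 - P2) \<bullet> (N ** (skew z1 ** P1 - skew z2 ** P2)))
        - \<epsilon> * (((force P1 - M *v z1) - (force P2 - M *v z2)) \<bullet> torque d (P1 - P2)
               + m * ((z1 - z2) \<bullet> torque d (skew z1 ** P1 - skew z2 ** P2)))
      \<le> - c * ((norm (z1 - z2))\<^sup>2 + (norm (P1 - P2))\<^sup>2)"
    using saddle_estimate[OF e Pe ne] unfolding N_def \<phi>_def by blast
  obtain kt where kt: "kt > 0" "\<And>P. norm (torque d P) \<le> kt * norm P"
    using torque_bound by blast
  obtain kM where kM: "kM > 0" "\<And>(X :: real^3^3) (Y :: real^3^3). norm (X ** Y) \<le> norm X * norm Y * kM"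
    using bounded_bilinear.pos_bounded[OF bounded_bilinear_matrix_matrix_mult] by blast
  \<comment> \<open>Sum of the bounds of the three terms of \<open>h\<close>, using
    \<open>\<epsilon> <= 1\<close>, so that \<open>|h| <= Ce * s\<close>.\<close>
  define Ce where "Ce = m / 2 + \<phi> / 2 * (norm N * kM) + m * kt"
  have "Ce > 0" using m_pos \<phi> kM(1) kt(1) by (simp add: Ce_def add_pos_nonneg)
  show ?thesis
    unfolding repelling_def
  proof (intro exI[of _ r] conjI allI impI r, unfold N_def[symmetric], rule ccontr)
    fix T P1 z1 P2 z2
    assume S1: "sol {T..} P1 z1" and S2: "sol {T..} P2 z2" and T: "t0 \<le> T" and zT: "z1 T = z2 T"
      and near1: "\<forall>t\<ge>T. norm (P1 t - dmat e) \<le> r \<and> norm (z1 t) \<le> r"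
      and near2: "\<forall>t\<ge>T. norm (P2 t - dmat e) \<le> r \<and> norm (z2 t) \<le> r"
      and neg: "\<not> 0 \<le> (P1 T - P2 T) \<bullet> (N ** (P1 T - P2 T))"
    define Z w where "Z = (\<lambda>t. P1 t - P2 t)" and "w = (\<lambda>t. z1 t - z2 t)"
    define h where "h t = m/2 * (norm (w t))\<^sup>2 + \<phi>/2 * (Z t \<bullet> (N ** Z t)) - \<epsilon> * m * (w t \<bullet> torque d (Z t))" for t
    define s where "s t = (norm (w t))\<^sup>2 + (norm (Z t))\<^sup>2" for t
    define h' where "h' t = w t \<bullet> ((force (P1 t) - A t *v z1 t) - (force (P2 t) - A t *v z2 t))
        + \<phi> * (Z t \<bullet> (N ** (skew (z1 t) ** P1 t - skew (z2 t) ** P2 t)))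
        - \<epsilon> * (((force (P1 t) - A t *v z1 t) - (force (P2 t) - A t *v z2 t)) \<bullet> torque d (Z t)
               + m * (w t \<bullet> torque d (skew (z1 t) ** P1 t - skew (z2 t) ** P2 t)))" for t
    have dh: "(h has_vector_derivative h' t) (at t within {T..})" if "t \<in> {T..}" for t
    proof -
      let ?a = "(1/m) *\<^sub>R (force (P1 t) - A t *v z1 t) - (1/m) *\<^sub>R (force (P2 t) - A t *v z2 t)"
      let ?b = "skew (z1 t) ** P1 t - skew (z2 t) ** P2 t"
      have dw: "(w has_vector_derivative ?a) (at t within {T..})"
        unfolding w_def by (intro has_vector_derivative_diff solD[OF S1 that] solD[OF S2 that])
      have dZ: "(Z has_vector_derivative ?b) (at t within {T..})"
        unfolding Z_def by (intro has_vector_derivative_diff solD[OF S1 that] solD[OF S2 that])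
      have dt: "((\<lambda>t. torque d (Z t)) has_vector_derivative torque d ?b) (at t within {T..})"
        by (rule bounded_linear.has_vector_derivative[OF bounded_linear_torque dZ])
      have "(h has_vector_derivative m/2 * (2 * (w t \<bullet> ?a)) + \<phi>/2 * (2 * (Z t \<bullet> (N ** ?b)))
          - \<epsilon> * m * (w t \<bullet> torque d ?b + ?a \<bullet> torque d (Z t))) (at t within {T..})"
        unfolding h_def N_def
        by (intro has_vector_derivative_diff has_vector_derivative_add has_vector_derivative_mult_right
            norm2_has_vector_derivative quadratic_form_derivative dw dZ
            bounded_bilinear.has_vector_derivative[OF bounded_bilinear_inner dw dt])
      moreover have a: "?a = (1/m) *\<^sub>R ((force (P1 t) - A t *v z1 t) - (force (P2 t) - A t *v z2 t))"
        by (simp only: scaleR_diff_right)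
      moreover have alg: "m/2 * (2 * (x \<bullet> ((1/m) *\<^sub>R y))) + \<phi>/2 * (2 * q) - \<epsilon> * m * (u + ((1/m) *\<^sub>R y) \<bullet> v)
          = x \<bullet> y + \<phi> * q - \<epsilon> * (y \<bullet> v + m * u)" for x y v :: "real^3" and q u
        using m_pos by (simp add: field_simps)
      ultimately show ?thesis
        unfolding h'_def by (simp only: a alg)
    qed
    have h'_le: "h' t \<le> - c * s t" if "t \<ge> T" for t
      unfolding h'_def s_def Z_def w_def
      by (rule est[rule_format]) (use near1[rule_format, OF that] near2[rule_format, OF that] solD(1)[OF S1] solD(1)[OF S2] A_coercive A_bound T that in auto)
    have s0: "0 \<le> s t" for t by (simp add: s_def)
    have h_abs: "\<bar>h t\<bar> \<le> Ce * s t" for t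
    proof -
      have WY: "norm (w t) * norm (Z t) \<le> s t"
        using sum_squares_bound[of "norm (w t)" "norm (Z t)"]
          mult_nonneg_nonneg[OF norm_ge_zero[of "w t"] norm_ge_zero[of "Z t"]]
        unfolding s_def by linarith
      have "norm (N ** Z t) \<le> norm N * norm (Z t) * kM" by (rule kM(2))
      then have "\<bar>Z t \<bullet> (N ** Z t)\<bar> \<le> norm (Z t) * (norm N * norm (Z t) * kM)"
        by (intro abs_inner_le) simp_all
      also have "\<dots> = (norm N * kM) * (norm (Z t))\<^sup>2" by (simp add: power2_eq_square)
      also have "\<dots> \<le> (norm N * kM) * s t" using kM(1) by (intro mult_left_mono) (auto simp: s_def)
      finally have 1: "\<bar>\<phi>/2 * (Z t \<bullet> (N ** Z t))\<bar> \<le> \<phi>/2 * ((norm N * kM) * s t)"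
        using \<phi> by (simp add: abs_mult)
      have "\<bar>w t \<bullet> torque d (Z t)\<bar> \<le> norm (w t) * (kt * norm (Z t))"
        using kt(2) by (intro abs_inner_le) simp_all
      also have "\<dots> \<le> kt * s t" using WY kt(1) by simp
      finally have "(\<epsilon> * m) * \<bar>w t \<bullet> torque d (Z t)\<bar> \<le> (1 * m) * (kt * s t)"
        using \<epsilon> m_pos kt(1) s0[of t] by (intro mult_mono) auto
      then have 2: "\<bar>\<epsilon> * m * (w t \<bullet> torque d (Z t))\<bar> \<le> m * (kt * s t)"
        using \<epsilon> m_pos by (simp add: abs_mult)
      have 3: "\<bar>m/2 * (norm (w t))\<^sup>2\<bar> \<le> m/2 * s t"
        using m_pos by (simp add: s_def abs_mult)
      have "\<bar>h t\<bar> \<le> m/2 * s t + \<phi>/2 * ((norm N * kM) * s t) + m * (kt * s t)"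
        unfolding h_def using 1 2 3 by linarith
      then show ?thesis by (simp add: Ce_def algebra_simps)
    qed
    have hT: "h T < 0"
      using neg \<phi> zT by (simp add: h_def w_def Z_def mult_pos_neg)
    \<comment> \<open>While \<open>h\<close> stays below its negative initial value,
      \<open>s\<close> cannot drop below this level, so the decrease of \<open>h\<close> does not
      die out.\<close>
    define \<kappa> where "\<kappa> = - h T / Ce"
    have "\<kappa> > 0" using divide_neg_pos[OF hT \<open>Ce > 0\<close>] by (simp add: \<kappa>_def)
    have decr: "h t \<le> h T" if "t \<ge> T" for t
    proof (rule nonincreasing_within[OF that _ dh])
      fix x assume "x \<in> {T..t}"
      then have "h' x \<le> - c * s x" using h'_le by simp
      moreover have "0 \<le> c * s x" using c s0 by simp
      ultimately show "h' x \<le> 0" by linarith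
    qed auto
    have sk: "\<kappa> \<le> s t" if "t \<ge> T" for t
    proof -
      have "- h T \<le> Ce * s t" using h_abs[of t] decr[OF that] by linarith
      then show ?thesis using \<open>Ce > 0\<close> by (simp add: \<kappa>_def field_simps)
    qed
    have linear_decr: "h t + c * \<kappa> * t \<le> h T + c * \<kappa> * T" if "t \<ge> T" for t
    proof (rule nonincreasing_within[OF that])
      show "((\<lambda>t. h t + c * \<kappa> * t) has_vector_derivative h' x + c * \<kappa> * 1) (at x within {T..})" if "x \<in> {T..}" for x
        by (intro has_vector_derivative_add dh that has_vector_derivative_mult_right has_vector_derivative_id)
      show "h' x + c * \<kappa> * 1 \<le> 0" if "x \<in> {T..t}" for x
      proof -
        have "T \<le> x" using that by simp
        then have "c * \<kappa> \<le> c * s x" using c sk by (intro mult_left_mono) auto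
        then show ?thesis using h'_le[OF \<open>T \<le> x\<close>] by linarith
      qed
    qed auto
    have s_le: "s t \<le> 8 * r\<^sup>2" if "t \<ge> T" for t
    proof -
      have "norm (w t) \<le> 2 * r" "norm (Z t) \<le> 2 * r"
        using near1[rule_format, OF that] near2[rule_format, OF that] norm_triangle_ineq4[of "z1 t" "z2 t"]
          norm_triangle_ineq4[of "P1 t - dmat e" "P2 t - dmat e"]
        by (auto simp: w_def Z_def)
      then have "(norm (w t))\<^sup>2 \<le> (2 * r)\<^sup>2" "(norm (Z t))\<^sup>2 \<le> (2 * r)\<^sup>2" 
        using power_mono[of "norm (w t)" "2 * r" 2] power_mono[of "norm (Z t)" "2 * r" 2] by simp_all
      then show ?thesis by (simp add: s_def power_mult_distrib)
    qed
    \<comment> \<open>By this time the linear decrease exceeds \<open>Ce * (8 * r\<^sup>2)\<close>,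
      the largest modulus of \<open>h\<close> that confinement to the balls of radius
      \<open>r\<close> allows.\<close>
    define t where "t = T + (Ce * (8 * r\<^sup>2) + 1) / (c * \<kappa>)"
    have ck: "c * \<kappa> > 0" using c \<open>\<kappa> > 0\<close> by simp
    have "t \<ge> T" using ck \<open>Ce > 0\<close> by (simp add: t_def)
    have "- h t \<le> Ce * (8 * r\<^sup>2)"
      using h_abs[of t] mult_left_mono[OF s_le[OF \<open>t \<ge> T\<close>], of Ce] \<open>Ce > 0\<close> by linarith
    moreover have "c * \<kappa> * t = c * \<kappa> * T + (Ce * (8 * r\<^sup>2) + 1)"
    proof -
      have "x * (T + y / x) = x * T + y" if "x > 0" for x y :: real
        using that by (simp add: distrib_left)
      then show ?thesis using ck unfolding t_def by blast
    qed
    ultimately show False using linear_decr[OF \<open>t \<ge> T\<close>] hT by linarith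
  qed
qed

end

section \<open>The domain of attraction\<close>

context observer
begin

text \<open>Counterpart of the domain of attraction in the coordinates \<open>(P, z)\<close>. Only
  \<open>P\<close> is mentioned because \<open>z\<close> tends to 0 along every solution.\<close>

definition basin :: "((real^3^3) \<times> (real^3)) set" where
  "basin = {x \<in> SO3 \<times> UNIV. \<forall>P z. sol {t0..} P z \<longrightarrow> (P t0, z t0) = x \<longrightarrow> (P \<longlongrightarrow> mat 1) at_top}"

lemma sol_unique_at:
  assumes S: "sol {t0..} P z" "sol {t0..} Q w" and eq: "(P t0, z t0) = (Q t0, w t0)" and T: "t0 \<le> T"
  shows "P T = Q T" "z T = w T"
proof -
  have "sol {t0..T} P z" "sol {t0..T} Q w"
    by (rule sol_subset[OF S(1)], simp, rule sol_subset[OF S(2)], simp)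
  note sol_unique[OF this, of T]
  then show "P T = Q T" "z T = w T" using eq T by auto
qed

lemma low_energy_basin:
  assumes S: "sol {t0..} P z" and T: "t0 \<le> T" and low: "energy (P T) (z T) < \<Phi> (4 * d_min)"
  shows "(P t0, z t0) \<in> basin"
proof -
  have "(Q \<longlongrightarrow> mat 1) at_top" if S2: "sol {t0..} Q w" and eq: "(Q t0, w t0) = (P t0, z t0)" for Q w
  proof (rule low_energy_converges[OF _ T])
    show "sol {T..} Q w" by (rule sol_subset[OF S2]) (use T in auto)
    show "energy (Q T) (w T) < \<Phi> (4 * d_min)"
      using low sol_unique_at[OF S2 S eq T] by simp
  qed
  then show ?thesis using solD(1)[OF S, of t0] by (auto simp: basin_def)
qed

text \<open>With \<open>low_energy_basin\<close>, membership in the basin becomes a strict energy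
  inequality at one finite time; openness is then a matter of continuous dependence.\<close>

lemma basin_low_energy:
  assumes S: "sol {t0..} P z" and x: "(P t0, z t0) \<in> basin"
  obtains T where "t0 \<le> T" "energy (P T) (z T) < \<Phi> (4 * d_min)"
proof -
  have lim: "((\<lambda>t. (P t, z t)) \<longlongrightarrow> (mat 1, 0)) at_top"
    using x S z_tendsto_0[OF S] by (auto simp: basin_def intro: tendsto_Pair)
  have "((\<lambda>t. energy (P t) (z t)) \<longlongrightarrow> 0) at_top"
    using continuous_on_tendsto_compose[OF continuous_on_energy lim] solD(1)[OF S]
    by (auto simp: mat_1_SO3 eventually_at_top_linorder)
  moreover have "\<Phi> (4 * d_min) > 0"
    using \<Phi>_strict_mono[of 0 "4 * d_min"] \<Phi>_zero d_min(1) by simp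
  ultimately have "\<forall>\<^sub>F t in at_top. energy (P t) (z t) < \<Phi> (4 * d_min)"
    by (rule order_tendstoD)
  then obtain N where "\<And>t. t \<ge> N \<Longrightarrow> energy (P t) (z t) < \<Phi> (4 * d_min)"
    by (auto simp: eventually_at_top_linorder)
  then show ?thesis using that[of "max t0 N"] by simp
qed

lemma open_basin: "openin (top_of_set (SO3 \<times> UNIV)) basin"
  unfolding openin_euclidean_subtopology_iff
proof (intro conjI ballI)
  show "basin \<subseteq> SO3 \<times> UNIV" by (auto simp: basin_def)
  fix x assume x: "x \<in> basin"
  then obtain P0 z0 where x0: "x = (P0, z0)" "P0 \<in> SO3" by (auto simp: basin_def)
  obtain P z where S: "sol {t0..} P z" "P t0 = P0" "z t0 = z0"
    using forward_exists[OF order_refl x0(2)] by blast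
  then obtain T where T: "t0 \<le> T" "energy (P T) (z T) < \<Phi> (4 * d_min)"
    using basin_low_energy[OF S(1)] x x0 by auto
  have PT: "(P T, z T) \<in> SO3 \<times> UNIV" using solD(1)[OF S(1)] T by simp
  obtain e where "e > 0" and e: "\<And>y. y \<in> SO3 \<times> UNIV \<Longrightarrow> dist y (P T, z T) < e \<Longrightarrow>
      dist (energy (fst y) (snd y)) (energy (fst (P T, z T)) (snd (P T, z T))) < \<Phi> (4 * d_min) - energy (P T) (z T)"
    using continuous_on_energy[unfolded continuous_on_iff, rule_format, OF PT] T(2)
    by (metis diff_gt_0_iff_gt)
  obtain \<delta> where "\<delta> > 0" and \<delta>: "\<And>Q w. sol {t0..} Q w \<Longrightarrow> dist (Q t0, w t0) (P t0, z t0) < \<delta> \<Longrightarrow>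
      dist (Q T, w T) (P T, z T) < e"
    using continuous_dependence[OF S(1) T(1) \<open>e > 0\<close>] by blast
  show "\<exists>e>0. \<forall>x'\<in>SO3 \<times> UNIV. dist x' x < e \<longrightarrow> x' \<in> basin"
  proof (rule exI[of _ \<delta>], intro conjI ballI impI \<open>\<delta> > 0\<close>)
    fix x' :: "(real^3^3) \<times> (real^3)" assume x': "x' \<in> SO3 \<times> UNIV" "dist x' x < \<delta>"
    then obtain Q w where S2: "sol {t0..} Q w" "Q t0 = fst x'" "w t0 = snd x'"
      using forward_exists[OF order_refl, of "fst x'" "snd x'"] by (auto simp: mem_Times_iff)
    have "dist (Q T, w T) (P T, z T) < e"
      by (rule \<delta>[OF S2(1)]) (use S S2 x' x0 in simp)
    then have "energy (Q T) (w T) < \<Phi> (4 * d_min)"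
      using e[of "(Q T, w T)"] solD(1)[OF S2(1)] T(1) by (simp add: dist_real_def)
    from low_energy_basin[OF S2(1) T(1) this] show "x' \<in> basin" using S2 by simp
  qed
qed

text \<open>The strict inequalities make this set open; its complement in the state space consists
  of the states trapped in the closed \<open>r\<close>-neighbourhood from time \<open>T\<close>
  on.\<close>

definition escape :: "real^3^3 \<Rightarrow> real \<Rightarrow> real \<Rightarrow> ((real^3^3) \<times> (real^3)) set" where
  "escape Pe r T = {x \<in> SO3 \<times> UNIV. \<forall>P z. sol {t0..} P z \<longrightarrow> (P t0, z t0) = x \<longrightarrow>
     (\<exists>t\<ge>T. r < norm (P t - Pe) \<or> r < norm (z t))}"

lemma open_escape:
  assumes "t0 \<le> T"
  shows "openin (top_of_set (SO3 \<times> UNIV)) (escape Pe r T)"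
  unfolding openin_euclidean_subtopology_iff
proof (intro conjI ballI)
  show "escape Pe r T \<subseteq> SO3 \<times> UNIV" by (auto simp: escape_def)
  fix x assume x: "x \<in> escape Pe r T"
  then obtain P0 z0 where x0: "x = (P0, z0)" "P0 \<in> SO3" by (auto simp: escape_def)
  obtain P z where S: "sol {t0..} P z" "P t0 = P0" "z t0 = z0"
    using forward_exists[OF order_refl x0(2)] by blast
  then obtain t where t: "t \<ge> T" "r < norm (P t - Pe) \<or> r < norm (z t)"
    using x x0 by (auto simp: escape_def)
  define e where "e = max (norm (P t - Pe)) (norm (z t)) - r"
  have "e > 0" "t0 \<le> t" using t assms by (auto simp: e_def)
  then obtain \<delta> where "\<delta> > 0" and \<delta>: "\<And>Q w. sol {t0..} Q w \<Longrightarrow> dist (Q t0, w t0) (P t0, z t0) < \<delta> \<Longrightarrow>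
      dist (Q t, w t) (P t, z t) < e"
    using continuous_dependence[OF S(1)] by blast
  show "\<exists>e>0. \<forall>x'\<in>SO3 \<times> UNIV. dist x' x < e \<longrightarrow> x' \<in> escape Pe r T"
  proof (rule exI[of _ \<delta>], intro conjI ballI impI \<open>\<delta> > 0\<close>)
    fix x' :: "(real^3^3) \<times> (real^3)" assume x': "x' \<in> SO3 \<times> UNIV" "dist x' x < \<delta>"
    have "r < norm (Q t - Pe) \<or> r < norm (w t)" if S2: "sol {t0..} Q w" and "(Q t0, w t0) = x'" for Q w
    proof -
      have d: "dist (Q t, w t) (P t, z t) < e"
        by (rule \<delta>[OF S2]) (use S that x' x0 in simp)
      have "norm (Q t - P t) < e" "norm (w t - z t) < e"
        using d dist_fst_le[of "(Q t, w t)" "(P t, z t)"] dist_snd_le[of "(Q t, w t)" "(P t, z t)"]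
        by (auto simp: dist_norm)
      moreover have "norm (P t - Pe) \<le> norm (Q t - Pe) + norm (Q t - P t)"
        using norm_triangle_ineq4[of "Q t - Pe" "Q t - P t"] by simp
      moreover have "norm (z t) \<le> norm (w t) + norm (w t - z t)"
        using norm_triangle_ineq4[of "w t" "w t - z t"] by simp
      ultimately show ?thesis unfolding e_def by linarith
    qed
    then show "x' \<in> escape Pe r T" using x'(1) t(1) unfolding escape_def by blast
  qed
qed

text \<open>A trapped solution is itself the comparison solution: turning its attitude at time
  \<open>T\<close> slightly about the axis \<open>k\<close> with \<open>e$k = 1\<close> changes only
  rows on which the quadratic form is negative. By \<open>repelling\<close> the new solution
  escapes, and \<open>backward_dependence\<close> keeps its initial state close.\<close>

lemma dense_escape:
  assumes e: "\<And>i. e$i = 1 \<or> e$i = -1" "e$1 * e$2 * e$3 = 1" and ne: "dmat e \<noteq> mat 1" and "t0 \<le> T"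
    and r: "repelling e r"
  shows "SO3 \<times> UNIV \<subseteq> closure (escape (dmat e) r T)"
proof
  fix x :: "(real^3^3) \<times> (real^3)" assume x: "x \<in> SO3 \<times> UNIV"
  show "x \<in> closure (escape (dmat e) r T)"
  proof (cases "x \<in> escape (dmat e) r T")
    case True
    then show ?thesis using closure_subset by blast
  next
    case False
    then obtain P z where S: "sol {t0..} P z" and P0: "(P t0, z t0) = x"
      and near: "\<forall>t\<ge>T. norm (P t - dmat e) \<le> r \<and> norm (z t) \<le> r"
      using x unfolding escape_def by (auto simp: not_less)
    \<comment> \<open>At a half-turn exactly one entry of \<open>e\<close> is 1, that of its
      axis.\<close>
    obtain k where k: "e$k = 1" "\<And>i. i \<noteq> k \<Longrightarrow> e$i = -1"
    proof -
      have "\<not> (e$1 = 1 \<and> e$2 = 1 \<and> e$3 = 1)"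
        using ne by (auto simp: vec_eq_iff dmat_nth mat_def forall_3)
      then have "(e$1 = 1 \<and> e$2 = -1 \<and> e$3 = -1) \<or> (e$1 = -1 \<and> e$2 = 1 \<and> e$3 = -1) \<or> (e$1 = -1 \<and> e$2 = -1 \<and> e$3 = 1)"
        using sign_triple[OF e] by auto
      then have "(\<exists>k. e$k = 1 \<and> (\<forall>i. i \<noteq> k \<longrightarrow> e$i = -1))"
      proof (elim disjE)
        assume "e$1 = 1 \<and> e$2 = -1 \<and> e$3 = -1"
        then show ?thesis by (intro exI[of _ 1]) (auto simp: forall_3)
      next
        assume "e$1 = -1 \<and> e$2 = 1 \<and> e$3 = -1"
        then show ?thesis by (intro exI[of _ 2]) (auto simp: forall_3)
      next
        assume "e$1 = -1 \<and> e$2 = -1 \<and> e$3 = 1"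
        then show ?thesis by (intro exI[of _ 3]) (auto simp: forall_3)
      qed
      then show ?thesis using that by blast
    qed
    have PT: "P T \<in> SO3" using solD(1)[OF S] \<open>t0 \<le> T\<close> by simp
    have "\<exists>y\<in>escape (dmat e) r T. dist y x < \<epsilon>" if eps: "\<epsilon> > 0" for \<epsilon>
    proof -
      obtain \<delta> where "\<delta> > 0" and \<delta>: "\<And>Q0. Q0 \<in> SO3 \<Longrightarrow> norm (Q0 - P T) < \<delta> \<Longrightarrow>
          \<exists>Q w. sol {t0..} Q w \<and> Q T = Q0 \<and> w T = z T \<and> dist (Q t0, w t0) (P t0, z t0) < \<epsilon>"
        using backward_dependence[OF S \<open>t0 \<le> T\<close> eps] by blast
      \<comment> \<open>The perturbation has squared norm \<open>4 * \<eta>\<close>: two rows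
        contribute \<open>2 * \<eta>\<close> each.\<close>
      define \<eta> where "\<eta> = min 1 (\<delta>\<^sup>2 / 8)"
      have \<eta>: "0 < \<eta>" "\<eta> \<le> 1" "4 * \<eta> < \<delta>\<^sup>2" using \<open>\<delta> > 0\<close> by (auto simp: \<eta>_def min_def field_simps)
      obtain Rt where Rt: "Rt \<in> SO3" "\<And>i. Rt$i$i = (if i = k then 1 else 1 - \<eta>)"
        using plane_rotation[of \<eta> k] \<eta> by (metis less_imp_le)
      note row = rotated_difference_row[OF PT Rt(1)]
      have "(norm (Rt ** P T - P T))\<^sup>2 = 4 * \<eta>"
        unfolding norm_matrix_power2 row using exhaust_3[of k] by (auto simp: Rt(2) sum_3)
      then have "norm (Rt ** P T - P T) < \<delta>"
        using \<eta>(3) \<open>\<delta> > 0\<close> by (metis power_less_imp_less_base less_imp_le)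
      then obtain Q w where S2: "sol {t0..} Q w" and QT: "Q T = Rt ** P T" "w T = z T"
        and near0: "dist (Q t0, w t0) (P t0, z t0) < \<epsilon>"
        using \<delta>[OF SO3_mult[OF Rt(1) PT]] by blast
      have "(Q T - P T) \<bullet> (dmat (\<chi> i. e$i * d$i) ** (Q T - P T)) = (\<Sum>i\<in>UNIV. e$i * d$i * (2 * (1 - Rt$i$i)))"
        unfolding inner_dmat_mult QT row[symmetric] by (simp add: power2_eq_square)
      also have "\<dots> = (\<Sum>i\<in>UNIV. if i = k then 0 else - (2 * \<eta> * d$i))"
        by (rule sum.cong) (auto simp: k Rt(2))
      also have "\<dots> < 0"
      proof -
        have "0 < \<eta> * d$i" for i using \<eta>(1) d_pos by simp
        from this[of 1] this[of 2] this[of 3] show ?thesis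
          using exhaust_3[of k] by (auto simp: sum_3 simp del: zero_less_mult_iff zero_less_mult_pos)
      qed
      finally have neg: "(Q T - P T) \<bullet> (dmat (\<chi> i. e$i * d$i) ** (Q T - P T)) < 0" .
      have "(Q t0, w t0) \<in> escape (dmat e) r T"
        unfolding escape_def
      proof (intro CollectI conjI allI impI)
        show "(Q t0, w t0) \<in> SO3 \<times> UNIV" using solD(1)[OF S2] by simp
        fix Q' w' assume S3: "sol {t0..} Q' w'" and "(Q' t0, w' t0) = (Q t0, w t0)"
        then have eqT: "Q' T = Q T" "w' T = w T" using sol_unique_at[OF S3 S2 _ \<open>t0 \<le> T\<close>] by auto
        show "\<exists>t\<ge>T. r < norm (Q' t - dmat e) \<or> r < norm (w' t)"
        proof (rule ccontr)
          assume "\<not> ?thesis"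
          then have near': "\<forall>t\<ge>T. norm (Q' t - dmat e) \<le> r \<and> norm (w' t) \<le> r"
            by (auto simp: not_less)
          have "sol {T..} Q' w'" "sol {T..} P z"
            using \<open>t0 \<le> T\<close> by (auto intro: sol_subset[OF S3] sol_subset[OF S])
          then show False
            using r[unfolded repelling_def, rule_format, of T Q' w' P z] near near' eqT QT \<open>t0 \<le> T\<close> neg by simp
        qed
      qed
      then show ?thesis using near0 P0 by blast
    qed
    then show ?thesis by (simp add: closure_approachable)
  qed
qed

text \<open>A solution starting outside the basin converges to one of finitely many half-turns, so
  its initial state is missed by some \<open>escape\<close> set with integer delay.
  \<open>SO3 \<times> UNIV\<close> is closed, which provides the Baire property.\<close>

lemma dense_basin: "SO3 \<times> UNIV \<subseteq> closure basin"
proof -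
  define Eq where "Eq = {e :: real^3. (\<forall>i. e$i = 1 \<or> e$i = -1) \<and> e$1 * e$2 * e$3 = 1 \<and> dmat e \<noteq> mat 1}"
  have "Eq \<subseteq> (\<lambda>(a, b, c). vector [a, b, c]) ` ({1, -1} \<times> {1, -1} \<times> {1, -1})"
  proof
    fix e assume "e \<in> Eq"
    then have "(e$1, e$2, e$3) \<in> {1, -1} \<times> {1, -1} \<times> {1, -1}" "e = vector [e$1, e$2, e$3]"
      by (auto simp: Eq_def vec_eq_iff forall_3)
    then show "e \<in> (\<lambda>(a, b, c). vector [a, b, c]) ` ({1, -1} \<times> {1, -1} \<times> {1, -1})"
      by (metis (mono_tags, lifting) case_prod_conv image_eqI)
  qed
  then have "finite Eq" by (rule finite_subset) simp
  have sq: "e$i * e$i = 1" if "e \<in> Eq" for e i using that by (auto simp: Eq_def) (metis mult_1 square_eq_1_iff)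
  have SO: "dmat e \<in> SO3" if "e \<in> Eq" for e
    using sq[OF that] that by (auto simp: dmat_SO3_iff power2_eq_square Eq_def)
  have "\<exists>r>0. repelling e r" if "e \<in> Eq" for e
    by (rule saddle_repels) (use that SO[OF that] in \<open>auto simp: Eq_def\<close>)
  then obtain r where r_pos: "\<And>e. e \<in> Eq \<Longrightarrow> r e > 0" and r: "\<And>e. e \<in> Eq \<Longrightarrow> repelling e (r e)" by metis
  \<comment> \<open>The state space itself is a member, so that the intersection lies in it whether
    or not \<open>Eq\<close> is inhabited.\<close>
  define \<G> where "\<G> = insert (SO3 \<times> UNIV) ((\<lambda>(n, e). escape (dmat e) (r e) (t0 + real n)) ` (UNIV \<times> Eq))"
  have "SO3 \<times> UNIV \<subseteq> closure (\<Inter>\<G>)"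
  proof (rule Baire)
    show "closed (SO3 \<times> (UNIV :: (real^3) set))" by (intro closed_Times closed_SO3 closed_UNIV)
    show "countable \<G>"
      unfolding \<G>_def using countable_finite[OF \<open>finite Eq\<close>] by (intro countable_insert countable_image countable_SIGMA) auto
    fix G assume "G \<in> \<G>"
    then consider "G = SO3 \<times> UNIV" | n e where "e \<in> Eq" "G = escape (dmat e) (r e) (t0 + real n)"
      by (auto simp: \<G>_def)
    then show "openin (top_of_set (SO3 \<times> UNIV)) G \<and> SO3 \<times> UNIV \<subseteq> closure G"
    proof cases
      case 1
      then show ?thesis using closure_subset[of G] by simp
    next
      case 2
      have "SO3 \<times> UNIV \<subseteq> closure (escape (dmat e) (r e) (t0 + real n))"
        by (rule dense_escape[OF _ _ _ _ r[OF 2(1)]]) (use 2(1) in \<open>auto simp: Eq_def\<close>)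
      then show ?thesis using open_escape[of "t0 + real n" "dmat e" "r e"] 2(2) by simp
    qed
  qed
  moreover have "\<Inter>\<G> \<subseteq> basin"
  proof
    fix x assume x: "x \<in> \<Inter>\<G>"
    have "(P \<longlongrightarrow> mat 1) at_top" if S: "sol {t0..} P z" and x0: "(P t0, z t0) = x" for P z
    proof -
      obtain Pe where Pe: "Pe \<in> SO3" "torque d Pe = 0" "(P \<longlongrightarrow> Pe) at_top"
        using sol_converges[OF S order_refl] by blast
      have "Pe = mat 1"
      proof (rule ccontr)
        assume "Pe \<noteq> mat 1"
        obtain e where e: "Pe = dmat e" "\<And>i. e$i = 1 \<or> e$i = -1" "e$1 * e$2 * e$3 = 1"
          using critical_point[OF Pe(1,2) d_pos d_inj] by metis
        have eE: "e \<in> Eq" using e \<open>Pe \<noteq> mat 1\<close> by (simp add: Eq_def)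
        have "\<forall>\<^sub>F t in at_top. dist (P t) Pe < r e" "\<forall>\<^sub>F t in at_top. dist (z t) 0 < r e"
          using tendstoD[OF Pe(3) r_pos[OF eE]] tendstoD[OF z_tendsto_0[OF S order_refl] r_pos[OF eE]] by auto
        then have "\<forall>\<^sub>F t in at_top. dist (P t) Pe < r e \<and> dist (z t) 0 < r e" by (rule eventually_conj)
        then obtain N where N: "\<And>t. t \<ge> N \<Longrightarrow> dist (P t) Pe < r e \<and> dist (z t) 0 < r e"
          by (auto simp: eventually_at_top_linorder)
        obtain n where n: "N - t0 \<le> real n" using real_arch_simple by blast
        have "x \<in> escape (dmat e) (r e) (t0 + real n)"
          using x eE by (auto simp: \<G>_def)
        then obtain t where "t \<ge> t0 + real n" "r e < norm (P t - dmat e) \<or> r e < norm (z t)"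
          using S x0 unfolding escape_def by blast
        then show False using N[of t] n e(1) by (auto simp: dist_norm)
      qed
      then show ?thesis using Pe(3) by simp
    qed
    moreover have "x \<in> SO3 \<times> UNIV" using x by (auto simp: \<G>_def)
    ultimately show "x \<in> basin" by (auto simp: basin_def)
  qed
  ultimately show ?thesis using closure_mono by blast
qed

end

section \<open>Reduction of the filter to the error system\<close>

text \<open>\<open>D\<close> may fail to be symmetric, so \<open>lam\<close> is taken as the minimum
  of the quadratic form on the compact unit sphere rather than as an eigenvalue.\<close>

lemma positive_definite_bounds:
  fixes D :: "real^3^3"
  assumes "positive_definite D"
  obtains lam alpha where "lam > 0" "\<And>x. lam * (norm x)\<^sup>2 \<le> x \<bullet> (D *v x)" "\<And>x. norm (D *v x) \<le> alpha * norm x"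
proof -
  have cont: "continuous_on (sphere 0 1) (\<lambda>x. x \<bullet> (D *v x))"
    by (intro continuous_intros matrix_continuous_intros)
  have "sphere (0 :: real^3) 1 \<noteq> {}" by simp
  then obtain x0 where x0: "x0 \<in> sphere 0 1" "\<And>x. x \<in> sphere 0 1 \<Longrightarrow> x0 \<bullet> (D *v x0) \<le> x \<bullet> (D *v x)"
    using continuous_attains_inf[OF compact_sphere _ cont] by blast
  define lam where "lam = x0 \<bullet> (D *v x0)"
  have "x0 \<noteq> 0" using x0(1) by auto
  then have "lam > 0" using assms by (simp add: lam_def positive_definite_def)
  moreover have "lam * (norm x)\<^sup>2 \<le> x \<bullet> (D *v x)" for x
  proof (cases "x = 0")
    case False
    define u where "u = (1 / norm x) *\<^sub>R x"
    have x: "x = norm x *\<^sub>R u" using False by (simp add: u_def)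
    have "lam \<le> u \<bullet> (D *v u)" unfolding lam_def by (rule x0(2)) (use False in \<open>simp add: u_def\<close>)
    then have "(norm x)\<^sup>2 * lam \<le> (norm x)\<^sup>2 * (u \<bullet> (D *v u))" by (rule mult_left_mono) simp
    also have "\<dots> = (norm x *\<^sub>R u) \<bullet> (D *v (norm x *\<^sub>R u))"
      by (simp add: matrix_vector_mult_scaleR power2_eq_square)
    finally show ?thesis using x by (simp add: mult.commute)
  qed simp
  moreover obtain alpha where "\<And>x. norm (D *v x) \<le> alpha * norm x"
    using bounded_linear.bounded[OF matrix_vector_mul_bounded_linear[of D]] by (metis mult.commute)
  ultimately show ?thesis using that by blast
qed

text \<open>The weights \<open>d i / (\<sigma> i)\<^sup>2\<close> cancel the singular values on both
  sides. In odd dimension \<open>- U\<close> has the opposite determinant and conjugates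
  identically, so \<open>U\<close> can be taken to be a rotation.\<close>

lemma weight_diagonalises:
  fixes E :: "real^'n^3"
  assumes "admissible_weight E W"
  obtains U d where "U \<in> SO3" "\<And>i. d$i > 0" "E ** W ** transpose E = U ** dmat d ** transpose U"
proof -
  obtain \<iota> U \<sigma> V d W0 where svd: "is_svd E \<iota> U \<sigma> V" and d: "\<And>i. 0 < d i" and "diagonal W0"
    and W0: "\<And>i. W0 $ \<iota> i $ \<iota> i = d i / (\<sigma> i)\<^sup>2" and W: "W = V ** W0 ** transpose V"
    using assms unfolding admissible_weight_def by metis
  define \<Sigma> :: "real^'n^3" where "\<Sigma> = (\<chi> i j. if j = \<iota> i then \<sigma> i else 0)"
  have \<iota>: "inj \<iota>" and U: "orthogonal_matrix U" and V: "transpose V ** V = mat 1" and \<sigma>: "\<And>i. 0 < \<sigma> i"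
    and E: "E = U ** \<Sigma> ** transpose V"
    using svd by (simp_all add: is_svd_def orthogonal_matrix_def \<Sigma>_def)
  have mid: "\<Sigma> ** W0 ** transpose \<Sigma> = dmat (\<chi> i. d i)"
  proof (intro vec_eq_iff[THEN iffD2] allI)
    fix i k
    have "(\<Sigma> ** W0)$i$j = \<sigma> i * W0$(\<iota> i)$j" for j
      by (simp add: matrix_matrix_mult_def \<Sigma>_def if_distrib if_distribR cong: if_cong)
    moreover have "(Y ** transpose \<Sigma>)$i$k = Y$i$(\<iota> k) * \<sigma> k" for Y :: "real^'n^3"
      by (simp add: matrix_matrix_mult_def transpose_def \<Sigma>_def if_distrib if_distribR cong: if_cong)
    ultimately have "(\<Sigma> ** W0 ** transpose \<Sigma>)$i$k = \<sigma> i * W0$(\<iota> i)$(\<iota> k) * \<sigma> k"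
      by simp
    also have "\<dots> = dmat (\<chi> i. d i)$i$k"
      using \<open>diagonal W0\<close> W0[of i] \<sigma>[of i] \<iota>
      by (auto simp: dmat_nth diagonal_def inj_eq power2_eq_square field_simps)
    finally show "(\<Sigma> ** W0 ** transpose \<Sigma>)$i$k = dmat (\<chi> i. d i)$i$k" .
  qed
  have "E ** W ** transpose E
      = U ** \<Sigma> ** (transpose V ** V) ** W0 ** (transpose V ** V) ** transpose \<Sigma> ** transpose U"
    by (simp only: E W matrix_transpose_mul transpose_transpose matrix_mul_assoc)
  also have "\<dots> = U ** (\<Sigma> ** W0 ** transpose \<Sigma>) ** transpose U"
    by (simp add: V matrix_mul_assoc)
  finally have K: "E ** W ** transpose E = U ** dmat (\<chi> i. d i) ** transpose U" by (simp add: mid)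
  have dp: "(\<chi> i. d i) $ i > 0" for i using d by simp
  show ?thesis
  proof (cases "det U = 1")
    case True
    then show ?thesis using that[OF _ dp K] U by (simp add: SO3_def rotation_matrix_def)
  next
    case False
    then have "det U = -1" using det_orthogonal_matrix[OF U] by blast
    then have "det (- U) = 1" by (simp add: det_3)
    moreover have t: "transpose (- U) = - transpose U" by (simp add: transpose_def vec_eq_iff)
    have neg: "(- X) ** Y = - (X ** Y)" "X ** (- Y) = - (X ** Y)" for X Y :: "real^3^3"
      by (simp_all add: bounded_bilinear.minus_left[OF bounded_bilinear_matrix_matrix_mult]
          bounded_bilinear.minus_right[OF bounded_bilinear_matrix_matrix_mult])
    ultimately have "- U \<in> SO3" using U by (simp add: SO3_iff orthogonal_matrix_def t neg)
    then show ?thesis using that[OF _ dp] K by (simp add: t neg)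
  qed
qed

text \<open>Each eigenvalue is an entry of \<open>d\<close>; three different eigenvalues leave no
  room for a repeated entry.\<close>

lemma distinct_eigenvalues_inj:
  assumes U: "U \<in> SO3" and dist: "distinct_positive_eigenvalues (U ** dmat d ** transpose U)"
    and eq: "d$i = d$j"
  shows "i = j"
proof -
  have "eigenvalues (U ** dmat d ** transpose U) \<subseteq> range (\<lambda>i. d$i)"
  proof
    fix k assume "k \<in> eigenvalues (U ** dmat d ** transpose U)"
    then obtain v where v: "v \<noteq> 0" "(U ** dmat d ** transpose U) *v v = k *\<^sub>R v"
      by (auto simp: eigenvalues_def)
    define u where "u = transpose U *v v"
    have "norm u = norm v" unfolding u_def by (rule norm_SO3_mult_vector[OF SO3_transpose[OF U]])
    then have "u \<noteq> 0" using v(1) by auto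
    have "dmat d *v u = (transpose U ** U) *v (dmat d *v u)" using SO3_transpose_mult[OF U] by simp
    also have "\<dots> = transpose U *v ((U ** dmat d ** transpose U) *v v)"
      by (simp only: u_def matrix_vector_mul_assoc matrix_mul_assoc)
    also have "\<dots> = k *\<^sub>R u" by (simp only: v(2) matrix_vector_mult_scaleR u_def)
    finally have du: "dmat d *v u = k *\<^sub>R u" .
    obtain i where "u$i \<noteq> 0" using \<open>u \<noteq> 0\<close> by (auto simp: vec_eq_iff)
    moreover have "(dmat d *v u)$i = d$i * u$i"
      by (simp add: matrix_vector_mult_def dmat_nth if_distrib if_distribR cong: if_cong)
    ultimately have "k = d$i" using du by simp
    then show "k \<in> range (\<lambda>i. d$i)" by blast
  qed
  then have "card (eigenvalues (U ** dmat d ** transpose U)) \<le> card (range (\<lambda>i. d$i))"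
    by (intro card_mono) auto
  then have "card (range (\<lambda>i. d$i)) = card (UNIV :: 3 set)"
    using dist card_image_le[of "UNIV :: 3 set" "\<lambda>i. d$i"]
    by (simp add: distinct_positive_eigenvalues_def)
  then have "inj (\<lambda>i. d$i)" by (intro eq_card_imp_inj_on) auto
  then show ?thesis using eq by (auto simp: inj_def)
qed

text \<open>With \<open>X = Rh R^T\<close> one has \<open>(1 - X)^T (1 - X) = 2 - X - X^T\<close>;
  cyclicity of the trace brings in \<open>E W E^T\<close>, and conjugation by \<open>U\<close> turns
  \<open>X\<close> into the transpose of \<open>P\<close>. \<open>P\<close> and its transpose
  contribute equally to the trace, which cancels the factor 1/2.\<close>

lemma U0_eq_pot:
  fixes E :: "real^'n^3"
  assumes U: "U \<in> SO3" and R: "R \<in> SO3" and Rh: "Rh \<in> SO3"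
    and K: "E ** W ** transpose E = U ** dmat d ** transpose U"
  shows "U0 E W Rh (transpose R ** E) = pot d (transpose U ** R ** transpose Rh ** U)"
proof -
  define X where "X = Rh ** transpose R"
  define P where "P = transpose U ** R ** transpose Rh ** U"
  have X: "transpose X ** X = mat 1"
    unfolding X_def by (rule SO3_transpose_mult[OF SO3_mult[OF Rh SO3_transpose[OF R]]])
  have t: "transpose (A - B) = transpose A - transpose B" for A B :: "real^3^3"
    by (simp add: transpose_def vec_eq_iff)
  have EX: "E - Rh ** (transpose R ** E) = (mat 1 - X) ** E"
    by (simp add: X_def matrix_mult_diff matrix_mul_assoc)
  have "frob_inner ((mat 1 - X) ** E) ((mat 1 - X) ** E ** W)
      = trace (transpose E ** (transpose (mat 1 - X) ** (mat 1 - X) ** (E ** W)))"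
    by (simp only: frob_inner_def matrix_transpose_mul matrix_mul_assoc)
  also have "\<dots> = trace (transpose (mat 1 - X) ** (mat 1 - X) ** (E ** W) ** transpose E)"
    by (rule trace_mul_sym)
  also have "\<dots> = trace ((transpose (mat 1 - X) ** (mat 1 - X) ** U ** dmat d) ** transpose U)"
    by (simp only: matrix_mul_assoc[symmetric] K[unfolded matrix_mul_assoc[symmetric]])
  also have "\<dots> = trace (transpose U ** (transpose (mat 1 - X) ** (mat 1 - X) ** U ** dmat d))"
    by (rule trace_mul_sym)
  also have "transpose U ** (transpose (mat 1 - X) ** (mat 1 - X) ** U ** dmat d)
      = (mat 1 - P - transpose P + mat 1) ** dmat d"
  proof -
    have "transpose (mat 1 - X) ** (mat 1 - X) = mat 1 - transpose X - X + mat 1"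
      by (simp add: t matrix_mult_diff X algebra_simps)
    moreover have "transpose U ** (mat 1 - transpose X - X + mat 1) ** U = mat 1 - P - transpose P + mat 1"
    proof -
      have "transpose U ** transpose X ** U = P" "transpose U ** X ** U = transpose P"
        by (simp_all add: X_def P_def matrix_transpose_mul matrix_mul_assoc)
      moreover have "transpose U ** mat 1 ** U = mat 1" using SO3_transpose_mult[OF U] by simp
      ultimately show ?thesis by (simp only: matrix_mult_diff matrix_mult_add)
    qed
    ultimately show ?thesis by (simp only: matrix_mul_assoc)
  qed
  also have "trace ((mat 1 - P - transpose P + mat 1) ** dmat d) = 2 * pot d P"
    by (simp add: trace_def mult_dmat_nth pot_def sum_3 mat_def transpose_def algebra_simps)
  finally show ?thesis by (simp add: U0_def EX P_def)
qed

text \<open>Once the diagonalisation is inserted, the matrix under \<open>vex\<close> is that of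
  \<open>skew_torque\<close> conjugated by the rotation \<open>R^T U\<close>, and
  \<open>skew_rotation\<close> turns the conjugation into a rotation of the vector.\<close>

lemma SL_eq_torque:
  fixes E :: "real^'n^3"
  assumes U: "U \<in> SO3" and R: "R \<in> SO3" and Rh: "Rh \<in> SO3"
    and K: "E ** W ** transpose E = U ** dmat d ** transpose U"
  shows "SL (E ** W ** transpose (transpose R ** E)) Rh
    = transpose R *v (U *v torque d (transpose U ** R ** transpose Rh ** U))"
proof -
  define P where "P = transpose U ** R ** transpose Rh ** U"
  have UU: "U ** (transpose U ** Y) = Y" for Y :: "real^3^3"
    using SO3_mult_transpose[OF U] by (simp add: matrix_mul_assoc)
  have RR: "transpose R ** (R ** Y) = Y" for Y :: "real^3^3"
    using SO3_transpose_mult[OF R] by (simp add: matrix_mul_assoc)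
  define L where "L = E ** W ** transpose (transpose R ** E)"
  have L: "L = U ** dmat d ** transpose U ** R"
    by (simp add: L_def matrix_transpose_mul matrix_mul_assoc K)
  have "transpose L ** Rh - transpose Rh ** L
      = transpose R ** U ** skew (torque d P) ** transpose (transpose R ** U)"
    by (simp add: L skew_torque P_def matrix_transpose_mul matrix_mult_diff
        matrix_mul_assoc[symmetric] UU RR SO3_transpose_mult[OF R])
  also have "\<dots> = skew ((transpose R ** U) *v torque d P)"
    by (rule skew_rotation[symmetric]) (intro SO3_mult SO3_transpose U R)
  finally show ?thesis
    by (simp add: SL_def vex_skew matrix_vector_mul_assoc P_def L_def)
qed

theorem theorem4p1:
  fixes R :: "real \<Rightarrow> real^3^3" and \<Omega> \<Omega>m :: "real \<Rightarrow> real^3"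
    and E :: "real^'n^3" and W :: "real^'n^'n" and Um :: "real \<Rightarrow> real^'n^3"
    and \<Phi> \<Phi>' :: "real \<Rightarrow> real" and m :: real and D :: "real^3^3" and t0 :: real
  assumes attitude: "\<And>t. t \<ge> 0 \<Longrightarrow> R t \<in> SO3"
    and kinematics: "\<And>t. t \<ge> 0 \<Longrightarrow>
          (R has_vector_derivative R t ** skew (\<Omega> t)) (at t within {0..})"
    and no_noise_Um: "\<And>t. t \<ge> 0 \<Longrightarrow> Um t = transpose (R t) ** E"
    and no_noise_\<Omega>m: "\<And>t. t \<ge> 0 \<Longrightarrow> \<Omega>m t = \<Omega> t"
    and rank_E: "rank E = 3"
    and weight: "admissible_weight E W"
    and eigenvalues_K: "distinct_positive_eigenvalues (E ** W ** transpose E)"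
    and potential: "admissible_potential \<Phi> \<Phi>'"
    and m_pos: "m > 0"
    and D_pos: "positive_definite D"
    and t0: "t0 \<ge> 0"
  shows "asymptotically_stable (SO3 \<times> UNIV)
           (error_trajectories m D \<Phi>' E W Um \<Omega>m R t0) t0 (mat 1, 0) \<and>
         dense_open_in (SO3 \<times> UNIV)
           (domain_of_attraction (SO3 \<times> UNIV)
              (error_trajectories m D \<Phi>' E W Um \<Omega>m R t0) t0 (mat 1, 0))"
proof -
  obtain U d where U: "U \<in> SO3" and d: "\<And>i. d$i > 0" and K: "E ** W ** transpose E = U ** dmat d ** transpose U"
    using weight_diagonalises[OF weight] by metis
  obtain lam alpha where lam: "lam > 0" "\<And>x. lam * (norm x)\<^sup>2 \<le> x \<bullet> (D *v x)"
    and alpha: "\<And>x. norm (D *v x) \<le> alpha * norm x"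
    using positive_definite_bounds[OF D_pos] by metis
  \<comment> \<open>\<open>B t\<close> maps body coordinates to the eigenframe of
    \<open>E ** W ** transpose E\<close>, in which the gain is \<open>A t\<close>.\<close>
  define B where "B t = transpose U ** R t" for t
  define A where "A t = B t ** D ** transpose (B t)" for t
  have B: "B t \<in> SO3" if "t \<ge> t0" for t
    unfolding B_def using attitude that t0 by (intro SO3_mult SO3_transpose U) auto
  have dR: "(R has_vector_derivative R t ** skew (\<Omega> t)) (at t within {t0..})" if "t \<ge> t0" for t
    by (rule has_vector_derivative_within_subset[OF kinematics]) (use that t0 in auto)
  have dB: "(B has_vector_derivative B t ** skew (\<Omega> t)) (at t within {t0..})" if "t \<ge> t0" for t
    unfolding B_def
    using bounded_linear.has_vector_derivative[OF
        bounded_bilinear.bounded_linear_right[OF bounded_bilinear_matrix_matrix_mult] dR[OF that]]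
    by (simp add: matrix_mul_assoc)
  have contB: "continuous_on {t0..} B"
    using dB by (auto intro!: continuous_on_vector_derivative)
  interpret observer m lam alpha d A \<Phi> \<Phi>' t0
  proof
    show "m > 0" "lam > 0" "admissible_potential \<Phi> \<Phi>'" "\<And>i. 0 < d$i" by fact+
    show "i = j" if "d$i = d$j" for i j
      by (rule distinct_eigenvalues_inj[OF U _ that]) (use eigenvalues_K K in simp)
    show "continuous_on {t0..} A"
      unfolding A_def by (intro matrix_continuous_intros contB continuous_on_const)
    fix t x assume t: "t0 \<le> t"
    let ?y = "transpose (B t) *v x"
    have y: "norm ?y = norm x" by (rule norm_SO3_mult_vector[OF SO3_transpose[OF B[OF t]]])
    have Ax: "A t *v x = B t *v (D *v ?y)" by (simp only: A_def matrix_vector_mul_assoc matrix_mul_assoc)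
    have "x \<bullet> (A t *v x) = ?y \<bullet> (D *v ?y)"
      unfolding Ax by (simp add: dot_lmul_matrix)
    then show "lam * (norm x)\<^sup>2 \<le> x \<bullet> (A t *v x)" using lam(2)[of ?y] by (simp only: y)
    show "norm (A t *v x) \<le> alpha * norm x"
      unfolding Ax using alpha[of ?y] by (simp only: y norm_SO3_mult_vector[OF B[OF t]])
  qed
  define Tr where "Tr = error_trajectories m D \<Phi>' E W Um \<Omega>m R t0"
  \<comment> \<open>\<open>G t\<close> maps the coordinates \<open>(P, z)\<close> back to the error
    state. For \<open>t >= t0\<close> it is an isometry fixing \<open>(mat 1, 0)\<close>, so
    stability and attraction transfer although its velocity part depends on time.\<close>
  define G where "G t a = (U ** fst a ** transpose U, transpose (B t) *v snd a)" for t and a :: "(real^3^3) \<times> (real^3)"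
  let ?X = "SO3 \<times> (UNIV :: (real^3) set)"
  have BB: "transpose (B t) ** (B t ** Y) = Y" "B t ** (transpose (B t) ** Y) = Y" if "t \<ge> t0" for t and Y :: "real^3^3"
    using SO3_transpose_mult[OF B[OF that]] SO3_mult_transpose[OF B[OF that]] by (simp_all add: matrix_mul_assoc)
  have BBv: "transpose (B t) *v (B t *v v) = v" "B t *v (transpose (B t) *v v) = v" if "t \<ge> t0" for t v
    using SO3_transpose_mult[OF B[OF that]] SO3_mult_transpose[OF B[OF that]]
    by (simp_all only: matrix_vector_mul_assoc matrix_vector_mul_lid)
  have UU: "U ** (transpose U ** Y) = Y" "transpose U ** (U ** Y) = Y" for Y :: "real^3^3"
    using SO3_mult_transpose[OF U] SO3_transpose_mult[OF U] by (simp_all add: matrix_mul_assoc)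
  have R_eq: "R t = U ** B t" for t by (simp add: B_def UU)
  have inputs: "\<Phi>' (U0 E W Rh (Um t)) *\<^sub>R SL (E ** W ** transpose (Um t)) Rh
      = transpose (B t) *v force (B t ** transpose Rh ** U)" if t: "t \<ge> t0" and Rh: "Rh \<in> SO3" for t Rh
  proof -
    have Rt: "R t \<in> SO3" and Um: "Um t = transpose (R t) ** E" using attitude no_noise_Um t t0 by auto
    have PS: "B t ** transpose Rh ** U \<in> SO3" by (intro SO3_mult SO3_transpose B t U Rh)
    have 1: "U0 E W Rh (Um t) = pot d (B t ** transpose Rh ** U)"
      unfolding Um B_def by (rule U0_eq_pot[OF U Rt Rh K])
    have 2: "SL (E ** W ** transpose (Um t)) Rh = transpose (B t) *v torque d (B t ** transpose Rh ** U)"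
      unfolding Um using SL_eq_torque[OF U Rt Rh K]
      by (simp only: B_def matrix_transpose_mul transpose_transpose matrix_vector_mul_assoc)
    show ?thesis
      using pot_nonneg[OF PS] by (simp only: 1 2 force_def max_absorb2 matrix_vector_mult_scaleR)
  qed
  \<comment> \<open>\<open>F1\<close> and its converse \<open>F2\<close> set up a correspondence
    between filter trajectories and solutions. Trajectories are functions on all reals, so they are
    compared only from \<open>t0\<close> on.\<close>
  have F1: "\<exists>P z. sol {t0..} P z \<and> (\<forall>t\<ge>t0. x t = G t (P t, z t))" if xT: "x \<in> Tr" for x
  proof -
    obtain Rh \<omega> where fs: "filter_solution m D \<Phi>' E W Um \<Omega>m t0 Rh \<omega>"
      and x: "x = (\<lambda>t. (R t ** transpose (Rh t), \<omega> t))"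
      using xT by (auto simp: Tr_def error_trajectories_def)
    define P where "P = (\<lambda>t. B t ** transpose (Rh t) ** U)"
    define z where "z = (\<lambda>t. B t *v \<omega> t)"
    have "sol {t0..} P z"
      unfolding sol_def
    proof
      fix t assume "t \<in> {t0..}"
      then have t: "t \<ge> t0" by simp
      let ?Oh = "\<Omega> t - \<omega> t"
      have Om: "\<Omega>m t = \<Omega> t" using no_noise_\<Omega>m t t0 by simp
      obtain \<omega>' where Rh: "Rh t \<in> SO3" and dRh: "(Rh has_vector_derivative Rh t ** skew ?Oh) (at t within {t0..})"
        and d\<omega>: "(\<omega> has_vector_derivative \<omega>') (at t within {t0..})"
        and \<omega>': "m *\<^sub>R \<omega>' = - m *\<^sub>R cross3 ?Oh (\<omega> t)
            + \<Phi>' (U0 E W (Rh t) (Um t)) *\<^sub>R SL (E ** W ** transpose (Um t)) (Rh t) - D *v \<omega> t"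
        using fs t by (auto simp: filter_solution_def Let_def Om)
      have sk: "skew ?Oh = skew (\<Omega> t) - skew (\<omega> t)"
        by (rule linear_diff[OF bounded_linear.linear[OF bounded_linear_skew]])
      have tr: "transpose (Rh t ** skew ?Oh) = (skew (\<omega> t) - skew (\<Omega> t)) ** transpose (Rh t)"
        unfolding matrix_transpose_mul transpose_skew by (simp only: sk minus_diff_eq)
      have "(P has_vector_derivative (B t ** transpose (Rh t)) ** 0
          + (B t ** transpose (Rh t ** skew ?Oh) + (B t ** skew (\<Omega> t)) ** transpose (Rh t)) ** U) (at t within {t0..})"
        unfolding P_def
        by (intro matrix_vector_derivative_intros dB[OF t] dRh has_vector_derivative_const)
      moreover have "(B t ** transpose (Rh t)) ** 0
          + (B t ** transpose (Rh t ** skew ?Oh) + (B t ** skew (\<Omega> t)) ** transpose (Rh t)) ** U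
        = skew (z t) ** P t"
        by (simp add: z_def P_def skew_rotation[OF B[OF t]] tr
            matrix_mult_diff matrix_mult_add matrix_mult_minus matrix_mul_assoc[symmetric] BB[OF t] matrix_mult_0)
      ultimately have dP: "(P has_vector_derivative skew (z t) ** P t) (at t within {t0..})" by simp
      have PS: "P t \<in> SO3" unfolding P_def by (intro SO3_mult SO3_transpose B t U Rh)
      \<comment> \<open>Because \<open>cross3 (\<omega> t) (\<omega> t)\<close> vanishes. This
        gyroscopic term is cancelled by the derivative of \<open>B\<close> in
        \<open>z = B \<omega>\<close>, which is how the angular velocity of the body
        disappears.\<close>
      have cr: "cross3 ?Oh (\<omega> t) = skew (\<Omega> t) *v \<omega> t"
        by (simp add: skew_mult cross3_simps)
      have \<omega>'2: "\<omega>' = (1/m) *\<^sub>R (transpose (B t) *v force (P t) - D *v \<omega> t) - skew (\<Omega> t) *v \<omega> t"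
      proof -
        have "(1/m) *\<^sub>R (m *\<^sub>R \<omega>') = (1/m) *\<^sub>R (- m *\<^sub>R (skew (\<Omega> t) *v \<omega> t) + transpose (B t) *v force (P t) - D *v \<omega> t)"
          unfolding \<omega>' inputs[OF t Rh] cr P_def ..
        then show ?thesis using m_pos by (simp add: algebra_simps)
      qed
      have "(z has_vector_derivative B t *v \<omega>' + (B t ** skew (\<Omega> t)) *v \<omega> t) (at t within {t0..})"
        unfolding z_def by (intro matrix_vector_derivative_intros dB[OF t] d\<omega>)
      moreover have "B t *v \<omega>' + (B t ** skew (\<Omega> t)) *v \<omega> t = (1/m) *\<^sub>R (force (P t) - A t *v z t)"
      proof -
        have "A t *v z t = B t *v (D *v \<omega> t)"
          using BBv(1)[OF t, of "\<omega> t"] by (simp only: A_def z_def matrix_vector_mul_assoc[symmetric])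
        moreover have "B t *v (transpose (B t) *v force (P t)) = force (P t)" by (rule BBv(2)[OF t])
        ultimately show ?thesis
          by (simp only: \<omega>'2 matrix_vector_mult_diff_distrib matrix_vector_mult_scaleR matrix_vector_mul_assoc[symmetric]) simp
      qed
      ultimately show "P t \<in> SO3 \<and> (P has_vector_derivative skew (z t) ** P t) (at t within {t0..}) \<and>
          (z has_vector_derivative (1/m) *\<^sub>R (force (P t) - A t *v z t)) (at t within {t0..})"
        using PS dP by simp
    qed
    moreover have "x t = G t (P t, z t)" if "t \<ge> t0" for t
      using BBv(1)[OF that, of "\<omega> t"] SO3_mult_transpose[OF U]
      by (simp add: x G_def P_def z_def R_eq matrix_mul_assoc[symmetric])
    ultimately show ?thesis by blast
  qed
  have F2: "\<exists>x\<in>Tr. \<forall>t\<ge>t0. x t = G t (P t, z t)" if S: "sol {t0..} P z" for P z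
  proof -
    \<comment> \<open>Obtained by solving \<open>P = B Rh^T U\<close> for \<open>Rh\<close>.\<close>
    define Rh where "Rh = (\<lambda>t. U ** transpose (P t) ** B t)"
    define \<omega> where "\<omega> = (\<lambda>t. transpose (B t) *v z t)"
    have P_eq: "B t ** transpose (Rh t) ** U = P t" if "t \<ge> t0" for t
      using SO3_transpose_mult[OF U]
      by (simp add: Rh_def matrix_transpose_mul matrix_mul_assoc[symmetric] BB[OF that])
    have "filter_solution m D \<Phi>' E W Um \<Omega>m t0 Rh \<omega>"
      unfolding filter_solution_def Let_def
    proof (intro allI impI conjI)
      fix t assume t: "t0 \<le> t"
      have Om: "\<Omega>m t = \<Omega> t" using no_noise_\<Omega>m t t0 by simp
      have dP: "(P has_vector_derivative skew (z t) ** P t) (at t within {t0..})"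
        and dz: "(z has_vector_derivative (1/m) *\<^sub>R (force (P t) - A t *v z t)) (at t within {t0..})"
        and PS: "P t \<in> SO3" using solD[OF S, of t] t by auto
      show Rh: "Rh t \<in> SO3" unfolding Rh_def by (intro SO3_mult SO3_transpose B t U PS)
      have sk: "skew (\<Omega> t - \<omega> t) = skew (\<Omega> t) - transpose (B t) ** skew (z t) ** B t"
        using skew_rotation[OF SO3_transpose[OF B[OF t]], of "z t"]
        by (simp add: \<omega>_def linear_diff[OF bounded_linear.linear[OF bounded_linear_skew]] del: transpose_matrix_vector)
      have "(Rh has_vector_derivative (U ** transpose (P t)) ** (B t ** skew (\<Omega> t))
          + (U ** transpose (skew (z t) ** P t) + 0 ** transpose (P t)) ** B t) (at t within {t0..})"
        unfolding Rh_def
        by (intro matrix_vector_derivative_intros dB[OF t] dP has_vector_derivative_const)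
      moreover have "(U ** transpose (P t)) ** (B t ** skew (\<Omega> t))
          + (U ** transpose (skew (z t) ** P t) + 0 ** transpose (P t)) ** B t = Rh t ** skew (\<Omega>m t - \<omega> t)"
        by (simp add: Rh_def Om sk matrix_transpose_mul transpose_skew
            matrix_mult_diff matrix_mult_add matrix_mult_minus matrix_mul_assoc[symmetric] BB[OF t] matrix_mult_0)
      ultimately show "(Rh has_vector_derivative Rh t ** skew (\<Omega>m t - \<omega> t)) (at t within {t0..})" by simp
      define \<omega>' where "\<omega>' = transpose (B t) *v ((1/m) *\<^sub>R (force (P t) - A t *v z t)) + transpose (B t ** skew (\<Omega> t)) *v z t"
      have "(\<omega> has_vector_derivative \<omega>') (at t within {t0..})"
        unfolding \<omega>_def \<omega>'_def by (intro matrix_vector_derivative_intros dB[OF t] dz)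
      moreover have "m *\<^sub>R \<omega>' = - m *\<^sub>R cross3 (\<Omega>m t - \<omega> t) (\<omega> t)
          + \<Phi>' (U0 E W (Rh t) (Um t)) *\<^sub>R SL (E ** W ** transpose (Um t)) (Rh t) - D *v \<omega> t"
      proof -
        have Az: "transpose (B t) *v (A t *v z t) = D *v \<omega> t"
          using BBv(1)[OF t, of "D *v \<omega> t"] by (simp only: A_def \<omega>_def matrix_vector_mul_assoc[symmetric])
        have neg: "(- X) *v v = - (X *v v)" for X :: "real^3^3" and v
          by (rule bounded_bilinear.minus_left[OF bounded_bilinear_matrix_vector_mult])
        have cr: "cross3 (\<Omega>m t - \<omega> t) (\<omega> t) = skew (\<Omega> t) *v \<omega> t"
          by (simp add: Om skew_mult cross3_simps)
        have "transpose (B t ** skew (\<Omega> t)) *v z t = - (skew (\<Omega> t) *v \<omega> t)"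
          by (simp only: matrix_transpose_mul transpose_skew matrix_mult_minus neg \<omega>_def matrix_vector_mul_assoc)
        then show ?thesis
          unfolding inputs[OF t Rh] P_eq[OF t] cr \<omega>'_def
          using m_pos
          by (simp only: matrix_vector_mult_scaleR matrix_vector_mult_diff_distrib Az scaleR_add_right scaleR_scaleR) simp
      qed
      ultimately show "\<exists>\<omega>'. (\<omega> has_vector_derivative \<omega>') (at t within {t0..}) \<and>
          m *\<^sub>R \<omega>' = - m *\<^sub>R cross3 (\<Omega>m t - \<omega> t) (\<omega> t)
          + \<Phi>' (U0 E W (Rh t) (Um t)) *\<^sub>R SL (E ** W ** transpose (Um t)) (Rh t) - D *v \<omega> t"
        by blast
    qed
    then have mem: "(\<lambda>t. (R t ** transpose (Rh t), \<omega> t)) \<in> Tr"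
      by (auto simp: Tr_def error_trajectories_def)
    have "(R t ** transpose (Rh t), \<omega> t) = G t (P t, z t)" if "t \<ge> t0" for t
      by (simp only: G_def \<omega>_def R_eq Rh_def matrix_transpose_mul transpose_transpose
          matrix_mul_assoc[symmetric] BB[OF that] fst_conv snd_conv)
    then show ?thesis by (intro bexI[OF _ mem]) simp
  qed
  have iso: "dist (G t a) (G t b) = dist a b" if "t \<ge> t0" for t a b
  proof -
    have "U ** fst a ** transpose U - U ** fst b ** transpose U = U ** (fst a - fst b) ** transpose U"
      by (simp add: matrix_mult_diff)
    then have "norm (U ** fst a ** transpose U - U ** fst b ** transpose U) = norm (fst a - fst b)"
      by (simp only: norm_orthogonal_mult_right[OF SO3_transpose[OF U]] norm_orthogonal_mult_left[OF U])
    moreover have "norm (transpose (B t) *v snd a - transpose (B t) *v snd b) = norm (snd a - snd b)"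
      by (simp only: matrix_vector_mult_diff_distrib[symmetric] norm_SO3_mult_vector[OF SO3_transpose[OF B[OF that]]])
    moreover have "dist a b = sqrt ((dist (fst a) (fst b))\<^sup>2 + (dist (snd a) (snd b))\<^sup>2)" by (rule dist_prod_def)
    ultimately show ?thesis unfolding G_def dist_Pair_Pair by (simp only: dist_norm)
  qed
  have G1: "G t (mat 1, 0) = (mat 1, 0)" for t
    using SO3_mult_transpose[OF U] by (simp add: G_def)
  have distG: "dist (G t a) (mat 1, 0) = dist a (mat 1, 0)" if "t \<ge> t0" for t a
    using iso[OF that, of a "(mat 1, 0)"] by (simp only: G1)
  have GX: "G t0 a \<in> ?X" if "a \<in> ?X" for a
    using that by (auto simp: G_def intro!: SO3_mult SO3_transpose U)
  have G_surj: "\<exists>a\<in>?X. G t0 a = x" if "x \<in> ?X" for x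
  proof (intro bexI)
    show "G t0 (transpose U ** fst x ** U, B t0 *v snd x) = x"
      using BBv(1)[OF order_refl, of "snd x"] SO3_mult_transpose[OF U]
      by (simp add: G_def matrix_mul_assoc[symmetric] UU)
    show "(transpose U ** fst x ** U, B t0 *v snd x) \<in> ?X"
      using that by (auto intro!: SO3_mult SO3_transpose U)
  qed
  have conv: "(x \<longlongrightarrow> (mat 1, 0)) at_top \<longleftrightarrow> ((\<lambda>t. (P t, z t)) \<longlongrightarrow> (mat 1, 0)) at_top"
    if "\<forall>t\<ge>t0. x t = G t (P t, z t)" for x P z
  proof -
    have "\<forall>\<^sub>F t in at_top. dist (x t) (mat 1, 0) = dist (P t, z t) (mat 1, 0)"
      using eventually_ge_at_top[of t0] by eventually_elim (use that distG in simp)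
    then have "(\<forall>\<^sub>F t in at_top. dist (x t) (mat 1, 0) < e) \<longleftrightarrow> (\<forall>\<^sub>F t in at_top. dist (P t, z t) (mat 1, 0) < e)" for e
      by (rule eventually_subst[OF eventually_mono]) simp
    then show ?thesis by (simp add: tendsto_iff)
  qed
  \<comment> \<open>\<open>G t0\<close> is injective, being an isometry.\<close>
  have init: "(P t0, z t0) = a" if "G t0 (P t0, z t0) = G t0 a" for P z and a :: "(real^3^3) \<times> (real^3)"
    using iso[OF order_refl, of "(P t0, z t0)" a] that by simp
  have ex: "\<exists>P z. sol {t0..} P z \<and> (P t0, z t0) = a" if "a \<in> ?X" for a
    using forward_exists[OF order_refl, of "fst a" "snd a"] that by (metis mem_Times_iff prod.collapse)
  let ?DoA = "domain_of_attraction ?X Tr t0 (mat 1, 0)"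
  have DoA: "G t0 a \<in> ?DoA \<longleftrightarrow> a \<in> basin" if a: "a \<in> ?X" for a
  proof
    assume GD: "G t0 a \<in> ?DoA"
    have "(P \<longlongrightarrow> mat 1) at_top" if S: "sol {t0..} P z" and "(P t0, z t0) = a" for P z
    proof -
      obtain x where x: "x \<in> Tr" "\<forall>t\<ge>t0. x t = G t (P t, z t)" using F2[OF S] by blast
      then have "(x \<longlongrightarrow> (mat 1, 0)) at_top"
        using GD that(2) by (auto simp: domain_of_attraction_def)
      then have "((\<lambda>t. fst (P t, z t)) \<longlongrightarrow> fst (mat 1 :: real^3^3, 0 :: real^3)) at_top"
        unfolding conv[OF x(2)] by (rule tendsto_fst)
      then show ?thesis by simp
    qed
    then show "a \<in> basin" using a by (auto simp: basin_def)
  next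
    assume ab: "a \<in> basin"
    have "\<exists>x\<in>Tr. x t0 = G t0 a"
      using ex[OF a] F2 by (metis order_refl)
    moreover have "(x \<longlongrightarrow> (mat 1, 0)) at_top" if xT: "x \<in> Tr" and x0: "x t0 = G t0 a" for x
    proof -
      obtain P z where S: "sol {t0..} P z" and x: "\<forall>t\<ge>t0. x t = G t (P t, z t)" using F1[OF xT] by blast
      have "(P t0, z t0) = a" by (rule init) (use x x0 in simp)
      then have "(P \<longlongrightarrow> mat 1) at_top" using ab S by (auto simp: basin_def)
      then show ?thesis
        unfolding conv[OF x] by (intro tendsto_Pair z_tendsto_0[OF S order_refl])
    qed
    ultimately show "G t0 a \<in> ?DoA" using GX[OF a] by (auto simp: domain_of_attraction_def)
  qed
  \<comment> \<open>The isometry \<open>G t0\<close> is onto, so it carries a ball in the basin to a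
    ball in the domain of attraction. This yields local attraction, with \<open>a\<close> the
    identity state, as well as openness.\<close>
  have DoA_ball: "\<exists>e>0. \<forall>x\<in>?X. dist x (G t0 a) < e \<longrightarrow> x \<in> ?DoA" if ab: "a \<in> basin" for a
  proof -
    obtain e where "e > 0" and e: "\<And>b. b \<in> ?X \<Longrightarrow> dist b a < e \<Longrightarrow> b \<in> basin"
      using open_basin[unfolded openin_euclidean_subtopology_iff, THEN conjunct2, THEN bspec, OF ab] by blast
    have "x \<in> ?DoA" if "x \<in> ?X" and near: "dist x (G t0 a) < e" for x
    proof -
      obtain b where "b \<in> ?X" "G t0 b = x" using G_surj[OF \<open>x \<in> ?X\<close>] by blast
      then show ?thesis using e[of b] DoA[of b] iso[OF order_refl, of b a] near by simp
    qed
    then show ?thesis using \<open>e > 0\<close> by blast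
  qed
  have "lyapunov_stable ?X Tr t0 (mat 1, 0)"
    unfolding lyapunov_stable_def
  proof (intro allI impI)
    fix \<epsilon> :: real assume "\<epsilon> > 0"
    then obtain \<delta> where "\<delta> > 0" and \<delta>: "\<And>a P z t. sol {a..} P z \<Longrightarrow> t0 \<le> a \<Longrightarrow> dist (P a, z a) (mat 1, 0) < \<delta> \<Longrightarrow> a \<le> t \<Longrightarrow>
        dist (P t, z t) (mat 1, 0) < \<epsilon>"
      using stable by metis
    have key: "(\<exists>x\<in>Tr. x t0 = x0) \<and> (\<forall>x\<in>Tr. x t0 = x0 \<longrightarrow> (\<forall>t\<ge>t0. dist (x t) (mat 1, 0) < \<epsilon>))"
      if x0: "x0 \<in> ?X" "dist x0 (mat 1, 0) < \<delta>" for x0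
    proof (intro conjI ballI impI allI)
      obtain a where a: "a \<in> ?X" "G t0 a = x0" using G_surj[OF x0(1)] by blast
      then show "\<exists>x\<in>Tr. x t0 = x0" using ex[OF a(1)] F2 by (metis order_refl)
      fix x t assume "x \<in> Tr" "x t0 = x0" "t0 \<le> t"
      obtain P z where S: "sol {t0..} P z" and x: "\<forall>t\<ge>t0. x t = G t (P t, z t)" using F1[OF \<open>x \<in> Tr\<close>] by blast
      have "dist (P t0, z t0) (mat 1, 0) < \<delta>"
        using distG[OF order_refl, of "(P t0, z t0)"] x x0(2) \<open>x t0 = x0\<close> by simp
      from \<delta>[OF S order_refl this \<open>t0 \<le> t\<close>] show "dist (x t) (mat 1, 0) < \<epsilon>"
        using distG[OF \<open>t0 \<le> t\<close>, of "(P t, z t)"] x \<open>t0 \<le> t\<close> by simp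
    qed
    show "\<exists>\<delta>>0. \<forall>x0\<in>?X. dist x0 (mat 1, 0) < \<delta> \<longrightarrow>
        (\<exists>x\<in>Tr. x t0 = x0) \<and> (\<forall>x\<in>Tr. x t0 = x0 \<longrightarrow> (\<forall>t\<ge>t0. dist (x t) (mat 1, 0) < \<epsilon>))"
      by (rule exI[of _ \<delta>], rule conjI[OF \<open>\<delta> > 0\<close>], rule ballI, rule impI, rule key)
  qed
  moreover have "(mat 1, 0) \<in> basin"
  proof -
    obtain P z where S: "sol {t0..} P z" "P t0 = mat 1" "z t0 = 0"
      using forward_exists[OF order_refl mat_1_SO3] by blast
    have "\<Phi> (4 * d_min) > 0"
      using \<Phi>_strict_mono[of 0 "4 * d_min"] \<Phi>_zero d_min(1) by simp
    then show ?thesis using low_energy_basin[OF S(1) order_refl] S by simp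
  qed
  then have "\<exists>c>0. \<forall>x0\<in>?X. dist x0 (mat 1, 0) < c \<longrightarrow> x0 \<in> ?DoA"
    using DoA_ball[of "(mat 1, 0)"] by (simp only: G1)
  moreover have "openin (top_of_set ?X) ?DoA"
    unfolding openin_euclidean_subtopology_iff
  proof (intro conjI ballI)
    show "?DoA \<subseteq> ?X" by (auto simp: domain_of_attraction_def)
    fix x assume x: "x \<in> ?DoA"
    then have "x \<in> ?X" by (auto simp: domain_of_attraction_def)
    then obtain a where a: "a \<in> ?X" "G t0 a = x" using G_surj by blast
    then have "a \<in> basin" using DoA[OF a(1)] x by simp
    from DoA_ball[OF this] show "\<exists>e>0. \<forall>x'\<in>?X. dist x' x < e \<longrightarrow> x' \<in> ?DoA" by (simp only: a)
  qed
  moreover have "?X \<subseteq> closure ?DoA"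
  proof
    fix x assume "x \<in> ?X"
    then obtain a where a: "a \<in> ?X" "G t0 a = x" using G_surj by blast
    have "\<exists>y\<in>?DoA. dist y x < e" if ep: "e > 0" for e
    proof -
      have "a \<in> closure basin" using dense_basin a(1) by blast
      then obtain b where b: "b \<in> basin" "dist b a < e" using ep unfolding closure_approachable by blast
      then have "G t0 b \<in> ?DoA" using DoA[of b] by (auto simp: basin_def)
      moreover have "dist (G t0 b) x < e" using iso[OF order_refl, of b a] a b by simp
      ultimately show ?thesis by blast
    qed
    then show "x \<in> closure ?DoA" by (simp add: closure_approachable)
  qed
  ultimately show ?thesis
    unfolding Tr_def asymptotically_stable_def dense_open_in_def by blast
qed

end
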